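(* Fix a positive integer $p$ and $c\in(0,1)$. For positive integers $n,m$ with $n/m=c$ and $p<n(m-n+1)$, let $\kappa_{W_0,p}$ be the $p$th cumulant of $W_0$. Let the coefficients $\beta_{r,j}(c)$ ($r\ge1$, $j\ge0$) be as defined in the context, and define $\alpha_{1,j}(c)=\beta_{1,j}(c)$ for $j\ge0$ and, recursively for $p\ge2$ and $j\ge0$, $$\alpha_{p,j}(c)=\beta_{p,p-1+j}(c)-\sum_{r=1}^{p-1}\binom{p-1}{r-1}\sum_{\ell=0}^{p-r+j}\alpha_{r,\ell}(c)\,\beta_{p-r,\,p-r+j-\ell}(c).$$ Then $\kappa_{W_0,p}$ admits the asymptotic expansion $$\kappa_{W_0,p}\sim\sum_{j=0}^\infty\frac{\alpha_{p,j}(c)}{n^{2(p-1+j)}}$$ as $n\to\infty$ with $n/m=c$ fixed; that is, for every integer $N\ge0$, $\kappa_{W_0,p}=\sum_{j=0}^N\alpha_{p,j}(c)\,n^{-2(p-1+j)}+O\left(n^{-2(p+N)}\right)$.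
   Context: $W_0=\frac{\frac1n\operatorname{Tr}(\mathbf{X}\mathbf{X}^\dagger)}{\det(\mathbf{X}\mathbf{X}^\dagger)^{1/n}}$, where $\mathbf{X}$ is an $n\times m$ random matrix whose columns are independent circularly symmetric complex Gaussian vectors in $\mathbb{C}^n$ with mean zero and covariance $N_0\mathbf{I}_n$, for some $N_0>0$ (the law of $W_0$ does not depend on $N_0$). Cumulants are defined from the moments $\mu_{W_0,p}=\mathrm{E}[W_0^p]$ by $\kappa_{W_0,1}=\mu_{W_0,1}$ and $\kappa_{W_0,p}=\mu_{W_0,p}-\sum_{\ell=1}^{p-1}\binom{p-1}{\ell-1}\kappa_{W_0,\ell}\,\mu_{W_0,p-\ell}$ for $p\ge2$. Coefficients $\beta_{p,j}(c)$: for $p\ge1$ let $$A_{p,0}(c)=p-p\left(1-\tfrac1c\right)\log(1-c),$$ $$A_{p,1}(c)=-\frac{p^2}{2}\log(1-c)+\frac{cp\left(12-11c+6(1-p)(c-1)\right)}{12(c-1)},$$ and, for integers $q>1$, $$A_{p,q}(c)=\frac{(cp)^q\left(c+12p-12cp-cq^2\right)}{12cq(q^2-1)(1-c)^q}+\frac{(cp)^q\left(-12p+c(q^2-1)\right)}{12cq(q^2-1)}-\frac{c^q}{q}H_{p,-q}+\sum_{j=1}^{q-1}\frac{B_{2j+2}\,c^{2j}\,(2j)_{q-j}\,(pc)^{q-j}}{4j(j+1)(q-j)!}\left(1-(1-c)^{-j-q}\right),$$ where $H_{p,-q}=\sum_{j=1}^p j^q$, $B_k$ are the Bernoulli numbers,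 $(a)_r=a(a+1)\cdots(a+r-1)$, and $\log$ is the natural logarithm. Then $\beta_{p,0}(c)=e^{A_{p,0}(c)}$ and, for $j>0$, $$\beta_{p,j}(c)=e^{A_{p,0}(c)}\sum_{i_1+2i_2+\dots+j\,i_j=j}\ \prod_{r=1}^{j}\frac{A_{p,r}(c)^{i_r}}{i_r!},$$ the sum being over nonnegative integer solutions $(i_1,\dots,i_j)$. *)

theory Defs
  imports
    "HOL-Probability.Probability"
    "HOL-Library.Landau_Symbols"
    "Jordan_Normal_Form.Schur_Decomposition"
begin

no_notation vec_nth (infixl "$" 90)

declare sum.cong [fundef_cong]

section \<open>Circularly symmetric complex Gaussian vectors and matrices\<close>

text \<open>The degenerate law (variance 0) counts as normal, as needed for the definition of jointly
  Gaussian vectors through linear combinations.\<close>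

definition normal_rv :: "'w measure \<Rightarrow> ('w \<Rightarrow> real) \<Rightarrow> bool" where
  "normal_rv M Y \<longleftrightarrow> Y \<in> borel_measurable M \<and>
     (\<exists>\<mu> \<sigma>. \<sigma> \<ge> 0 \<and> distr M borel Y =
        (if \<sigma> = 0 then return borel \<mu> else density lborel (normal_density \<mu> \<sigma>)))"

text \<open>The type of vectors carries no sigma-algebra, so a random vector in $\mathbb{C}^n$ is observed
  through its coordinate function, a point of the product space.\<close>

definition coords :: "nat \<Rightarrow> complex vec \<Rightarrow> nat \<Rightarrow> complex" where
  "coords n v = (\<lambda>i\<in>{..<n}. v $ i)"

definition coord_space :: "nat \<Rightarrow> (nat \<Rightarrow> complex) measure" where
  "coord_space n = (\<Pi>\<^sub>M i\<in>{..<n}. borel)"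

definition random_vec :: "'w measure \<Rightarrow> nat \<Rightarrow> ('w \<Rightarrow> complex vec) \<Rightarrow> bool" where
  "random_vec M n Z \<longleftrightarrow>
     (\<forall>\<omega>\<in>space M. Z \<omega> \<in> carrier_vec n) \<and> (\<lambda>\<omega>. coords n (Z \<omega>)) \<in> measurable M (coord_space n)"

text \<open>Joint normality of the $2n$ real and imaginary parts.\<close>

definition complex_gaussian_vec :: "'w measure \<Rightarrow> nat \<Rightarrow> ('w \<Rightarrow> complex vec) \<Rightarrow> bool" where
  "complex_gaussian_vec M n Z \<longleftrightarrow> random_vec M n Z \<and>
     (\<forall>a b :: nat \<Rightarrow> real.
        normal_rv M (\<lambda>\<omega>. \<Sum>i<n. a i * Re (Z \<omega> $ i) + b i * Im (Z \<omega> $ i)))"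

definition circularly_symmetric :: "'w measure \<Rightarrow> nat \<Rightarrow> ('w \<Rightarrow> complex vec) \<Rightarrow> bool" where
  "circularly_symmetric M n Z \<longleftrightarrow>
     (\<forall>\<theta>. distr M (coord_space n) (\<lambda>\<omega>. coords n (cis \<theta> \<cdot>\<^sub>v Z \<omega>)) =
          distr M (coord_space n) (\<lambda>\<omega>. coords n (Z \<omega>)))"

definition mean_vec :: "'w measure \<Rightarrow> nat \<Rightarrow> ('w \<Rightarrow> complex vec) \<Rightarrow> complex vec" where
  "mean_vec M n Z = vec n (\<lambda>i. \<integral>\<omega>. Z \<omega> $ i \<partial>M)"

definition covariance_mat :: "'w measure \<Rightarrow> nat \<Rightarrow> ('w \<Rightarrow> complex vec) \<Rightarrow> complex mat" where
  "covariance_mat M n Z = mat n n (\<lambda>(i, k).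
     \<integral>\<omega>. (Z \<omega> $ i - mean_vec M n Z $ i) * cnj (Z \<omega> $ k - mean_vec M n Z $ k) \<partial>M)"

definition gaussian_matrix ::
  "'w measure \<Rightarrow> nat \<Rightarrow> nat \<Rightarrow> real \<Rightarrow> ('w \<Rightarrow> complex mat) \<Rightarrow> bool" where
  "gaussian_matrix M n m N0 X \<longleftrightarrow>
     prob_space M \<and>
     (\<forall>\<omega>\<in>space M. X \<omega> \<in> carrier_mat n m) \<and>
     prob_space.indep_vars M (\<lambda>_. coord_space n) (\<lambda>j \<omega>. coords n (col (X \<omega>) j)) {..<m} \<and>
     (\<forall>j<m. complex_gaussian_vec M n (\<lambda>\<omega>. col (X \<omega>) j) \<and>
            circularly_symmetric M n (\<lambda>\<omega>. col (X \<omega>) j) \<and>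
            mean_vec M n (\<lambda>\<omega>. col (X \<omega>) j) = 0\<^sub>v n \<and>
            covariance_mat M n (\<lambda>\<omega>. col (X \<omega>) j) = complex_of_real N0 \<cdot>\<^sub>m 1\<^sub>m n)"


section \<open>The statistic and its cumulants\<close>

definition mat_trace :: "complex mat \<Rightarrow> complex" where
  "mat_trace A = (\<Sum>i<dim_row A. A $$ (i, i))"

text \<open>Trace and determinant of $XX^\dagger$ are real and nonnegative, so taking real parts loses
  nothing. On the null event of a singular $XX^\dagger$ the quotient is 0.\<close>

definition W0 :: "complex mat \<Rightarrow> real" where
  "W0 X = (let n = dim_row X; S = X * mat_adjoint X
           in (1 / real n * Re (mat_trace S)) / root n (Re (det S)))"

definition moment :: "'w measure \<Rightarrow> ('w \<Rightarrow> real) \<Rightarrow> nat \<Rightarrow> real" where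
  "moment M Y p = (\<integral>\<omega>. Y \<omega> ^ p \<partial>M)"

text \<open>Meaningful for index \<open>p \<ge> 1\<close>; the sum is empty for \<open>p = 1\<close>.\<close>

fun cumulant :: "(nat \<Rightarrow> real) \<Rightarrow> nat \<Rightarrow> real" where
  "cumulant \<mu> p = \<mu> p - (\<Sum>l = 1..p - 1. real ((p - 1) choose (l - 1)) * cumulant \<mu> l * \<mu> (p - l))"

declare cumulant.simps [simp del]


section \<open>Coefficients of the expansion\<close>

text \<open>Bernoulli numbers with \<open>B\<^sub>1 = - 1 / 2\<close>; only those of even index are used below.\<close>

fun bernoulli :: "nat \<Rightarrow> real" where
  "bernoulli n = (if n = 0 then 1
     else - (\<Sum>k = 0..n - 1. real ((n + 1) choose k) * bernoulli k) / real (n + 1))"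

declare bernoulli.simps [simp del]

definition A_coeff :: "nat \<Rightarrow> nat \<Rightarrow> real \<Rightarrow> real" where
  "A_coeff p q c =
     (if q = 0 then real p - real p * (1 - 1 / c) * ln (1 - c)
      else if q = 1 then
        - ((real p)\<^sup>2 / 2) * ln (1 - c)
        + c * real p * (12 - 11 * c + 6 * (1 - real p) * (c - 1)) / (12 * (c - 1))
      else
        (c * real p) ^ q * (c + 12 * real p - 12 * c * real p - c * (real q)\<^sup>2)
          / (12 * c * real q * ((real q)\<^sup>2 - 1) * (1 - c) ^ q)
        + (c * real p) ^ q * (- 12 * real p + c * ((real q)\<^sup>2 - 1))
          / (12 * c * real q * ((real q)\<^sup>2 - 1))
        - c ^ q / real q * (\<Sum>j = 1..p. real j ^ q)
        + (\<Sum>j = 1..q - 1.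
             bernoulli (2 * j + 2) * c ^ (2 * j) * pochhammer (real (2 * j)) (q - j)
               * (real p * c) ^ (q - j)
             / (4 * real j * (real j + 1) * fact (q - j))
             * (1 - 1 / (1 - c) ^ (j + q))))"

definition beta_coeff :: "nat \<Rightarrow> nat \<Rightarrow> real \<Rightarrow> real" where
  "beta_coeff p j c =
     (if j = 0 then exp (A_coeff p 0 c)
      else exp (A_coeff p 0 c) *
        (\<Sum>i \<in> {i \<in> {1..j} \<rightarrow>\<^sub>E (UNIV :: nat set). (\<Sum>r = 1..j. r * i r) = j}.
           \<Prod>r = 1..j. A_coeff p r c ^ i r / fact (i r)))"

text \<open>Meaningful for \<open>p \<ge> 1\<close>; for \<open>p = 1\<close> the outer sum is empty and the value is
  \<open>beta_coeff 1 j c\<close>.\<close>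

fun alpha_coeff :: "nat \<Rightarrow> nat \<Rightarrow> real \<Rightarrow> real" where
  "alpha_coeff p j c = beta_coeff p (p - 1 + j) c -
     (\<Sum>r = 1..p - 1. real ((p - 1) choose (r - 1)) *
        (\<Sum>l = 0..p - r + j. alpha_coeff r l c * beta_coeff (p - r) (p - r + j - l) c))"

declare alpha_coeff.simps [simp del]

end

theory Submission
  imports Defs "HOL-Real_Asymp.Real_Asymp"
begin

text \<open>The argument has an exact half, which computes the moments of $W_0$, and an asymptotic half,
which turns the formula for the moments into the expansion of the cumulants.

\<^bold>\<open>Exact half.\<close> A vector with circularly symmetric Gaussian law, mean $0$ and covariance $N_0 I$ has
the characteristic function of independent complex Gaussian coordinates; since a characteristic
function determines a joint law (\<open>joint_law_eqI\<close>), the entries of $X/\sqrt{N_0}$ are independent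
standard complex Gaussians (\<open>gaussian_matrix_distr\<close>). Let $T$ be the sum of the squared moduli
of the entries and $D$ the Gram determinant of the rows. A unitary rotation of all rows, chosen so
that the last row becomes a multiple of the last unit vector, changes neither $T$, nor $D$, nor the
law of the other rows, and splits off the squared norm of the last row as a factor of $D$ and as a
summand of $T$. Induction on the number of rows gives
$E[T^p D^{-s}] = \prod_{k<n} \Gamma(m-k-s)/\Gamma(m-k) \cdot (n(m-s))_p$
(\<open>gamma_moments_gram_det\<close>), and $s = p/n$ yields the moments of $W_0$ (\<open>moment_W0\<close>), whose
logarithms are \<open>log_moment\<close>.

\<^bold>\<open>Asymptotic half.\<close> The sum of $\ln\Gamma(m-k-p/n) - \ln\Gamma(m-k)$ over $k < n$ telescopes up to
a negligible error once $\ln\Gamma$ is written as a first difference of an explicit function, the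
truncated expansion \<open>barnes\<close> of the logarithm of Barnes' $G$-function. That this function has the
right difference is a Bernoulli number identity (\<open>bernoulli_even_convolution\<close>). At the arguments
$m$, $m-n$, $m-p/n$ and $m-n-p/n$ every term is a power series in $n^{-2}$ or cancels, and the
coefficients are those of \<open>A_coeff\<close> (\<open>log_moment_series\<close>). Exponentiation turns them into
\<open>beta_coeff\<close> (\<open>moment_series\<close>), and the recursion for cumulants turns these into \<open>alpha_coeff\<close>,
provided that the coefficients below order $n^{-2(p-1)}$ vanish.

\<^bold>\<open>Cancellation.\<close> This last point does not follow from the recursion. It rests on a
combinatorial formula. If $\mu_b = \prod_S (1+w_{|S|})$ over the nonempty subsets $S$ of a $b$-element
set, then expanding the product gives a sum over families of subsets, and the $p$th cumulant is the
part of the sum coming from the connected families on $p$ points (\<open>cumulant_eq_sum_connected\<close>).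
Here $\ln(1+w_k)$ is the $k$th finite difference of $b \mapsto \ln \mu_b$ at $0$. Because the
coefficient of $n^{-2q}$ in $\ln \mu_b$ is a polynomial in $b$ of degree at most $q+1$
(\<open>A_coeff_polynomial\<close>), $w_k$ is of order $n^{-2(k-1)}$. A connected family on $p$ points satisfies
$\sum_S (|S|-1) \ge p-1$, so that every term of the cumulant is of order $n^{-2(p-1)}$
(\<open>cumulant_bigo\<close>).\<close>

section \<open>Asymptotic series in powers of a small quantity\<close>

text \<open>The coefficients are kept as a formal power series, so that sums, products and
substitutions of asymptotic series become the operations on formal power series. The same notion
with \<open>F = nhds 0\<close> and \<open>e\<close> the identity covers Taylor expansions at $0$.\<close>

definition asymp_series :: "'a filter \<Rightarrow> ('a \<Rightarrow> real) \<Rightarrow> ('a \<Rightarrow> real) \<Rightarrow> real fps \<Rightarrow> bool" where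
  "asymp_series F e f A \<longleftrightarrow>
     (\<forall>N. (\<lambda>x. f x - (\<Sum>k<N. fps_nth A k * e x ^ k)) \<in> O[F](\<lambda>x. e x ^ N))"

lemma asymp_seriesD:
  "asymp_series F e f A \<Longrightarrow> (\<lambda>x. f x - (\<Sum>k<N. fps_nth A k * e x ^ k)) \<in> O[F](\<lambda>x. e x ^ N)"
  by (simp add: asymp_series_def)

locale asymptotic_scale =
  fixes F :: "'a filter" and e :: "'a \<Rightarrow> real"
  assumes scale_tendsto_0: "(e \<longlongrightarrow> 0) F"
begin

lemma scale_power_mono: "M \<le> N \<Longrightarrow> (\<lambda>x. e x ^ N) \<in> O[F](\<lambda>x. e x ^ M)"
proof (rule bigoI[where c = 1])
  assume "M \<le> N"
  have "eventually (\<lambda>x. \<bar>e x\<bar> < 1) F"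
    using tendstoD[OF scale_tendsto_0, of 1] by simp
  thus "eventually (\<lambda>x. norm (e x ^ N) \<le> 1 * norm (e x ^ M)) F"
    by eventually_elim (use \<open>M \<le> N\<close> in \<open>auto simp: power_abs intro!: power_decreasing\<close>)
qed

lemma series_bounded: assumes "asymp_series F e f A" shows "f \<in> O[F](\<lambda>_. 1)"
  using asymp_seriesD[OF assms, of 0] by simp

lemma partial_sum_bounded: "(\<lambda>x. \<Sum>k<N. a k * e x ^ k) \<in> O[F](\<lambda>_. 1)"
proof (rule big_sum_in_bigo)
  fix k
  show "(\<lambda>x. a k * e x ^ k) \<in> O[F](\<lambda>_. 1)"
    using scale_power_mono[of 0 k] by (cases "a k = 0") simp_all
qed

text \<open>A truncation at a higher order than the error bound suffices, because the
additional terms are themselves within the error bound.\<close>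

lemma asymp_seriesI:
  assumes "\<And>N. \<exists>N'\<ge>N. (\<lambda>x. f x - (\<Sum>k<N'. fps_nth A k * e x ^ k)) \<in> O[F](\<lambda>x. e x ^ N)"
  shows "asymp_series F e f A"
  unfolding asymp_series_def
proof
  fix N
  obtain N' where N': "N' \<ge> N" "(\<lambda>x. f x - (\<Sum>k<N'. fps_nth A k * e x ^ k)) \<in> O[F](\<lambda>x. e x ^ N)"
    using assms by blast
  have "(\<lambda>x. \<Sum>k\<in>{N..<N'}. fps_nth A k * e x ^ k) \<in> O[F](\<lambda>x. e x ^ N)"
  proof (rule big_sum_in_bigo)
    fix k assume "k \<in> {N..<N'}"
    thus "(\<lambda>x. fps_nth A k * e x ^ k) \<in> O[F](\<lambda>x. e x ^ N)"
      using scale_power_mono[of N k] by (cases "fps_nth A k = 0") simp_all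
  qed
  note bound = sum_in_bigo(1)[OF N'(2) this]
  have split: "{..<N'} = {..<N} \<union> {N..<N'}" using N' by auto
  have "(\<lambda>x. f x - (\<Sum>k<N'. fps_nth A k * e x ^ k) + (\<Sum>k\<in>{N..<N'}. fps_nth A k * e x ^ k)) =
        (\<lambda>x. f x - (\<Sum>k<N. fps_nth A k * e x ^ k))"
    unfolding split by (subst sum.union_disjoint) auto
  with bound show "(\<lambda>x. f x - (\<Sum>k<N. fps_nth A k * e x ^ k)) \<in> O[F](\<lambda>x. e x ^ N)"
    by simp
qed

lemma series_cong:
  assumes "asymp_series F e f A" "eventually (\<lambda>x. f x = g x) F"
  shows "asymp_series F e g A"
  unfolding asymp_series_def
proof
  fix N
  have "eventually (\<lambda>x. f x - (\<Sum>k<N. fps_nth A k * e x ^ k) = g x - (\<Sum>k<N. fps_nth A k * e x ^ k)) F"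
    using assms(2) by eventually_elim simp
  from landau_o.big.in_cong[OF this] show "(\<lambda>x. g x - (\<Sum>k<N. fps_nth A k * e x ^ k)) \<in> O[F](\<lambda>x. e x ^ N)"
    using asymp_seriesD[OF assms(1), of N] by simp
qed

lemma series_add:
  assumes "asymp_series F e f A" "asymp_series F e g B"
  shows "asymp_series F e (\<lambda>x. f x + g x) (A + B)"
  unfolding asymp_series_def
proof
  fix N
  from sum_in_bigo(1)[OF assms[THEN asymp_seriesD, of N]]
  show "(\<lambda>x. f x + g x - (\<Sum>k<N. fps_nth (A + B) k * e x ^ k)) \<in> O[F](\<lambda>x. e x ^ N)"
    by (simp add: algebra_simps sum.distrib)
qed

lemma series_cmult:
  assumes "asymp_series F e f A"
  shows "asymp_series F e (\<lambda>x. c * f x) (fps_const c * A)"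
  unfolding asymp_series_def
proof
  fix N
  have "(\<lambda>x. c * (f x - (\<Sum>k<N. fps_nth A k * e x ^ k))) \<in> O[F](\<lambda>x. e x ^ N)"
    using asymp_seriesD[OF assms, of N] by (cases "c = 0") simp_all
  thus "(\<lambda>x. c * f x - (\<Sum>k<N. fps_nth (fps_const c * A) k * e x ^ k)) \<in> O[F](\<lambda>x. e x ^ N)"
    by (simp add: algebra_simps sum_distrib_left)
qed

lemma series_minus:
  assumes "asymp_series F e f A" shows "asymp_series F e (\<lambda>x. - f x) (- A)"
  using series_cmult[OF assms, of "-1"] by (simp flip: fps_const_neg)

lemma series_diff:
  assumes "asymp_series F e f A" "asymp_series F e g B"
  shows "asymp_series F e (\<lambda>x. f x - g x) (A - B)"
  using series_add[OF assms(1) series_minus[OF assms(2)]] by simp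

lemma series_scale_power: "asymp_series F e (\<lambda>x. e x ^ n) (fps_X ^ n)"
proof (rule asymp_seriesI)
  fix N
  have "(\<Sum>k<N + Suc n. fps_nth (fps_X ^ n) k * e x ^ k) = e x ^ n" for x
    by (subst sum.remove[of _ n]) (auto simp: fps_X_power_nth intro!: sum.neutral)
  thus "\<exists>N'\<ge>N. (\<lambda>x. e x ^ n - (\<Sum>k<N'. fps_nth (fps_X ^ n) k * e x ^ k)) \<in> O[F](\<lambda>x. e x ^ N)"
    by (intro exI[of _ "N + Suc n"]) simp
qed

lemma series_const: "asymp_series F e (\<lambda>x. c) (fps_const c)"
  using series_cmult[OF series_scale_power[of 0], of c] by simp

lemma series_scale: "asymp_series F e e fps_X"
  using series_scale_power[of 1] by simp

lemma series_mult:
  assumes f: "asymp_series F e f A" and g: "asymp_series F e g B"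
  shows "asymp_series F e (\<lambda>x. f x * g x) (A * B)"
  unfolding asymp_series_def
proof
  fix N
  define P where "P = (\<lambda>x. \<Sum>k<N. fps_nth A k * e x ^ k)"
  define Q where "Q = (\<lambda>x. \<Sum>k<N. fps_nth B k * e x ^ k)"
  define I where "I = {ij \<in> {..<N} \<times> {..<N}. fst ij + snd ij < N}"
  define J where "J = {ij \<in> {..<N} \<times> {..<N}. fst ij + snd ij \<ge> N}"
  define t where "t = (\<lambda>ij x. fps_nth A (fst ij) * fps_nth B (snd ij) * e x ^ (fst ij + snd ij))"
  have fin: "finite I" "finite J" by (auto simp: I_def J_def)
  have PQ: "P x * Q x = (\<Sum>ij\<in>I. t ij x) + (\<Sum>ij\<in>J. t ij x)" for x
  proof -
    have "P x * Q x = (\<Sum>ij\<in>{..<N} \<times> {..<N}. t ij x)"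
      by (simp add: P_def Q_def t_def sum_product sum.cartesian_product case_prod_beta power_add mult_ac)
    also have "{..<N} \<times> {..<N} = I \<union> J" by (auto simp: I_def J_def)
    also have "(\<Sum>ij\<in>I \<union> J. t ij x) = (\<Sum>ij\<in>I. t ij x) + (\<Sum>ij\<in>J. t ij x)"
      by (rule sum.union_disjoint) (use fin in \<open>auto simp: I_def J_def\<close>)
    finally show ?thesis .
  qed
  have AB: "(\<Sum>k<N. fps_nth (A * B) k * e x ^ k) = (\<Sum>ij\<in>I. t ij x)" for x
  proof -
    have "(\<Sum>k<N. fps_nth (A * B) k * e x ^ k) =
          (\<Sum>k<N. \<Sum>i=0..k. fps_nth A i * fps_nth B (k - i) * e x ^ k)"
      by (simp add: fps_mult_nth sum_distrib_right)
    also have "\<dots> = (\<Sum>(k,i)\<in>(SIGMA k:{..<N}. {0..k}). fps_nth A i * fps_nth B (k - i) * e x ^ k)"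
      by (subst sum.Sigma) auto
    also have "\<dots> = (\<Sum>ij\<in>I. t ij x)"
      by (rule sum.reindex_bij_witness[of _ "\<lambda>ij. (fst ij + snd ij, fst ij)" "\<lambda>(k,i). (i, k - i)"])
         (auto simp: I_def t_def)
    finally show ?thesis .
  qed
  have J: "(\<lambda>x. \<Sum>ij\<in>J. t ij x) \<in> O[F](\<lambda>x. e x ^ N)"
  proof (rule big_sum_in_bigo)
    fix ij assume "ij \<in> J"
    thus "(\<lambda>x. t ij x) \<in> O[F](\<lambda>x. e x ^ N)"
      using scale_power_mono[of N "fst ij + snd ij"]
      by (cases "fps_nth A (fst ij) * fps_nth B (snd ij) = 0") (auto simp: t_def J_def)
  qed
  \<comment> \<open>The product of the partial sums is the partial sum of the product plus the terms of \<open>J\<close>.\<close>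
  have "(\<lambda>x. (f x - P x) * g x + P x * (g x - Q x) + (\<Sum>ij\<in>J. t ij x)) \<in> O[F](\<lambda>x. e x ^ N)"
  proof (intro sum_in_bigo J)
    show "(\<lambda>x. (f x - P x) * g x) \<in> O[F](\<lambda>x. e x ^ N)"
      using landau_o.big.mult[OF asymp_seriesD[OF f, of N] series_bounded[OF g]] by (simp add: P_def)
    show "(\<lambda>x. P x * (g x - Q x)) \<in> O[F](\<lambda>x. e x ^ N)"
      using landau_o.big.mult[OF partial_sum_bounded asymp_seriesD[OF g, of N]] unfolding P_def Q_def by simp
  qed
  also have "(\<lambda>x. (f x - P x) * g x + P x * (g x - Q x) + (\<Sum>ij\<in>J. t ij x)) =
             (\<lambda>x. f x * g x - (\<Sum>k<N. fps_nth (A * B) k * e x ^ k))"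
    using PQ unfolding AB by (auto simp: algebra_simps fun_eq_iff)
  finally show "(\<lambda>x. f x * g x - (\<Sum>k<N. fps_nth (A * B) k * e x ^ k)) \<in> O[F](\<lambda>x. e x ^ N)" .
qed

lemma series_power:
  assumes "asymp_series F e f A" shows "asymp_series F e (\<lambda>x. f x ^ n) (A ^ n)"
  by (induction n) (use series_mult[OF assms] series_const[of 1] in simp_all)

lemma series_sum:
  assumes "\<And>i. i \<in> I \<Longrightarrow> asymp_series F e (f i) (A i)"
  shows "asymp_series F e (\<lambda>x. \<Sum>i\<in>I. f i x) (\<Sum>i\<in>I. A i)"
  using assms
  by (induction I rule: infinite_finite_induct)
     (use series_const[of 0] in \<open>auto intro!: series_add\<close>)

lemma series_tendsto:
  assumes "asymp_series F e f A" shows "(f \<longlongrightarrow> fps_nth A 0) F"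
proof -
  have "(\<lambda>x. f x - fps_nth A 0) \<in> O[F](e)" using asymp_seriesD[OF assms, of 1] by simp
  then obtain C where C: "eventually (\<lambda>x. norm (f x - fps_nth A 0) \<le> C * norm (e x)) F"
    by (auto elim: landau_o.bigE)
  have "((\<lambda>x. C * norm (e x)) \<longlongrightarrow> 0) F" by (auto intro!: tendsto_eq_intros scale_tendsto_0)
  from Lim_null_comparison[OF C this] show ?thesis by (simp add: LIM_zero_iff)
qed

text \<open>A series without constant term may be substituted into any function that has an
asymptotic series at $0$: $f^k$ is of order $e^k$, so that only finitely many powers of $f$ reach a
given order.\<close>

lemma series_compose:
  assumes h: "asymp_series (nhds 0) (\<lambda>x. x) h H" and f: "asymp_series F e f A"
    and A0: "fps_nth A 0 = 0"
  shows "asymp_series F e (\<lambda>x. h (f x)) (H oo A)"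
  unfolding asymp_series_def
proof
  fix N
  have lim: "(f \<longlongrightarrow> 0) F" using series_tendsto[OF f] A0 by simp
  have "f \<in> O[F](e)" using asymp_seriesD[OF f, of 1] A0 by simp
  hence fN: "(\<lambda>x. f x ^ N) \<in> O[F](\<lambda>x. e x ^ N)" by (rule landau_o.big_power)
  have 1: "(\<lambda>x. h (f x) - (\<Sum>k<N. fps_nth H k * f x ^ k)) \<in> O[F](\<lambda>x. e x ^ N)"
    using landau_o.big.compose[OF asymp_seriesD[OF h, of N] lim] fN
    by (rule landau_o.big_trans)
  define B where "B = (\<Sum>k<N. fps_const (fps_nth H k) * A ^ k)"
  have "asymp_series F e (\<lambda>x. \<Sum>k<N. fps_nth H k * f x ^ k) B"
    unfolding B_def by (intro series_sum series_cmult series_power f)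
  note 2 = asymp_seriesD[OF this, of N]
  have 3: "fps_nth B n = fps_nth (H oo A) n" if "n < N" for n
  proof -
    have "fps_nth B n = (\<Sum>k<N. fps_nth H k * fps_nth (A ^ k) n)"
      by (simp add: B_def fps_sum_nth)
    also have "\<dots> = (\<Sum>k\<in>{0..n}. fps_nth H k * fps_nth (A ^ k) n)"
      by (rule sum.mono_neutral_right) (use that A0 in \<open>auto simp: startsby_zero_power_prefix\<close>)
    finally show ?thesis by (simp add: fps_compose_nth)
  qed
  have "(\<Sum>k<N. fps_nth B k * e x ^ k) = (\<Sum>k<N. fps_nth (H oo A) k * e x ^ k)" for x
    by (intro sum.cong refl) (simp add: 3)
  with sum_in_bigo(1)[OF 1 2]
  show "(\<lambda>x. h (f x) - (\<Sum>k<N. fps_nth (H oo A) k * e x ^ k)) \<in> O[F](\<lambda>x. e x ^ N)"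
    by simp
qed

lemma series_divide_scale:
  assumes f: "asymp_series F e f A" and A0: "fps_nth A 0 = 0" and nz: "eventually (\<lambda>x. e x \<noteq> 0) F"
  shows "asymp_series F e (\<lambda>x. f x / e x) (fps_shift 1 A)"
  unfolding asymp_series_def
proof
  fix N
  have "(\<lambda>x. (f x - (\<Sum>k<Suc N. fps_nth A k * e x ^ k)) / e x) \<in> O[F](\<lambda>x. e x ^ Suc N / e x)"
    by (intro landau_o.big.divide_right asymp_seriesD[OF f] nz)
  also have "?this \<longleftrightarrow> (\<lambda>x. f x / e x - (\<Sum>k<N. fps_nth (fps_shift 1 A) k * e x ^ k)) \<in> O[F](\<lambda>x. e x ^ N)"
  proof (rule landau_o.big.cong_ex)
    show "eventually (\<lambda>x. (f x - (\<Sum>k<Suc N. fps_nth A k * e x ^ k)) / e x =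
             f x / e x - (\<Sum>k<N. fps_nth (fps_shift 1 A) k * e x ^ k)) F"
      using nz by eventually_elim
        (subst sum.lessThan_Suc_shift, simp add: A0 field_simps sum_distrib_left)
    show "eventually (\<lambda>x. e x ^ Suc N / e x = e x ^ N) F"
      using nz by eventually_elim simp
  qed
  finally show "(\<lambda>x. f x / e x - (\<Sum>k<N. fps_nth (fps_shift 1 A) k * e x ^ k)) \<in> O[F](\<lambda>x. e x ^ N)" .
qed

text \<open>The lowest nonzero coefficient would dominate the function. This is the uniqueness of
asymptotic expansions, in the form in which it makes the low coefficients of a small cumulant vanish.\<close>

lemma series_coeff_zero:
  assumes f: "asymp_series F e f A" and O: "f \<in> O[F](\<lambda>x. e x ^ N)"
    and nz: "eventually (\<lambda>x. e x \<noteq> 0) F" and F: "F \<noteq> bot" and k: "k < N"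
  shows "fps_nth A k = 0"
  using k
proof (induction k rule: less_induct)
  case (less k)
  have "(\<Sum>i<Suc k. fps_nth A i * e x ^ i) = fps_nth A k * e x ^ k" for x
    using less by (subst sum.remove[of _ k]) (auto intro!: sum.neutral)
  hence 1: "(\<lambda>x. f x - fps_nth A k * e x ^ k) \<in> O[F](\<lambda>x. e x ^ Suc k)"
    using asymp_seriesD[OF f, of "Suc k"] by simp
  have 2: "f \<in> O[F](\<lambda>x. e x ^ Suc k)"
    using O scale_power_mono[of "Suc k" N] less.prems by (auto elim: landau_o.big_trans)
  have "(\<lambda>x. fps_nth A k * e x ^ k) \<in> O[F](\<lambda>x. e x ^ Suc k)"
    using sum_in_bigo(2)[OF 2 1] by simp
  moreover have "eventually (\<lambda>x. e x ^ k \<noteq> 0) F" using nz by eventually_elim simp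
  ultimately have "(\<lambda>x. fps_nth A k * e x ^ k / e x ^ k) \<in> O[F](\<lambda>x. e x ^ Suc k / e x ^ k)"
    by (intro landau_o.big.divide_right)
  also have "?this \<longleftrightarrow> (\<lambda>x. fps_nth A k) \<in> O[F](e)"
  proof (rule landau_o.big.cong_ex)
    show "eventually (\<lambda>x. fps_nth A k * e x ^ k / e x ^ k = fps_nth A k) F"
      using nz by eventually_elim simp
    show "eventually (\<lambda>x. e x ^ Suc k / e x ^ k = e x) F"
      using nz by eventually_elim simp
  qed
  finally obtain C where C: "eventually (\<lambda>x. norm (fps_nth A k) \<le> C * norm (e x)) F"
    by (auto elim: landau_o.bigE)
  have "((\<lambda>x. C * norm (e x)) \<longlongrightarrow> 0) F" by (auto intro!: tendsto_eq_intros scale_tendsto_0)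
  from tendsto_lowerbound[OF this C F] show ?case by simp
qed

end

text \<open>After the first $N$ terms of a convergent power series the rest is $x^N$ times a
function that is continuous at $0$.\<close>

lemma asymp_series_nhds_0:
  assumes "eventually (\<lambda>x. (\<lambda>n. fps_nth H n * x ^ n) sums h x) (nhds 0)"
  shows "asymp_series (nhds 0) (\<lambda>x::real. x) h H"
  unfolding asymp_series_def
proof
  fix N
  have exp: "h has_fps_expansion H" by (rule has_fps_expansionI[OF assms])
  hence pos: "fps_conv_radius H > 0" by (simp add: has_fps_expansion_def)
  have "isCont (eval_fps (fps_shift N H)) 0"
    by (rule continuous_on_interior[OF continuous_on_eval_fps])
       (use pos in \<open>auto simp: interior_open zero_ereal_def\<close>)
  hence "((eval_fps (fps_shift N H)) \<longlongrightarrow> eval_fps (fps_shift N H) 0) (nhds 0)"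
    by (simp add: continuous_at tendsto_at_iff_tendsto_nhds)
  hence O1: "eval_fps (fps_shift N H) \<in> O[nhds 0](\<lambda>_. 1)"
    by (intro bigoI_tendsto[where c = "eval_fps (fps_shift N H) 0"]) simp_all
  have "eventually (\<lambda>x. h x - (\<Sum>k<N. fps_nth H k * x ^ k) = x ^ N * eval_fps (fps_shift N H) x) (nhds 0)"
    using assms
  proof eventually_elim
    case (elim x)
    have "(\<lambda>n. fps_nth H (n + N) * x ^ (n + N)) sums (h x - (\<Sum>k<N. fps_nth H k * x ^ k))"
      using elim by (rule sums_split_initial_segment)
    show ?case
    proof (cases "x = 0")
      case True
      thus ?thesis using elim by (cases N) (auto simp: eval_fps_at_0 sum.lessThan_Suc_shift sums_iff
        simp del: sum.lessThan_Suc)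
    next
      case False
      have "(\<lambda>n. fps_nth H (n + N) * x ^ (n + N) * (1 / x ^ N)) sums ((h x - (\<Sum>k<N. fps_nth H k * x ^ k)) * (1 / x ^ N))"
        by (rule sums_mult2) fact
      also have "(\<lambda>n. fps_nth H (n + N) * x ^ (n + N) * (1 / x ^ N)) = (\<lambda>n. fps_nth H (n + N) * x ^ n)"
        using False by (auto simp: power_add)
      finally show ?thesis using False
        by (simp add: eval_fps_def sums_iff field_simps)
    qed
  qed
  from landau_o.big.in_cong[OF this] show "(\<lambda>x. h x - (\<Sum>k<N. fps_nth H k * x ^ k)) \<in> O[nhds 0](\<lambda>x. x ^ N)"
    using landau_o.big.mult[OF landau_o.big_refl[of "\<lambda>x::real. x ^ N"] O1] by simp
qed

section \<open>Cumulants as sums over connected set families\<close>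

text \<open>Families of nonempty subsets of \<open>V\<close> are the hypergraphs on the vertex set \<open>V\<close>;
singletons are allowed as edges.\<close>

definition edge_families :: "'a set \<Rightarrow> 'a set set set" where
  "edge_families V = Pow (Pow V - {{}})"

text \<open>Connectedness is expressed by cuts: every proper nonempty part of \<open>C\<close> is crossed by an
edge.\<close>

definition connected_family :: "'a set \<Rightarrow> 'a set set \<Rightarrow> bool" where
  "connected_family C E \<longleftrightarrow> E \<in> edge_families C \<and>
     (\<forall>A\<subseteq>C. A \<noteq> {} \<longrightarrow> A \<noteq> C \<longrightarrow> (\<exists>S\<in>E. S \<inter> A \<noteq> {} \<and> \<not> S \<subseteq> A))"

definition family_weight :: "(nat \<Rightarrow> real) \<Rightarrow> 'a set set \<Rightarrow> real" where
  "family_weight w E = (\<Prod>S\<in>E. w (card S))"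

text \<open>The least set of vertices around \<open>v\<close> that no edge leaves.\<close>

definition component :: "'a \<Rightarrow> 'a set \<Rightarrow> 'a set set \<Rightarrow> 'a set" where
  "component v V E = \<Inter>{A. A \<subseteq> V \<and> v \<in> A \<and> (\<forall>S\<in>E. S \<subseteq> A \<or> S \<inter> A = {})}"

lemma finite_edge_families: "finite V \<Longrightarrow> finite (edge_families V)"
  by (simp add: edge_families_def)

lemma finite_family: "E \<in> edge_families V \<Longrightarrow> finite V \<Longrightarrow> finite E"
  by (auto simp: edge_families_def intro: finite_subset)

lemma component_least:
  "A \<subseteq> V \<Longrightarrow> v \<in> A \<Longrightarrow> (\<And>S. S \<in> E \<Longrightarrow> S \<subseteq> A \<or> S \<inter> A = {}) \<Longrightarrow> component v V E \<subseteq> A"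
  unfolding component_def by blast

lemma component_closed:
  assumes "E \<in> edge_families V" "v \<in> V"
  shows "component v V E \<subseteq> V" "v \<in> component v V E"
    "S \<in> E \<Longrightarrow> S \<subseteq> component v V E \<or> S \<inter> component v V E = {}"
proof -
  have "V \<in> {A. A \<subseteq> V \<and> v \<in> A \<and> (\<forall>S\<in>E. S \<subseteq> A \<or> S \<inter> A = {})}"
    using assms by (auto simp: edge_families_def)
  thus "component v V E \<subseteq> V" unfolding component_def by blast
  show "v \<in> component v V E" by (auto simp: component_def)
  show "S \<in> E \<Longrightarrow> S \<subseteq> component v V E \<or> S \<inter> component v V E = {}"
    unfolding component_def by blast
qed

text \<open>If no edge crossed the boundary of a part \<open>A\<close> of the component, then \<open>A\<close> or its complement in
the component would be a smaller set around \<open>v\<close> that no edge leaves.\<close>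

lemma connected_component:
  assumes E: "E \<in> edge_families V" and v: "v \<in> V"
  shows "connected_family (component v V E) {S\<in>E. S \<subseteq> component v V E}"
    (is "connected_family ?C ?E")
  unfolding connected_family_def
proof (intro conjI allI impI)
  show "?E \<in> edge_families ?C" using E by (auto simp: edge_families_def)
  fix A assume A: "A \<subseteq> ?C" "A \<noteq> {}" "A \<noteq> ?C"
  note C = component_closed[OF E v]
  show "\<exists>S\<in>?E. S \<inter> A \<noteq> {} \<and> \<not> S \<subseteq> A"
  proof (rule ccontr)
    assume "\<not> ?thesis"
    hence nc: "S \<subseteq> A \<or> S \<inter> A = {}" if "S \<in> E" "S \<subseteq> ?C" for S using that by blast
    have AV: "A \<subseteq> V" using A(1) C(1) by (rule subset_trans)
    have cl: "S \<subseteq> A \<or> S \<inter> A = {}" if S: "S \<in> E" for S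
    proof (cases "S \<subseteq> ?C")
      case True
      with nc S show ?thesis by simp
    next
      case False
      hence "S \<inter> ?C = {}" using C(3)[OF S] by simp
      thus ?thesis using A(1) by blast
    qed
    show False
    proof (cases "v \<in> A")
      case True
      have "?C \<subseteq> A" by (rule component_least[OF AV True cl])
      thus False using A by (simp add: subset_antisym)
    next
      case False
      have "?C \<subseteq> ?C - A"
      proof (rule component_least)
        show "?C - A \<subseteq> V" using C(1) by blast
        show "v \<in> ?C - A" using C(2) False by simp
        show "S \<subseteq> ?C - A \<or> S \<inter> (?C - A) = {}" if "S \<in> E" for S
          using C(3)[OF that] cl[OF that] by blast
      qed
      thus False using A(1,2) by blast
    qed
  qed
qed

text \<open>Joining a connected family on \<open>C\<close> with any family outside \<open>C\<close> does not enlarge the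
component: this is the inverse direction of splitting off the component of \<open>v\<close>.\<close>

lemma component_union:
  assumes E1: "connected_family C E1" and E2: "E2 \<in> edge_families (V - C)"
    and v: "v \<in> C" and C: "C \<subseteq> V"
  shows "component v V (E1 \<union> E2) = C"
proof -
  have 1: "E1 \<in> edge_families C" using E1 by (simp add: connected_family_def)
  have E: "E1 \<union> E2 \<in> edge_families V" and "v \<in> V"
    using 1 E2 C v by (auto simp: edge_families_def)
  note K = component_closed[OF this]
  have sub: "component v V (E1 \<union> E2) \<subseteq> C"
    by (rule component_least) (use C v 1 E2 in \<open>auto simp: edge_families_def\<close>)
  show ?thesis
  proof (rule ccontr)
    assume ne: "component v V (E1 \<union> E2) \<noteq> C"
    then obtain S where "S \<in> E1" "S \<inter> component v V (E1 \<union> E2) \<noteq> {}" "\<not> S \<subseteq> component v V (E1 \<union> E2)"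
      using E1 sub K(2) unfolding connected_family_def by blast
    with K(3)[of S] show False by blast
  qed
qed

text \<open>A family on \<open>V\<close> is the same as the component \<open>C\<close> of \<open>v\<close>, a connected family on
\<open>C\<close> and an arbitrary family on the rest; weights multiply. This is the combinatorial form of the
recursion between moments and cumulants.\<close>

lemma sum_families_by_component:
  assumes V: "finite V" and v: "v \<in> V"
  shows "(\<Sum>E\<in>edge_families V. family_weight w E) =
    (\<Sum>C | C \<subseteq> V \<and> v \<in> C. (\<Sum>E | connected_family C E. family_weight w E) *
                             (\<Sum>E\<in>edge_families (V - C). family_weight w E))"
proof -
  let ?\<C> = "{C. C \<subseteq> V \<and> v \<in> C}"
  define T where "T = (SIGMA C:?\<C>. {E. connected_family C E} \<times> edge_families (V - C))"
  have fin1: "finite ?\<C>" using V by simp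
  have fin2: "finite ({E. connected_family C E} \<times> edge_families (V - C))" if "C \<in> ?\<C>" for C
  proof -
    have "finite C" using that V by (auto intro: finite_subset)
    hence "finite {E. connected_family C E}"
      by (rule finite_subset[rotated, OF finite_edge_families]) (auto simp: connected_family_def)
    thus ?thesis using V by (simp add: finite_edge_families)
  qed
  have "(\<Sum>C\<in>?\<C>. (\<Sum>E | connected_family C E. family_weight w E) *
                             (\<Sum>E\<in>edge_families (V - C). family_weight w E)) =
        (\<Sum>C\<in>?\<C>. \<Sum>(E1,E2)\<in>{E. connected_family C E} \<times> edge_families (V - C).
             family_weight w E1 * family_weight w E2)"
    by (simp add: sum_product sum.cartesian_product)
  also have "\<dots> = (\<Sum>(C,E1,E2)\<in>T. family_weight w E1 * family_weight w E2)"
    unfolding T_def by (subst sum.Sigma) (use fin1 fin2 in \<open>auto intro!: sum.cong\<close>)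
  also have "\<dots> = (\<Sum>E\<in>edge_families V. family_weight w E)"
  proof (rule sum.reindex_bij_witness[of _
      "\<lambda>E. (component v V E, {S\<in>E. S \<subseteq> component v V E}, {S\<in>E. \<not> S \<subseteq> component v V E})"
      "\<lambda>(C,E1,E2). E1 \<union> E2"])
    fix a assume "a \<in> T"
    then obtain C E1 E2 where a: "a = (C,E1,E2)" "C \<subseteq> V" "v \<in> C" "connected_family C E1"
      "E2 \<in> edge_families (V - C)" by (auto simp: T_def)
    have E1: "E1 \<in> edge_families C" using a by (simp add: connected_family_def)
    have "component v V (E1 \<union> E2) = C" using component_union a by metis
    moreover have "{S \<in> E1 \<union> E2. S \<subseteq> C} = E1" "{S \<in> E1 \<union> E2. \<not> S \<subseteq> C} = E2"
      using E1 a(5) by (auto simp: edge_families_def)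
    ultimately show "(component v V (case a of (C,E1,E2) \<Rightarrow> E1 \<union> E2),
        {S \<in> case a of (C,E1,E2) \<Rightarrow> E1 \<union> E2. S \<subseteq> component v V (case a of (C,E1,E2) \<Rightarrow> E1 \<union> E2)},
        {S \<in> case a of (C,E1,E2) \<Rightarrow> E1 \<union> E2. \<not> S \<subseteq> component v V (case a of (C,E1,E2) \<Rightarrow> E1 \<union> E2)}) = a"
      by (simp add: a(1))
    show "(case a of (C,E1,E2) \<Rightarrow> E1 \<union> E2) \<in> edge_families V"
      using E1 a by (auto simp: edge_families_def)
    have "finite E1" "finite E2"
      using finite_family[OF E1] finite_family[OF a(5)] a(2) V by (auto intro: finite_subset)
    moreover have "E1 \<inter> E2 = {}" using E1 a(5) unfolding edge_families_def by blast
    ultimately show "family_weight w (case a of (C,E1,E2) \<Rightarrow> E1 \<union> E2) =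
          (case a of (C,E1,E2) \<Rightarrow> family_weight w E1 * family_weight w E2)"
      by (simp add: a(1) family_weight_def prod.union_disjoint)
  next
    fix E assume E: "E \<in> edge_families V"
    note K = component_closed[OF E v] connected_component[OF E v]
    show "(case (component v V E, {S\<in>E. S \<subseteq> component v V E}, {S\<in>E. \<not> S \<subseteq> component v V E}) of
      (C,E1,E2) \<Rightarrow> E1 \<union> E2) = E" by auto
    have "{S\<in>E. \<not> S \<subseteq> component v V E} \<in> edge_families (V - component v V E)"
      using K(3) E unfolding edge_families_def by blast
    thus "(component v V E, {S\<in>E. S \<subseteq> component v V E}, {S\<in>E. \<not> S \<subseteq> component v V E}) \<in> T"
      using K by (auto simp: T_def)
  qed
  finally show ?thesis ..
qed

lemma cumulant_cong:
  assumes "\<And>i. 1 \<le> i \<Longrightarrow> i \<le> p \<Longrightarrow> \<mu> i = \<nu> i" "p \<ge> 1"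
  shows "cumulant \<mu> p = cumulant \<nu> p"
  using assms
proof (induction p rule: less_induct)
  case (less p)
  have "(\<Sum>l = 1..p - 1. real ((p - 1) choose (l - 1)) * cumulant \<mu> l * \<mu> (p - l)) =
        (\<Sum>l = 1..p - 1. real ((p - 1) choose (l - 1)) * cumulant \<nu> l * \<nu> (p - l))"
  proof (rule sum.cong)
    fix l assume l: "l \<in> {1..p - 1}"
    have "cumulant \<mu> l = cumulant \<nu> l" by (rule less.IH) (use l less.prems in auto)
    moreover have "\<mu> (p - l) = \<nu> (p - l)" by (rule less.prems(1)) (use l in auto)
    ultimately show "real ((p - 1) choose (l - 1)) * cumulant \<mu> l * \<mu> (p - l) =
      real ((p - 1) choose (l - 1)) * cumulant \<nu> l * \<nu> (p - l)" by simp
  qed simp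
  moreover have "\<mu> p = \<nu> p" using less.prems by simp
  ultimately show ?case by (subst (1 2) cumulant.simps) simp
qed

lemma card_subsets_through_point:
  assumes "finite V" "v \<in> V" "l \<ge> 1"
  shows "card {C. C \<subseteq> V \<and> v \<in> C \<and> card C = l} = (card V - 1) choose (l - 1)"
proof -
  have "bij_betw (insert v) {C. C \<subseteq> V - {v} \<and> card C = l - 1} {C. C \<subseteq> V \<and> v \<in> C \<and> card C = l}"
  proof (rule bij_betw_byWitness[where f' = "\<lambda>C. C - {v}"])
    show "insert v ` {C. C \<subseteq> V - {v} \<and> card C = l - 1} \<subseteq> {C. C \<subseteq> V \<and> v \<in> C \<and> card C = l}"
    proof
      fix D assume "D \<in> insert v ` {C. C \<subseteq> V - {v} \<and> card C = l - 1}"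
      then obtain C where C: "D = insert v C" "C \<subseteq> V - {v}" "card C = l - 1" by auto
      have "finite C" using C assms by (auto intro: finite_subset)
      thus "D \<in> {C. C \<subseteq> V \<and> v \<in> C \<and> card C = l}"
        using C assms by (auto simp: card_insert_if)
    qed
  qed (use assms in \<open>auto simp: card_Diff_singleton\<close>)
  from bij_betw_same_card[OF this] show ?thesis
    using assms by (simp add: n_subsets card_Diff_singleton)
qed

text \<open>Both sides satisfy the same recursion. On the combinatorial side it comes from
the component of a fixed vertex, which is one of $\binom{p-1}{l-1}$ sets if it has size $l$.\<close>

theorem cumulant_eq_sum_connected:
  assumes \<mu>: "\<And>V :: 'a set. finite V \<Longrightarrow> (\<Sum>E\<in>edge_families V. family_weight w E) = \<mu> (card V)"
    and V: "finite (V :: 'a set)" "V \<noteq> {}"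
  shows "(\<Sum>E | connected_family V E. family_weight w E) = cumulant \<mu> (card V)"
  using V
proof (induction "card V" arbitrary: V rule: less_induct)
  case less
  define p where "p = card V"
  obtain v where v: "v \<in> V" using less.prems by auto
  have p: "p \<ge> 1" using less.prems by (simp add: p_def Suc_le_eq card_gt_0_iff)
  define K where "K = (\<lambda>C :: 'a set. \<Sum>E | connected_family C E. family_weight w E)"
  have \<mu>0: "\<mu> 0 = 1" using \<mu>[of "{}"] by (simp add: edge_families_def family_weight_def)
  let ?\<C> = "{C. C \<subseteq> V \<and> v \<in> C}"
  have fin: "finite ?\<C>" using less.prems by simp
  have "\<mu> p = (\<Sum>C\<in>?\<C>. K C * \<mu> (card (V - C)))"
    using sum_families_by_component[OF less.prems(1) v, of w] less.prems
    by (simp add: \<mu> K_def p_def)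
  also have "\<dots> = K V + (\<Sum>C\<in>?\<C> - {V}. K C * \<mu> (card (V - C)))"
    using fin v \<mu>0 by (subst sum.remove[of _ V]) auto
  also have "(\<Sum>C\<in>?\<C> - {V}. K C * \<mu> (card (V - C))) =
             (\<Sum>C\<in>?\<C> - {V}. cumulant \<mu> (card C) * \<mu> (p - card C))"
  proof (rule sum.cong)
    fix C assume "C \<in> ?\<C> - {V}"
    hence C: "C \<subset> V" "v \<in> C" by auto
    have fC: "finite C" using C less.prems by (auto intro: finite_subset)
    have "card C < card V" using C less.prems by (intro psubset_card_mono) auto
    hence "K C = cumulant \<mu> (card C)"
      unfolding K_def by (rule less.hyps) (use C fC in auto)
    moreover have "card (V - C) = p - card C" using C fC by (simp add: p_def card_Diff_subset)
    ultimately show "K C * \<mu> (card (V - C)) = cumulant \<mu> (card C) * \<mu> (p - card C)" by simp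
  qed simp
  also have "\<dots> = (\<Sum>l = 1..p - 1. \<Sum>C | C \<in> ?\<C> - {V} \<and> card C = l. cumulant \<mu> (card C) * \<mu> (p - card C))"
  proof (rule sum.group[symmetric])
    show "card ` (?\<C> - {V}) \<subseteq> {1..p - 1}"
    proof
      fix l assume "l \<in> card ` (?\<C> - {V})"
      then obtain C where C: "l = card C" "C \<subset> V" "v \<in> C" by auto
      have "finite C" using C less.prems by (auto intro: finite_subset)
      moreover have "card C < card V" using C less.prems by (intro psubset_card_mono) auto
      ultimately show "l \<in> {1..p - 1}" using C by (auto simp: p_def Suc_le_eq card_gt_0_iff)
    qed
  qed (use fin in auto)
  also have "\<dots> = (\<Sum>l = 1..p - 1. real ((p - 1) choose (l - 1)) * cumulant \<mu> l * \<mu> (p - l))"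
  proof (rule sum.cong)
    fix l assume l: "l \<in> {1..p - 1}"
    have "{C \<in> ?\<C> - {V}. card C = l} = {C. C \<subseteq> V \<and> v \<in> C \<and> card C = l}"
      using l by (auto simp: p_def)
    thus "(\<Sum>C | C \<in> ?\<C> - {V} \<and> card C = l. cumulant \<mu> (card C) * \<mu> (p - card C)) =
          real ((p - 1) choose (l - 1)) * cumulant \<mu> l * \<mu> (p - l)"
      using card_subsets_through_point[OF less.prems(1) v, of l] l by (simp add: p_def)
  qed simp
  finally have "K V = \<mu> p - (\<Sum>l = 1..p - 1. real ((p - 1) choose (l - 1)) * cumulant \<mu> l * \<mu> (p - l))"
    by simp
  thus ?case by (subst cumulant.simps) (simp add: K_def p_def)
qed

text \<open>Grow a set of vertices from a single point: as long as it is not everything, some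
edge \<open>S\<close> crosses its boundary, and adding \<open>S\<close> adds at most $|S|-1$ new vertices.\<close>

lemma connected_family_excess:
  assumes E: "connected_family C E" and C: "finite C" "C \<noteq> {}"
  shows "card C - 1 \<le> (\<Sum>S\<in>E. card S - 1)"
proof -
  have fE: "E \<in> edge_families C" using E by (simp add: connected_family_def)
  have finE: "finite E" using finite_family[OF fE C(1)] .
  have "\<exists>A G. A \<subseteq> C \<and> G \<subseteq> E \<and> A \<noteq> {} \<and> k \<le> card A \<and> (\<forall>S\<in>G. S \<subseteq> A) \<and> card A \<le> 1 + (\<Sum>S\<in>G. card S - 1)"
    if "1 \<le> k" "k \<le> card C" for k
    using that
  proof (induction k rule: dec_induct)
    case base
    obtain v where "v \<in> C" using C by auto
    thus ?case by (intro exI[of _ "{v}"] exI[of _ "{}"]) auto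
  next
    case (step k)
    have "k \<le> card C" using step.prems by simp
    then obtain A G where AG: "A \<subseteq> C" "G \<subseteq> E" "A \<noteq> {}" "k \<le> card A" "\<forall>S\<in>G. S \<subseteq> A"
      "card A \<le> 1 + (\<Sum>S\<in>G. card S - 1)" using step.IH by blast
    show ?case
    proof (cases "Suc k \<le> card A")
      case True
      thus ?thesis using AG by blast
    next
      case False
      hence "A \<noteq> C" using step by auto
      then obtain S where S: "S \<in> E" "S \<inter> A \<noteq> {}" "\<not> S \<subseteq> A"
        using E AG unfolding connected_family_def by blast
      have SC: "S \<subseteq> C" using S fE by (auto simp: edge_families_def)
      have fin: "finite S" "finite A" "finite G"
        using finite_subset[OF SC C(1)] finite_subset[OF AG(1) C(1)] finite_subset[OF AG(2) finE] .
      have "card A < card (A \<union> S)" using S fin by (intro psubset_card_mono) auto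
      moreover have "card (A \<union> S) + 1 \<le> card A + card S"
      proof -
        have "card (A \<inter> S) \<ge> 1" using S fin by (auto simp: Suc_le_eq card_gt_0_iff)
        thus ?thesis using card_Un_Int[of A S] fin by linarith
      qed
      moreover have "S \<notin> G" using S AG by auto
      moreover from this fin have "(\<Sum>T\<in>insert S G. card T - 1) = (card S - 1) + (\<Sum>T\<in>G. card T - 1)"
        by simp
      ultimately have "Suc k \<le> card (A \<union> S)" "card (A \<union> S) \<le> 1 + (\<Sum>T\<in>insert S G. card T - 1)"
        using AG(4,6) by linarith+
      moreover have "\<forall>T\<in>insert S G. T \<subseteq> A \<union> S" using AG(5) by auto
      moreover have "A \<union> S \<subseteq> C" "insert S G \<subseteq> E" "A \<union> S \<noteq> {}" using AG(1-3) SC S(1) by auto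
      ultimately show ?thesis by blast
    qed
  qed
  from this[of "card C"] have "\<exists>A G. A \<subseteq> C \<and> G \<subseteq> E \<and> A \<noteq> {} \<and> card C \<le> card A \<and>
      (\<forall>S\<in>G. S \<subseteq> A) \<and> card A \<le> 1 + (\<Sum>S\<in>G. card S - 1)"
    using C by (simp add: Suc_le_eq card_gt_0_iff)
  then obtain A G where "A \<subseteq> C \<and> G \<subseteq> E \<and> A \<noteq> {} \<and> card C \<le> card A \<and>
      (\<forall>S\<in>G. S \<subseteq> A) \<and> card A \<le> 1 + (\<Sum>S\<in>G. card S - 1)" by (elim exE)
  hence AG: "G \<subseteq> E" "card C \<le> card A" "card A \<le> 1 + (\<Sum>S\<in>G. card S - 1)" by simp_all
  have "(\<Sum>S\<in>G. card S - 1) \<le> (\<Sum>S\<in>E. card S - 1)"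
    by (rule sum_mono2[OF finE AG(1)]) simp
  thus ?thesis using AG by linarith
qed

definition fdiff :: "(nat \<Rightarrow> real) \<Rightarrow> nat \<Rightarrow> real" where
  "fdiff f i = f (Suc i) - f i"

text \<open>Newton's interpolation formula: a function on the natural numbers is a combination of
binomial coefficients, with its iterated differences as coefficients.\<close>

lemma newton_forward:
  "f (i + b) = (\<Sum>k\<le>b. real (b choose k) * (fdiff ^^ k) f i)"
proof (induction b arbitrary: i)
  case (Suc b)
  have "f (i + Suc b) = (\<Sum>k\<le>b. real (b choose k) * (fdiff ^^ k) f (Suc i))"
    using Suc[of "Suc i"] by simp
  also have "\<dots> = (\<Sum>k\<le>b. real (b choose k) * (fdiff ^^ k) f i) +
                  (\<Sum>k\<le>b. real (b choose k) * (fdiff ^^ Suc k) f i)"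
    by (simp add: fdiff_def algebra_simps flip: sum.distrib)
  also have "(\<Sum>k\<le>b. real (b choose k) * (fdiff ^^ k) f i) =
             f i + (\<Sum>k\<le>b. real (b choose Suc k) * (fdiff ^^ Suc k) f i)"
  proof -
    have "(\<Sum>k\<le>b. real (b choose k) * (fdiff ^^ k) f i) = (\<Sum>k\<le>Suc b. real (b choose k) * (fdiff ^^ k) f i)"
      by simp
    also have "\<dots> = f i + (\<Sum>k\<le>b. real (b choose Suc k) * (fdiff ^^ Suc k) f i)"
      by (subst sum.atMost_Suc_shift) simp
    finally show ?thesis .
  qed
  also have "f i + (\<Sum>k\<le>b. real (b choose Suc k) * (fdiff ^^ Suc k) f i) +
               (\<Sum>k\<le>b. real (b choose k) * (fdiff ^^ Suc k) f i) =
             f i + (\<Sum>k\<le>b. real (Suc b choose Suc k) * (fdiff ^^ Suc k) f i)"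
    by (simp add: algebra_simps sum.distrib)
  also have "\<dots> = (\<Sum>k\<le>Suc b. real (Suc b choose k) * (fdiff ^^ k) f i)"
    by (subst sum.atMost_Suc_shift) simp
  finally show ?case .
qed simp

lemma sum_Pow_card:
  assumes "finite V"
  shows "(\<Sum>S\<in>Pow V. f (card S)) = (\<Sum>k\<le>card V. real (card V choose k) * f k)"
proof -
  have "(\<Sum>S\<in>Pow V. f (card S)) = (\<Sum>k\<le>card V. \<Sum>S | S \<in> Pow V \<and> card S = k. f (card S))"
    by (rule sum.group[symmetric]) (use assms in \<open>auto intro: card_mono\<close>)
  also have "\<dots> = (\<Sum>k\<le>card V. real (card V choose k) * f k)"
    using assms by (intro sum.cong refl) (simp add: n_subsets)
  finally show ?thesis .
qed

lemma abs_exp_minus_one_le: "\<bar>exp x - 1\<bar> \<le> \<bar>x\<bar> * exp \<bar>x\<bar>" for x :: real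
proof (cases "x \<ge> 0")
  case True
  have "(1 - x) * exp x \<le> exp (-x) * exp x"
    using exp_ge_add_one_self[of "-x"] by (intro mult_right_mono) auto
  thus ?thesis using True by (simp add: algebra_simps flip: exp_add)
next
  case False
  have "1 + x \<le> exp x" by (rule exp_ge_add_one_self)
  hence "1 - exp x \<le> \<bar>x\<bar> * 1" using False by linarith
  also have "\<dots> \<le> \<bar>x\<bar> * exp \<bar>x\<bar>" by (intro mult_left_mono) auto
  finally show ?thesis using False by simp
qed

context asymptotic_scale
begin

lemma exp_minus_one_bigo:
  assumes "f \<in> O[F](\<lambda>x. e x ^ j)" shows "(\<lambda>x. exp (f x) - 1) \<in> O[F](\<lambda>x. e x ^ j)"
proof -
  obtain C where C: "eventually (\<lambda>x. norm (f x) \<le> C * norm (e x ^ j)) F"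
    using assms by (auto elim: landau_o.bigE)
  obtain D where D: "eventually (\<lambda>x. norm (f x) \<le> D) F"
    using landau_o.big_trans[OF assms scale_power_mono[of 0 j]] by (auto elim: landau_o.bigE)
  show ?thesis
  proof (rule bigoI)
    show "eventually (\<lambda>x. norm (exp (f x) - 1) \<le> C * exp D * norm (e x ^ j)) F"
      using C D
    proof eventually_elim
      case (elim x)
      have "norm (exp (f x) - 1) \<le> \<bar>f x\<bar> * exp \<bar>f x\<bar>" using abs_exp_minus_one_le by simp
      also have "\<dots> \<le> (C * norm (e x ^ j)) * exp D"
        using elim by (intro mult_mono) (auto intro: order_trans[OF abs_ge_zero])
      finally show ?case by (simp add: mult_ac)
    qed
  qed
qed

text \<open>By Newton's formula $\exp(L(b))$ is the product of $\exp(\lambda_{|S|})$ over the nonempty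
subsets $S$ of a set of size $b$, with $\lambda_k$ the $k$th difference of $L$ at $0$. Hence the cumulant
is a sum over connected families of products of $\exp(\lambda_{|S|})-1$, each of order $e^{|S|-1}$.\<close>

theorem cumulant_bigo:
  assumes L0: "\<And>x. L x 0 = 0"
    and diffs: "\<And>k. k \<ge> 1 \<Longrightarrow> (\<lambda>x. (fdiff ^^ k) (L x) 0) \<in> O[F](\<lambda>x. e x ^ (k - 1))"
    and p: "p \<ge> 1"
  shows "(\<lambda>x. cumulant (\<lambda>b. exp (L x b)) p) \<in> O[F](\<lambda>x. e x ^ (p - 1))"
proof -
  define l where "l = (\<lambda>x k. (fdiff ^^ k) (L x) 0)"
  define w where "w = (\<lambda>x k. exp (l x k) - 1)"
  \<comment> \<open>Expand the product of $1 + w_{|S|} = \exp(\lambda_{|S|})$ over the nonempty subsets.\<close>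
  have moments: "(\<Sum>E\<in>edge_families V. family_weight (w x) E) = exp (L x (card V))"
    if V: "finite V" for V :: "nat set" and x
  proof -
    have "(\<Prod>S\<in>Pow V - {{}}. w x (card S) + 1) =
      (\<Sum>E\<in>Pow (Pow V - {{}}). (\<Prod>S\<in>E. w x (card S)) * (\<Prod>S\<in>(Pow V - {{}}) - E. 1))"
      using V by (intro prod_add) auto
    also have "\<dots> = (\<Sum>E\<in>edge_families V. family_weight (w x) E)"
      by (simp add: family_weight_def edge_families_def)
    also have "(\<Prod>S\<in>Pow V - {{}}. w x (card S) + 1) = exp (\<Sum>S\<in>Pow V - {{}}. l x (card S))"
      using V by (simp add: w_def exp_sum)
    also have "(\<Sum>S\<in>Pow V - {{}}. l x (card S)) = (\<Sum>S\<in>Pow V. l x (card S))"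
      using V L0 by (intro sum.mono_neutral_left) (auto simp: l_def)
    also have "\<dots> = L x (card V)"
      using newton_forward[of "L x" 0 "card V"] sum_Pow_card[OF V, of "l x"] by (simp add: l_def)
    finally show ?thesis by simp
  qed
  have fin: "finite {E. connected_family {..<p} E}"
    by (rule finite_subset[OF _ finite_edge_families[of "{..<p}"]]) (auto simp: connected_family_def)
  have "(\<lambda>x. \<Sum>E | connected_family {..<p} E. family_weight (w x) E) \<in> O[F](\<lambda>x. e x ^ (p - 1))"
  proof (rule big_sum_in_bigo)
    fix E assume "E \<in> {E. connected_family {..<p} E}"
    hence E: "connected_family {..<p} E" by simp
    hence fE: "E \<in> edge_families {..<p}" by (simp add: connected_family_def)
    have finE: "finite E" using finite_family[OF fE] by simp
    have "(\<lambda>x. \<Prod>S\<in>G. w x (card S)) \<in> O[F](\<lambda>x. e x ^ (\<Sum>S\<in>G. card S - 1))" if "G \<subseteq> E" for G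
      using finite_subset[OF that finE] that
    proof (induction G rule: finite_induct)
      case (insert S G)
      have "S \<in> Pow {..<p} - {{}}" using insert fE by (auto simp: edge_families_def)
      hence "card S \<ge> 1" by (auto simp: Suc_le_eq card_gt_0_iff intro: finite_subset)
      hence "(\<lambda>x. w x (card S)) \<in> O[F](\<lambda>x. e x ^ (card S - 1))"
        unfolding w_def l_def by (intro exp_minus_one_bigo diffs)
      from landau_o.big.mult[OF this insert.IH] insert show ?case by (simp add: power_add)
    qed simp
    from this[of E] have "(\<lambda>x. family_weight (w x) E) \<in> O[F](\<lambda>x. e x ^ (\<Sum>S\<in>E. card S - 1))"
      by (simp add: family_weight_def)
    moreover have "p - 1 \<le> (\<Sum>S\<in>E. card S - 1)"
      using connected_family_excess[OF E] p by (auto simp: lessThan_empty_iff)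
    ultimately show "(\<lambda>x. family_weight (w x) E) \<in> O[F](\<lambda>x. e x ^ (p - 1))"
      using scale_power_mono landau_o.big_trans by blast
  qed
  also have "(\<lambda>x. \<Sum>E | connected_family {..<p} E. family_weight (w x) E) =
             (\<lambda>x. cumulant (\<lambda>b. exp (L x b)) p)"
    using cumulant_eq_sum_connected[of _ "\<lambda>b. exp (L _ b)" "{..<p}"] moments p
    by (auto simp: fun_eq_iff lessThan_empty_iff)
  finally show ?thesis .
qed

end

section \<open>A Bernoulli number identity and elementary power series\<close>

lemma bernoulli_sum_zero:
  assumes "N \<ge> 1" shows "(\<Sum>k\<le>N. real (Suc N choose k) * bernoulli k) = 0"
proof -
  have "{0..N - 1} = {..<N}" using assms by auto
  hence "bernoulli N = - (\<Sum>k<N. real (Suc N choose k) * bernoulli k) / real (Suc N)"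
    using assms by (subst bernoulli.simps) simp
  moreover have "Suc N choose N = Suc N" using binomial_Suc_n[of N] by simp
  ultimately show ?thesis by (simp add: lessThan_Suc_atMost[symmetric] field_simps del: of_nat_Suc)
qed

text \<open>The exponential generating function $x/(e^x-1)$.\<close>

definition bernoulli_fps :: "real fps" where
  "bernoulli_fps = Abs_fps (\<lambda>n. bernoulli n / fact n)"

lemma bernoulli_fps_mult_exp: "bernoulli_fps * (fps_exp 1 - 1) = fps_X"
proof (rule fps_ext)
  fix n
  show "fps_nth (bernoulli_fps * (fps_exp 1 - 1)) n = fps_nth fps_X n"
  proof (cases n)
    case (Suc N)
    have "fps_nth (bernoulli_fps * (fps_exp 1 - 1)) n =
          (\<Sum>i\<le>N. bernoulli i / fact i * (1 / fact (Suc N - i)))"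
      by (simp add: fps_mult_nth Suc bernoulli_fps_def atMost_atLeast0) (simp add: mult.commute)
    also have "\<dots> = (\<Sum>i\<le>N. real (Suc N choose i) * bernoulli i) / fact (Suc N)"
      unfolding sum_divide_distrib
      by (intro sum.cong refl) (simp add: binomial_fact mult.commute del: fact_Suc)
    also have "\<dots> = fps_nth fps_X n"
      using bernoulli_sum_zero[of N] Suc by (cases N) (auto simp: bernoulli.simps)
    finally show ?thesis .
  qed (simp add: fps_mult_nth)
qed

text \<open>With $B = x/(e^x-1)$ one has $xB'-B = -x^2e^x/(e^x-1)^2$, and
$e^x+e^{-x}-2 = (e^x-1)^2/e^x$, so that the product of the two is $-x^2$. The sum is a coefficient of
this product; as the second factor is even, only Bernoulli numbers of even index enter.\<close>

lemma bernoulli_even_convolution: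
  assumes "s \<ge> 1"
  shows "(\<Sum>i\<le>s. (2 * real i - 1) * bernoulli (2 * i) / fact (2 * i) / fact (2 * s + 2 - 2 * i)) = 0"
proof -
  define B where "B = bernoulli_fps"
  define E where "E = (fps_exp 1 :: real fps)"
  define C where "C = E + fps_exp (-1) - 2"
  define H where "H = fps_X * fps_deriv B - B"
  have BE: "B * (E - 1) = fps_X" using bernoulli_fps_mult_exp by (simp add: B_def E_def)
  have EE: "E * fps_exp (-1) = 1"
    unfolding E_def by (subst fps_exp_add_mult[symmetric]) simp
  have "fps_deriv (B * (E - 1)) = 1" by (simp add: BE)
  hence D: "fps_deriv B * (E - 1) + B * E = 1" by (simp add: E_def algebra_simps)
  have "H * C * E = H * (E - 1)\<^sup>2"
    using EE by (simp add: C_def power2_eq_square algebra_simps)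
  also have "\<dots> = fps_X * (fps_deriv B * (E - 1)) * (E - 1) - B * (E - 1) * (E - 1)"
    by (simp add: H_def power2_eq_square algebra_simps)
  also have "fps_deriv B * (E - 1) = 1 - B * E" using D by (simp add: algebra_simps)
  also have "fps_X * (1 - B * E) * (E - 1) - B * (E - 1) * (E - 1) =
             fps_X * (E - 1) - fps_X * (B * (E - 1)) * E - B * (E - 1) * (E - 1)"
    by (simp add: algebra_simps)
  also have "\<dots> = - (fps_X\<^sup>2) * E" unfolding BE by (simp add: algebra_simps power2_eq_square)
  finally have "H * C * E = - (fps_X\<^sup>2) * E" .
  moreover have "E \<noteq> 0" using EE by auto
  ultimately have HC: "H * C = - (fps_X\<^sup>2)" using mult_right_cancel by metis
  have Hn: "fps_nth H n = (real n - 1) * bernoulli n / fact n" for n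
    by (cases n) (auto simp: H_def B_def bernoulli_fps_def add_divide_distrib ring_distribs simp del: fact_Suc)
  have Cn: "fps_nth C n = (if even n \<and> n \<noteq> 0 then 2 / fact n else 0)" for n
    by (auto simp: C_def E_def fps_numeral_nth)
  have "0 = fps_nth (H * C) (2 * s + 2)" using assms by (simp add: HC)
  also have "\<dots> = (\<Sum>n\<le>2 * s + 2. fps_nth H n * fps_nth C (2 * s + 2 - n))"
    by (simp add: fps_mult_nth atMost_atLeast0)
  also have "\<dots> = (\<Sum>n\<in>(\<lambda>i. 2 * i) ` {..s}. fps_nth H n * fps_nth C (2 * s + 2 - n))"
  proof (rule sum.mono_neutral_right)
    show "\<forall>n\<in>{..2 * s + 2} - (\<lambda>i. 2 * i) ` {..s}. fps_nth H n * fps_nth C (2 * s + 2 - n) = 0"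
    proof
      fix n assume n: "n \<in> {..2 * s + 2} - (\<lambda>i. 2 * i) ` {..s}"
      show "fps_nth H n * fps_nth C (2 * s + 2 - n) = 0"
      proof (cases "even n")
        case True
        then obtain i where "n = 2 * i" by (elim evenE)
        with n have "n = 2 * s + 2" by (auto simp: image_iff)
        thus ?thesis by (simp add: Cn)
      qed (use n in \<open>auto simp: Cn\<close>)
    qed
  qed auto
  also have "\<dots> = (\<Sum>i\<le>s. fps_nth H (2 * i) * fps_nth C (2 * s + 2 - 2 * i))"
    by (subst sum.reindex) (auto simp: inj_on_def)
  also have "\<dots> = (\<Sum>i\<le>s. 2 * ((2 * real i - 1) * bernoulli (2 * i) / fact (2 * i) / fact (2 * s + 2 - 2 * i)))"
    by (intro sum.cong refl) (auto simp: Hn Cn)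
  also have "\<dots> = 2 * (\<Sum>i\<le>s. (2 * real i - 1) * bernoulli (2 * i) / fact (2 * i) / fact (2 * s + 2 - 2 * i))"
    by (simp only: sum_distrib_left)
  finally show ?thesis by simp
qed

definition ln_fps :: "real fps" where "ln_fps = Abs_fps (\<lambda>n. - ((- 1) ^ n) / real n)"

definition inverse_power_fps :: "nat \<Rightarrow> real fps" where
  "inverse_power_fps j = Abs_fps (\<lambda>n. (- 1) ^ n * pochhammer (real j) n / fact n)"

lemma eventually_abs_less_1: "eventually (\<lambda>x::real. \<bar>x\<bar> < 1) (nhds 0)"
  using eventually_nhds_in_open[of "ball 0 1" "0::real"] by (simp add: dist_norm)

lemma ln_asymp_series: "asymp_series (nhds 0) (\<lambda>x. x) (\<lambda>x. ln (1 + x)) ln_fps"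
proof (rule asymp_series_nhds_0)
  show "eventually (\<lambda>x. (\<lambda>n. fps_nth ln_fps n * x ^ n) sums ln (1 + x)) (nhds 0)"
    using eventually_abs_less_1
  proof eventually_elim
    case (elim x)
    have "(\<lambda>n. - ((-x) ^ n) / real n) sums ln (1 + x)" using ln_series'[OF elim] by simp
    also have "(\<lambda>n. - ((-x) ^ n) / real n) = (\<lambda>n. fps_nth ln_fps n * x ^ n)"
      by (simp add: ln_fps_def fun_eq_iff power_minus[of x])
    finally show ?case .
  qed
qed

lemma inverse_power_asymp_series:
  "asymp_series (nhds 0) (\<lambda>x. x) (\<lambda>x. 1 / (1 + x) ^ j) (inverse_power_fps j)"
proof (rule asymp_series_nhds_0)
  show "eventually (\<lambda>x. (\<lambda>n. fps_nth (inverse_power_fps j) n * x ^ n) sums (1 / (1 + x) ^ j)) (nhds 0)"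
    using eventually_abs_less_1
  proof eventually_elim
    case (elim x)
    have "(\<lambda>n. (- real j gchoose n) * x ^ n) sums (1 + x) powr - real j"
      by (rule gen_binomial_real) (use elim in simp)
    also have "(\<lambda>n. (- real j gchoose n) * x ^ n) = (\<lambda>n. fps_nth (inverse_power_fps j) n * x ^ n)"
      by (simp add: inverse_power_fps_def gbinomial_pochhammer)
    also have "(1 + x) powr - real j = 1 / (1 + x) ^ j"
      using elim by (simp add: powr_minus powr_realpow divide_inverse)
    finally show ?case .
  qed
qed

interpretation nhds_scale: asymptotic_scale "nhds (0::real)" "\<lambda>x. x"
  by standard (rule filterlim_ident)

definition sq_ln_fps :: "real fps" where "sq_ln_fps = (1 + fps_X) ^ 2 * ln_fps"

lemma sq_ln_asymp_series:
  "asymp_series (nhds 0) (\<lambda>x. x) (\<lambda>x. (1 + x)\<^sup>2 * ln (1 + x)) sq_ln_fps"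
proof -
  have "asymp_series (nhds 0) (\<lambda>x. x) (\<lambda>x. 1 + x) (1 + fps_X)"
    using nhds_scale.series_add[OF nhds_scale.series_const[of 1] nhds_scale.series_scale] by simp
  from nhds_scale.series_mult[OF nhds_scale.series_power[OF this] ln_asymp_series]
  show ?thesis by (simp add: sq_ln_fps_def)
qed

text \<open>The case distinction is that of $(1+x)^2\ln(1+x)$: the first three coefficients are
affected by the truncation of the logarithmic series at $0$, the others follow one pattern.\<close>

lemma sq_ln_fps_nth:
  "fps_nth sq_ln_fps n = (if n = 0 then 0 else if n = 1 then 1 else if n = 2 then 3 / 2
     else 2 * (- 1) ^ Suc n / (real n * (real n - 1) * (real n - 2)))"
proof -
  have e: "sq_ln_fps = ln_fps + 2 * (fps_X * ln_fps) + fps_X ^ 2 * ln_fps"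
    by (simp add: sq_ln_fps_def power2_eq_square algebra_simps)
  have n: "fps_nth sq_ln_fps n = fps_nth ln_fps n + 2 * (if n = 0 then 0 else fps_nth ln_fps (n - 1)) +
      (if n < 2 then 0 else fps_nth ln_fps (n - 2))" for n
    by (simp add: e fps_X_power_mult_nth)
  consider "n = 0" | "n = 1" | "n = 2" | k where "n = k + 3"
    by (metis One_nat_def Suc_1 add_Suc_right add.commute numeral_3_eq_3 not0_implies_Suc plus_nat.add_0 add_2_eq_Suc')
  thus ?thesis
  proof cases
    case 4
    have "fps_nth sq_ln_fps n = (- 1) ^ k * (1 / (real k + 3) - 2 / (real k + 2) + 1 / (real k + 1)) "
      unfolding n using 4 by (simp add: ln_fps_def numeral_3_eq_3 field_simps)
    also have "1 / (real k + 3) - 2 / (real k + 2) + 1 / (real k + 1) =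
               2 / ((real k + 3) * (real k + 2) * (real k + 1))"
      by (simp add: divide_simps) (simp add: algebra_simps)
    finally show ?thesis using 4 by (simp add: power_add add.commute)
  qed (simp_all add: n ln_fps_def)
qed

context asymptotic_scale
begin

text \<open>The most frequent instance of substitution, with explicit coefficients.\<close>

lemma series_linear:
  assumes "asymp_series (nhds 0) (\<lambda>x. x) h H"
  shows "asymp_series F e (\<lambda>x. h (c * e x)) (Abs_fps (\<lambda>n. c ^ n * fps_nth H n))"
proof -
  have "asymp_series F e (\<lambda>x. c * e x) (fps_const c * fps_X)"
    by (intro series_cmult series_scale)
  from series_compose[OF assms this] show ?thesis by (simp add: fps_compose_linear)
qed

end

section \<open>An approximate solution of a second-order difference equation\<close>

definition barnes_coeff :: "nat \<Rightarrow> real" where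
  "barnes_coeff k = bernoulli (2 * k + 2) / (4 * real k * (real k + 1))"

text \<open>The expansion of $\ln G(1+z)$, truncated after \<open>K\<close> terms, without its constant and
linear terms. The latter cancel in all differences formed below.\<close>

definition barnes :: "nat \<Rightarrow> real \<Rightarrow> real" where
  "barnes K z = z\<^sup>2 / 2 * ln z - 3 / 4 * z\<^sup>2 - ln z / 12 + (\<Sum>k = 1..K. barnes_coeff k / z ^ (2 * k))"

text \<open>The coefficients, as a series in $1/z$, of the second central difference of \<open>barnes K\<close>
minus $\ln z$.\<close>

definition second_diff_fps :: "nat \<Rightarrow> real fps" where
  "second_diff_fps K = Abs_fps (\<lambda>n. if odd n then 0 else
      fps_nth sq_ln_fps (n + 2) - (if n = 0 then 3 / 2 else 0) - fps_nth ln_fps n / 6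
      + (\<Sum>k = 1..K. if n \<le> 2 * k then 0 else 2 * barnes_coeff k * fps_nth (inverse_power_fps (2 * k)) (n - 2 * k)))"

text \<open>In this form the numbers match the summands of \<open>bernoulli_even_convolution\<close>; there the
summands of index $0$ and $1$ correspond to the terms $z^2\ln z/2$ and $-\ln z/12$.\<close>

lemma barnes_coeff_alt:
  assumes "k \<ge> 1"
  shows "barnes_coeff k = fact (2 * k - 1) * ((2 * real (k + 1) - 1) * bernoulli (2 * (k + 1)) / fact (2 * (k + 1)))"
proof -
  obtain j where j: "k = Suc j" using assms by (cases k) auto
  have f: "fact (2 * (k + 1)) = (2 * real k + 2) * (2 * real k + 1) * (2 * real k) * (fact (2 * k - 1) :: real)"
    by (simp add: j algebra_simps)
  have e: "2 * (k + 1) = 2 * k + 2" by simp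
  have r: "2 * real (k + 1) - 1 = 2 * real k + 1" by simp
  have "fact (2 * k - 1) * ((2 * real k + 1) * b / ((2 * real k + 2) * (2 * real k + 1) * (2 * real k) * (fact (2 * k - 1) :: real)))
        = b / (4 * real k * (real k + 1))" for b :: real
    using assms by (simp add: divide_simps)
  thus ?thesis unfolding f r unfolding e barnes_coeff_def by simp
qed

lemma pochhammer_of_nat_fact:
  assumes "j \<ge> 1" shows "pochhammer (real j) n = fact (j + n - 1) / fact (j - 1)"
proof -
  obtain i where "j = Suc i" using assms by (cases j) auto
  moreover have "fact (i + n) = fact i * pochhammer (real (Suc i)) n"
    by (induction n) (auto simp: pochhammer_Suc algebra_simps)
  ultimately show ?thesis by simp
qed

lemma bernoulli_0 [simp]: "bernoulli 0 = 1" by (simp add: bernoulli.simps)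
lemma bernoulli_1 [simp]: "bernoulli (Suc 0) = - 1 / 2" by (simp add: bernoulli.simps)
lemma bernoulli_2: "bernoulli 2 = 1 / 6"
  using bernoulli_sum_zero[of 2] by (simp add: numeral_2_eq_2)

text \<open>The coefficient of $z^{-2s}$ is, up to the factor $2(2s-1)!$, the convolution of
Bernoulli numbers that vanishes by \<open>bernoulli_even_convolution\<close>; all its terms are present as long
as $s \le K$.\<close>

lemma second_diff_fps_zero:
  assumes "n < 2 * K + 2" shows "fps_nth (second_diff_fps K) n = 0"
proof (cases "odd n")
  case True
  thus ?thesis by (simp add: second_diff_fps_def)
next
  case False
  hence "even n" by simp
  then obtain s where n: "n = 2 * s" by (rule evenE)
  show ?thesis
  proof (cases "s = 0")
    case True
    thus ?thesis by (simp add: n second_diff_fps_def sq_ln_fps_nth ln_fps_def)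
  next
    case s: False
    define h where "h = (\<lambda>i. (2 * real i - 1) * bernoulli (2 * i) / fact (2 * i))"
    have sq: "fps_nth sq_ln_fps (n + 2) = 2 * fact (2 * s - 1) * (h 0 / fact (2 * s + 2))"
    proof -
      obtain t where "s = Suc t" using s by (cases s) auto
      thus ?thesis by (simp add: n sq_ln_fps_nth h_def divide_simps)
    qed
    have l: "- (fps_nth ln_fps n / 6) = 2 * fact (2 * s - 1) * (h 1 / fact (2 * s))"
    proof -
      obtain t where "s = Suc t" using s by (cases s) auto
      thus ?thesis by (simp add: n ln_fps_def h_def bernoulli_2 divide_simps)
    qed
    have b: "2 * barnes_coeff k * fps_nth (inverse_power_fps (2 * k)) (n - 2 * k) =
          2 * fact (2 * s - 1) * (h (k + 1) / fact (2 * s - 2 * k))" if "k \<in> {1..<s}" for k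
    proof -
      have e: "even (n - 2 * k)" by (simp add: n)
      have p: "pochhammer (real (2 * k)) (n - 2 * k) = fact (2 * s - 1) / fact (2 * k - 1)"
        using that by (subst pochhammer_of_nat_fact) (auto simp: n)
      have "2 * barnes_coeff k * fps_nth (inverse_power_fps (2 * k)) (n - 2 * k) =
            2 * (fact (2 * k - 1) * h (k + 1)) * (fact (2 * s - 1) / fact (2 * k - 1) / fact (n - 2 * k))"
        using that e unfolding inverse_power_fps_def h_def p[symmetric]
        by (subst barnes_coeff_alt) (auto simp: minus_one_power_iff)
      also have "\<dots> = 2 * fact (2 * s - 1) * (h (k + 1) / fact (2 * s - 2 * k))"
        by (simp add: n)
      finally show ?thesis .
    qed
    have S: "(\<Sum>k = 1..K. if n \<le> 2 * k then 0 else 2 * barnes_coeff k * fps_nth (inverse_power_fps (2 * k)) (n - 2 * k)) =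
          (\<Sum>k\<in>{1..<s}. 2 * fact (2 * s - 1) * (h (k + 1) / fact (2 * s - 2 * k)))"
      by (rule sum.mono_neutral_cong_right) (use assms b in \<open>auto simp: n\<close>)
    have "fps_nth (second_diff_fps K) n = fps_nth sq_ln_fps (n + 2) + - (fps_nth ln_fps n / 6) +
       (\<Sum>k = 1..K. if n \<le> 2 * k then 0 else 2 * barnes_coeff k * fps_nth (inverse_power_fps (2 * k)) (n - 2 * k))"
      unfolding second_diff_fps_def n using s by simp
    also have "\<dots> = 2 * fact (2 * s - 1) *
       (h 0 / fact (2 * s + 2) + h 1 / fact (2 * s) + (\<Sum>k\<in>{1..<s}. h (k + 1) / fact (2 * s - 2 * k)))"
      unfolding sq l S by (simp only: distrib_left sum_distrib_left)
    also have "h 0 / fact (2 * s + 2) + h 1 / fact (2 * s) + (\<Sum>k\<in>{1..<s}. h (k + 1) / fact (2 * s - 2 * k)) =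
               (\<Sum>i\<le>s. h i / fact (2 * s + 2 - 2 * i))"
    proof -
      obtain t where t: "s = Suc t" using s by (cases s) auto
      have "(\<Sum>i\<le>s. h i / fact (2 * s + 2 - 2 * i)) =
            h 0 / fact (2 * s + 2) + (h 1 / fact (2 * s) + (\<Sum>i<t. h (i + 2) / fact (2 * s - 2 * (i + 1))))"
        unfolding t lessThan_Suc_atMost[symmetric] sum.lessThan_Suc_shift by simp
      moreover have "(\<Sum>i<t. h (i + 2) / fact (2 * s - 2 * (i + 1))) = (\<Sum>k\<in>{1..<s}. h (k + 1) / fact (2 * s - 2 * k))"
        by (rule sum.reindex_bij_witness[of _ "\<lambda>k. k - 1" "\<lambda>i. i + 1"]) (auto simp: t)
      ultimately show ?thesis by simp
    qed
    also have "\<dots> = 0" using bernoulli_even_convolution[of s] s by (simp add: h_def)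
    finally show ?thesis by simp
  qed
qed

interpretation at_top_scale: asymptotic_scale at_top "\<lambda>z::real. 1 / z"
  by standard (real_asymp)

text \<open>With $w = 1/z$ the second difference is an even function of $w$ with a convergent power
series, up to the term $\ln z$.\<close>

lemma barnes_second_difference:
  "(\<lambda>z. barnes K (z + 1) - 2 * barnes K z + barnes K (z - 1) - ln z) \<in> O(\<lambda>z. 1 / z ^ (2 * K + 2))"
proof -
  \<comment> \<open>The even part of a series: odd coefficients of $h(w)+h(-w)$ cancel.\<close>
  have sym: "asymp_series at_top (\<lambda>z. 1 / z) (\<lambda>z. h (1 / z) + h (- (1 / z)))
      (Abs_fps (\<lambda>n. if odd n then 0 else 2 * fps_nth H n))"
    if "asymp_series (nhds 0) (\<lambda>x. x) h H" for h H
  proof -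
    have "asymp_series at_top (\<lambda>z. 1 / z) (\<lambda>z. h (1 * (1 / z)) + h ((- 1) * (1 / z)))
      (Abs_fps (\<lambda>n. 1 ^ n * fps_nth H n) + Abs_fps (\<lambda>n. (- 1) ^ n * fps_nth H n))"
      by (intro at_top_scale.series_add at_top_scale.series_linear that)
    moreover have "Abs_fps (\<lambda>n. 1 ^ n * fps_nth H n) + Abs_fps (\<lambda>n. (- 1) ^ n * fps_nth H n) =
        Abs_fps (\<lambda>n. if odd n then 0 else 2 * fps_nth H n)"
      by (auto simp: fps_eq_iff minus_one_power_iff)
    ultimately show ?thesis by simp
  qed
  have nz: "eventually (\<lambda>z::real. 1 / z \<noteq> 0) at_top"
    using eventually_gt_at_top[of 0] by eventually_elim auto
  define P where "P = Abs_fps (\<lambda>n. if odd n then 0 else 2 * fps_nth sq_ln_fps n)"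
  define L where "L = Abs_fps (\<lambda>n. if odd n then 0 else 2 * fps_nth ln_fps n)"
  define Q where "Q = (\<lambda>k. Abs_fps (\<lambda>n. if odd n then 0 else 2 * fps_nth (inverse_power_fps (2 * k)) n))"
  define T where "T = fps_const (1 / 2) * fps_shift 1 (fps_shift 1 P) - fps_const (3 / 2) - fps_const (1 / 12) * L +
     (\<Sum>k=1..K. fps_const (barnes_coeff k) * (fps_X ^ (2 * k) * (Q k - fps_const 2)))"
  define R where "R = (\<lambda>z::real. 1 / 2 * (((1 + 1 / z)\<^sup>2 * ln (1 + 1 / z) + (1 + - (1 / z))\<^sup>2 * ln (1 + - (1 / z))) / (1 / z) / (1 / z))
     - 3 / 2 - 1 / 12 * (ln (1 + 1 / z) + ln (1 + - (1 / z))) +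
     (\<Sum>k=1..K. barnes_coeff k * ((1 / z) ^ (2 * k) * (1 / (1 + 1 / z) ^ (2 * k) + 1 / (1 + - (1 / z)) ^ (2 * k) - 2))))"
  have "asymp_series at_top (\<lambda>z. 1 / z) R T"
    unfolding R_def T_def
  proof (intro at_top_scale.series_add at_top_scale.series_diff at_top_scale.series_sum
      at_top_scale.series_cmult at_top_scale.series_const at_top_scale.series_divide_scale nz
      at_top_scale.series_mult at_top_scale.series_scale_power)
    show "asymp_series at_top (\<lambda>z. 1 / z) (\<lambda>x. (1 + 1 / x)\<^sup>2 * ln (1 + 1 / x) + (1 + - (1 / x))\<^sup>2 * ln (1 + - (1 / x))) P"
      unfolding P_def by (rule sym[OF sq_ln_asymp_series])
    show "asymp_series at_top (\<lambda>z. 1 / z) (\<lambda>x. ln (1 + 1 / x) + ln (1 + - (1 / x))) L"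
      unfolding L_def by (rule sym[OF ln_asymp_series])
    show "asymp_series at_top (\<lambda>z. 1 / z) (\<lambda>x. 1 / (1 + 1 / x) ^ (2 * k) + 1 / (1 + - (1 / x)) ^ (2 * k)) (Q k)" for k
      unfolding Q_def by (rule sym[OF inverse_power_asymp_series])
  qed (simp_all add: P_def sq_ln_fps_nth)
  moreover have "T = second_diff_fps K"
  proof (rule fps_ext)
    fix n
    have "fps_nth (fps_X ^ (2 * k) * (Q k - fps_const 2)) n =
       (if odd n \<or> n \<le> 2 * k then 0 else 2 * fps_nth (inverse_power_fps (2 * k)) (n - 2 * k))" for k
      by (auto simp: fps_X_power_mult_nth Q_def inverse_power_fps_def)
    hence "fps_nth T n = 1 / 2 * fps_nth P (n + 2) - (if n = 0 then 3 / 2 else 0) - fps_nth L n / 12 +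
      (\<Sum>k=1..K. barnes_coeff k * (if odd n \<or> n \<le> 2 * k then 0 else 2 * fps_nth (inverse_power_fps (2 * k)) (n - 2 * k)))"
      by (simp add: T_def fps_sum_nth numeral_2_eq_2)
    thus "fps_nth T n = fps_nth (second_diff_fps K) n"
      by (auto simp: P_def L_def second_diff_fps_def intro!: sum.cong)
  qed
  ultimately have "asymp_series at_top (\<lambda>z. 1 / z) R (second_diff_fps K)" by simp
  from asymp_seriesD[OF this, of "2 * K + 2"]
  have RO: "R \<in> O(\<lambda>z. 1 / z ^ (2 * K + 2))"
    by (simp add: second_diff_fps_zero power_one_over del: power_Suc power_add)
  have "eventually (\<lambda>z. barnes K (z + 1) - 2 * barnes K z + barnes K (z - 1) - ln z = R z) at_top"
    using eventually_gt_at_top[of 2]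
  proof eventually_elim
    case (elim z)
    have z: "z > 2" by fact
    have a: "z + 1 = z * (1 + 1 / z)" "z - 1 = z * (1 + - (1 / z))" using z by (auto simp: field_simps)
    have p: "1 + 1 / z > 0" "1 + - (1 / z) > 0" using z by (auto simp: field_simps)
    have ln: "ln (z + 1) = ln z + ln (1 + 1 / z)" "ln (z - 1) = ln z + ln (1 + - (1 / z))"
      unfolding a using z p by (simp_all add: ln_mult)
    have s: "(z + 1)\<^sup>2 = z\<^sup>2 * (1 + 1 / z)\<^sup>2" "(z - 1)\<^sup>2 = z\<^sup>2 * (1 + - (1 / z))\<^sup>2"
      unfolding a by (simp_all only: power_mult_distrib)
    have main: "(z + 1)\<^sup>2 / 2 * ln (z + 1) - 3 / 4 * (z + 1)\<^sup>2 - 2 * (z\<^sup>2 / 2 * ln z - 3 / 4 * z\<^sup>2) +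
        ((z - 1)\<^sup>2 / 2 * ln (z - 1) - 3 / 4 * (z - 1)\<^sup>2) - ln z =
       1 / 2 * (((1 + 1 / z)\<^sup>2 * ln (1 + 1 / z) + (1 + - (1 / z))\<^sup>2 * ln (1 + - (1 / z))) / (1 / z) / (1 / z)) - 3 / 2"
    proof -
      have gen: "1 / 2 * ((A * P + B * Q) / (1 / z) / (1 / z)) = z\<^sup>2 * A / 2 * P + z\<^sup>2 * B / 2 * Q" for A B P Q :: real
        by (simp add: power2_eq_square algebra_simps add_divide_distrib)
      have "1 / 2 * (((1 + 1 / z)\<^sup>2 * ln (1 + 1 / z) + (1 + - (1 / z))\<^sup>2 * ln (1 + - (1 / z))) / (1 / z) / (1 / z))
         = (z + 1)\<^sup>2 / 2 * ln (1 + 1 / z) + (z - 1)\<^sup>2 / 2 * ln (1 + - (1 / z))"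
        unfolding s gen ..
      thus ?thesis unfolding ln
        by (simp add: power2_eq_square algebra_simps add_divide_distrib diff_divide_distrib)
    qed
    have sums: "barnes_coeff k / (z + 1) ^ (2 * k) - 2 * (barnes_coeff k / z ^ (2 * k)) + barnes_coeff k / (z - 1) ^ (2 * k) =
       barnes_coeff k * ((1 / z) ^ (2 * k) * (1 / (1 + 1 / z) ^ (2 * k) + 1 / (1 + - (1 / z)) ^ (2 * k) - 2))" for k
      unfolding a power_mult_distrib by (simp add: power_one_over power_inverse algebra_simps divide_inverse)
    have "barnes K (z + 1) - 2 * barnes K z + barnes K (z - 1) - ln z =
       ((z + 1)\<^sup>2 / 2 * ln (z + 1) - 3 / 4 * (z + 1)\<^sup>2 - 2 * (z\<^sup>2 / 2 * ln z - 3 / 4 * z\<^sup>2) +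
        ((z - 1)\<^sup>2 / 2 * ln (z - 1) - 3 / 4 * (z - 1)\<^sup>2) - ln z)
       - 1 / 12 * (ln (z + 1) - 2 * ln z + ln (z - 1)) +
       (\<Sum>k=1..K. barnes_coeff k / (z + 1) ^ (2 * k) - 2 * (barnes_coeff k / z ^ (2 * k)) + barnes_coeff k / (z - 1) ^ (2 * k))"
      by (simp add: barnes_def sum.distrib sum_subtractf sum_distrib_left algebra_simps)
    also have "\<dots> = R z" unfolding main sums R_def by (simp add: ln)
    finally show ?case .
  qed
  from landau_o.big.in_cong[OF this] RO show ?thesis by simp
qed

section \<open>The Gamma function as a difference of the approximate solution\<close>

text \<open>Since $G(1+z)/G(z) = \Gamma(z)$, the first difference of \<open>barnes\<close> approximates
$\ln\Gamma$ up to a constant and a small remainder. Only differences of this error at two points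
matter, in which the constant cancels.\<close>

definition stirling_error :: "nat \<Rightarrow> real \<Rightarrow> real" where
  "stirling_error K z = ln_Gamma z - (barnes K z - barnes K (z - 1))"

lemma ln_Gamma_real_plus1: "x > 0 \<Longrightarrow> ln_Gamma (x + 1) = ln_Gamma x + ln (x::real)"
proof -
  assume x: "x > 0"
  hence "x \<notin> \<int>\<^sub>\<le>\<^sub>0" using nonpos_Ints_nonpos[of x] by auto
  hence "Gamma (x + 1) = x * Gamma x" by (rule Gamma_plus1)
  thus ?thesis using x Gamma_real_pos[OF x] by (simp add: ln_Gamma_real_pos ln_mult_pos)
qed

lemma ln_Gamma_shift:
  "x > 0 \<Longrightarrow> ln_Gamma (x + real N) = ln_Gamma x + (\<Sum>k<N. ln (x + real k))"
proof (induction N)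
  case (Suc N)
  have "ln_Gamma (x + real N + 1) = ln_Gamma (x + real N) + ln (x + real N)"
    by (rule ln_Gamma_real_plus1) (use Suc in auto)
  thus ?case using Suc by (simp add: add_ac)
qed simp

text \<open>Gauss' product formula for the Gamma function, read as a statement about
$\ln\Gamma$ far to the right.\<close>

lemma ln_Gamma_shift_tendsto:
  assumes a: "a > 0"
  shows "(\<lambda>N. ln_Gamma (a + 1 + real N) - a * ln (real N) - (\<Sum>k=1..N. ln (real k))) \<longlonglongrightarrow> 0"
proof -
  have "(\<lambda>N. ln_Gamma a - ln_Gamma_series a N) \<longlonglongrightarrow> ln_Gamma a - ln_Gamma a"
    by (intro tendsto_diff tendsto_const ln_Gamma_real_LIMSEQ a)
  moreover have "ln_Gamma a - ln_Gamma_series a N =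
      ln_Gamma (a + 1 + real N) - a * ln (real N) - (\<Sum>k=1..N. ln (real k))" for N
  proof -
    have "ln_Gamma (a + 1 + real N) = ln_Gamma a + (\<Sum>k<Suc N. ln (a + real k))"
      using ln_Gamma_shift[OF a, of "Suc N"] by (simp add: add_ac)
    also have "(\<Sum>k<Suc N. ln (a + real k)) = ln a + (\<Sum>k=1..N. ln (a + real k))"
      by (simp add: sum.lessThan_Suc_shift sum.atLeast1_atMost_eq del: sum.lessThan_Suc)
    also have "(\<Sum>k=1..N. ln (a + real k)) = (\<Sum>k=1..N. ln (a / real k + 1) + ln (real k))"
    proof (rule sum.cong)
      fix k assume "k \<in> {1..N}"
      hence k: "real k > 0" by simp
      have "a + real k = (a / real k + 1) * real k" using k by (simp add: field_simps)
      moreover have "a / real k + 1 > 0" using k a by (simp add: add_pos_pos)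
      ultimately show "ln (a + real k) = ln (a / real k + 1) + ln (real k)"
        using k by (simp only: ln_mult_pos)
    qed simp
    finally show ?thesis by (simp add: ln_Gamma_series_def sum.distrib)
  qed
  ultimately show ?thesis by simp
qed

text \<open>The expansion of $(b+t)^2\ln(b+t)/2$ for large $t$ up to terms tending to $0$.\<close>

lemma sq_ln_shift_tendsto:
  fixes b :: real
  shows "((\<lambda>t. (b + t)\<^sup>2 / 2 * ln (b + t) - (t\<^sup>2 / 2 + b * t + b\<^sup>2 / 2) * ln t - b * t / 2) \<longlongrightarrow> 3 / 4 * b\<^sup>2) at_top"
proof -
  define H where "H = Abs_fps (\<lambda>n. b ^ n * fps_nth sq_ln_fps n) - fps_const b * fps_X"
  have nz: "eventually (\<lambda>z::real. 1 / z \<noteq> 0) at_top"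
    using eventually_gt_at_top[of 0] by eventually_elim auto
  have "asymp_series at_top (\<lambda>t. 1 / t)
     (\<lambda>t. (1 + b * (1 / t))\<^sup>2 * ln (1 + b * (1 / t)) - b * (1 / t)) H"
    unfolding H_def
    by (intro at_top_scale.series_diff at_top_scale.series_linear at_top_scale.series_cmult
          at_top_scale.series_scale sq_ln_asymp_series)
  hence "asymp_series at_top (\<lambda>t. 1 / t)
     (\<lambda>t. ((1 + b * (1 / t))\<^sup>2 * ln (1 + b * (1 / t)) - b * (1 / t)) / (1 / t) / (1 / t))
     (fps_shift 1 (fps_shift 1 H))"
    by (intro at_top_scale.series_divide_scale nz) (simp_all add: H_def sq_ln_fps_nth)
  from at_top_scale.series_tendsto[OF this]
  have "((\<lambda>t. ((1 + b * (1 / t))\<^sup>2 * ln (1 + b * (1 / t)) - b * (1 / t)) / (1 / t) / (1 / t)) \<longlongrightarrow> b\<^sup>2 * (3 / 2)) at_top"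
    by (simp add: H_def sq_ln_fps_nth numeral_2_eq_2)
  hence "((\<lambda>t. 1 / 2 * (((1 + b * (1 / t))\<^sup>2 * ln (1 + b * (1 / t)) - b * (1 / t)) / (1 / t) / (1 / t))) \<longlongrightarrow> 1 / 2 * (b\<^sup>2 * (3 / 2))) at_top"
    by (intro tendsto_mult tendsto_const)
  also have "1 / 2 * (b\<^sup>2 * (3 / 2)) = 3 / 4 * b\<^sup>2" by simp
  finally show ?thesis
  proof (rule Lim_transform_eventually)
    show "eventually (\<lambda>t. 1 / 2 * (((1 + b * (1 / t))\<^sup>2 * ln (1 + b * (1 / t)) - b * (1 / t)) / (1 / t) / (1 / t)) =
       (b + t)\<^sup>2 / 2 * ln (b + t) - (t\<^sup>2 / 2 + b * t + b\<^sup>2 / 2) * ln t - b * t / 2) at_top"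
      using eventually_gt_at_top[of "max 0 (- b)"]
    proof eventually_elim
      case (elim t)
      define P where "P = ln (1 + b * (1 / t))"
      have "1 + b * (1 / t) > 0" using elim by (simp add: field_simps)
      moreover have "b + t = t * (1 + b * (1 / t))" using elim by (simp add: field_simps)
      ultimately have "ln (b + t) = ln t + P" using elim by (simp only: ln_mult_pos P_def)
      moreover have "1 / 2 * (((1 + b * (1 / t))\<^sup>2 * P - b * (1 / t)) / (1 / t) / (1 / t)) = (b + t)\<^sup>2 / 2 * P - b * t / 2"
        using elim by (simp add: field_simps power2_eq_square)
      ultimately show ?case
        unfolding P_def[symmetric] by (simp add: power2_eq_square algebra_simps add_divide_distrib)
    qed
  qed
qed

text \<open>With $\varphi(z) = z^2\ln z/2 - 3z^2/4 - \ln z/12$ the claim is about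
$\varphi(a+1+t)-\varphi(a+t)-\varphi(1+t)+\varphi(t)-a\ln t$, whose limit is read off the preceding
expansion at $b = a+1$, $a$ and $1$; the inverse powers tend to $0$.\<close>

lemma barnes_shift_tendsto:
  "(\<lambda>N. (barnes K (a + 1 + real N) - barnes K (a + real N)) - a * ln (real N)
        - (barnes K (1 + real N) - barnes K (real N))) \<longlonglongrightarrow> 0"
proof -
  define \<phi> where "\<phi> = (\<lambda>z::real. z\<^sup>2 / 2 * ln z - 3 / 4 * z\<^sup>2 - ln z / 12)"
  define s where "s = (\<lambda>z. \<Sum>k = 1..K. barnes_coeff k / z ^ (2 * k))"
  have b: "barnes K z = \<phi> z + s z" for z by (simp add: barnes_def \<phi>_def s_def)
  have "((\<lambda>t. (\<phi> (a + 1 + t) - \<phi> (a + t)) - a * ln t - (\<phi> (1 + t) - \<phi> t)) \<longlongrightarrow> 0) at_top"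
  proof -
    define D where "D = (\<lambda>b t::real. (b + t)\<^sup>2 / 2 * ln (b + t) - (t\<^sup>2 / 2 + b * t + b\<^sup>2 / 2) * ln t - b * t / 2)"
    define l where "l = (\<lambda>b t::real. ln (b + t) - ln t)"
    have l: "(l b \<longlongrightarrow> 0) at_top" for b unfolding l_def by real_asymp
    have D: "(D b \<longlongrightarrow> 3 / 4 * b\<^sup>2) at_top" for b unfolding D_def by (rule sq_ln_shift_tendsto)
    have "((\<lambda>t. (D (a + 1) t - D a t - D 1 t) - 3 / 2 * a - 1 / 12 * (l (a + 1) t - l a t - l 1 t)) \<longlongrightarrow>
       (3 / 4 * (a + 1)\<^sup>2 - 3 / 4 * a\<^sup>2 - 3 / 4 * 1\<^sup>2) - 3 / 2 * a - 1 / 12 * (0 - 0 - 0)) at_top"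
      by (intro tendsto_intros D l)
    also have "(3 / 4 * (a + 1)\<^sup>2 - 3 / 4 * a\<^sup>2 - 3 / 4 * 1\<^sup>2) - 3 / 2 * a - 1 / 12 * (0 - 0 - 0) = 0"
      by (simp add: power2_eq_square algebra_simps)
    also have "(\<lambda>t. (D (a + 1) t - D a t - D 1 t) - 3 / 2 * a - 1 / 12 * (l (a + 1) t - l a t - l 1 t)) =
       (\<lambda>t. (\<phi> (a + 1 + t) - \<phi> (a + t)) - a * ln t - (\<phi> (1 + t) - \<phi> t))"
      by (simp add: fun_eq_iff D_def l_def \<phi>_def power2_eq_square algebra_simps add_divide_distrib diff_divide_distrib)
    finally show ?thesis .
  qed
  hence 1: "(\<lambda>N. (\<phi> (a + 1 + real N) - \<phi> (a + real N)) - a * ln (real N) - (\<phi> (1 + real N) - \<phi> (real N))) \<longlonglongrightarrow> 0"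
    by (rule filterlim_compose[OF _ filterlim_real_sequentially])
  have s: "(\<lambda>N. s (x + real N)) \<longlonglongrightarrow> 0" for x
    unfolding s_def
  proof (rule tendsto_null_sum)
    fix k assume k: "k \<in> {1..K}"
    have "filterlim (\<lambda>N. (x + real N) ^ (2 * k)) at_infinity sequentially"
      by (intro filterlim_at_top_imp_at_infinity filterlim_pow_at_top
            filterlim_tendsto_add_at_top[OF tendsto_const filterlim_real_sequentially])
         (use k in auto)
    thus "(\<lambda>N. barnes_coeff k / (x + real N) ^ (2 * k)) \<longlonglongrightarrow> 0"
      by (intro tendsto_divide_0[OF tendsto_const])
  qed
  have "(\<lambda>N. ((\<phi> (a + 1 + real N) - \<phi> (a + real N)) - a * ln (real N) - (\<phi> (1 + real N) - \<phi> (real N)))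
     + (s (a + 1 + real N) - s (a + real N) - (s (1 + real N) - s (0 + real N)))) \<longlonglongrightarrow> 0 + (0 - 0 - (0 - 0))"
    by (intro tendsto_add tendsto_diff 1 s)
  thus ?thesis by (simp add: b algebra_simps)
qed

text \<open>Along integer shifts both $\ln\Gamma$ and the first difference of \<open>barnes\<close> have the
form $a\ln N$ plus a sequence that is the same for all starting points.\<close>

lemma stirling_error_shift_tendsto:
  assumes "x > 1" "y > 1"
  shows "(\<lambda>N. stirling_error K (x + real N) - stirling_error K (y + real N)) \<longlonglongrightarrow> 0"
proof -
  define T where "T = (\<lambda>N. (\<Sum>k=1..N. ln (real k)) - (barnes K (1 + real N) - barnes K (real N)))"
  have *: "(\<lambda>N. stirling_error K (z + real N) - T N) \<longlonglongrightarrow> 0" if "z > 1" for z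
  proof -
    define a where "a = z - 1"
    have "(\<lambda>N. (ln_Gamma (a + 1 + real N) - a * ln (real N) - (\<Sum>k=1..N. ln (real k))) -
       ((barnes K (a + 1 + real N) - barnes K (a + real N)) - a * ln (real N)
        - (barnes K (1 + real N) - barnes K (real N)))) \<longlonglongrightarrow> 0 - 0"
      by (intro tendsto_diff ln_Gamma_shift_tendsto barnes_shift_tendsto) (use that in \<open>simp add: a_def\<close>)
    moreover have "a + 1 + real N = z + real N" "a + real N = z + real N - 1" for N
      by (simp_all add: a_def)
    ultimately show ?thesis by (simp add: stirling_error_def T_def algebra_simps)
  qed
  from tendsto_diff[OF *[OF assms(1)] *[OF assms(2)]] show ?thesis by simp
qed

lemma sum_inverse_squares_le:
  assumes "z > (1::real)" shows "(\<Sum>j<N. 1 / (z + real j)\<^sup>2) \<le> 1 / (z - 1)"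
proof -
  have "(\<Sum>j<N. 1 / (z + real j)\<^sup>2) \<le> (\<Sum>j<N. 1 / (z + real j - 1) - 1 / (z + real (Suc j) - 1))"
  proof (rule sum_mono)
    fix j
    define u where "u = z + real j"
    have "u > 1" using assms by (simp add: u_def)
    hence "1 / u\<^sup>2 \<le> 1 / (u - 1) - 1 / u"
      by (simp add: divide_simps power2_eq_square)
    thus "1 / (z + real j)\<^sup>2 \<le> 1 / (z + real j - 1) - 1 / (z + real (Suc j) - 1)"
      by (simp add: u_def)
  qed
  also have "\<dots> = 1 / (z - 1) - 1 / (z + real N - 1)"
    using sum_lessThan_telescope'[of "\<lambda>j. 1 / (z + real j - 1)" N] by simp
  also have "\<dots> \<le> 1 / (z - 1)" using assms by simp
  finally show ?thesis .
qed

text \<open>The error changes by minus the second difference of \<open>barnes\<close> plus $\ln z$ when $z$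
increases by $1$, that is, by $O(z^{-2K-2})$. Summing these changes from $x$ and from $y$ to
infinity, where the two errors agree, bounds their difference.\<close>

lemma stirling_error_diff_bound:
  "\<exists>C Z. C \<ge> 0 \<and> Z \<ge> 2 \<and> (\<forall>x y. x \<ge> Z \<longrightarrow> y \<ge> Z \<longrightarrow>
     \<bar>stirling_error K x - stirling_error K y\<bar> \<le> C / x ^ (2 * K) + C / y ^ (2 * K))"
proof -
  define r where "r = (\<lambda>z. barnes K (z + 1) - 2 * barnes K z + barnes K (z - 1) - ln z)"
  obtain C where C: "C > 0" "eventually (\<lambda>z. norm (r z) \<le> C * norm (1 / z ^ (2 * K + 2))) at_top"
    using barnes_second_difference[of K] unfolding r_def by (elim landau_o.bigE)
  then obtain Z0 where Z0: "\<And>z. z \<ge> Z0 \<Longrightarrow> norm (r z) \<le> C * norm (1 / z ^ (2 * K + 2))"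
    by (auto simp: eventually_at_top_linorder)
  define Z where "Z = max Z0 2"
  have Er: "stirling_error K (z + 1) - stirling_error K z = - r z" if "z \<ge> Z" for z
  proof -
    have "ln_Gamma (z + 1) = ln_Gamma z + ln z"
      by (rule ln_Gamma_real_plus1) (use that in \<open>simp add: Z_def\<close>)
    thus ?thesis by (simp add: stirling_error_def r_def)
  qed
  \<comment> \<open>The total change from $z$ to $z+N$, uniformly in $N$.\<close>
  have far: "\<bar>stirling_error K (z + real N) - stirling_error K z\<bar> \<le> C / z ^ (2 * K)" if z: "z \<ge> Z" for z N
  proof -
    have z2: "z \<ge> 2" using z by (simp add: Z_def)
    have "stirling_error K (z + real N) - stirling_error K z =
          (\<Sum>j<N. stirling_error K (z + real (Suc j)) - stirling_error K (z + real j))"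
      using sum_lessThan_telescope[of "\<lambda>j. stirling_error K (z + real j)" N] by simp
    also have "\<bar>\<dots>\<bar> \<le> (\<Sum>j<N. \<bar>stirling_error K (z + real (Suc j)) - stirling_error K (z + real j)\<bar>)"
      by (rule sum_abs)
    also have "\<dots> \<le> (\<Sum>j<N. C / z ^ (2 * K) * (1 / (z + real j)\<^sup>2))"
    proof (rule sum_mono)
      fix j
      define u where "u = z + real j"
      have u: "u \<ge> Z" "u \<ge> z" "u > 0" using z z2 by (auto simp: u_def)
      have eq: "z + real (Suc j) = u + 1" by (simp add: u_def)
      have "\<bar>stirling_error K (z + real (Suc j)) - stirling_error K (z + real j)\<bar> = \<bar>r u\<bar>"
        using Er[OF u(1)] unfolding eq u_def[symmetric] by simp
      also have "\<dots> \<le> C * (1 / u ^ (2 * K + 2))" using Z0[of u] u by (simp add: Z_def)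
      also have "\<dots> = C * (1 / u ^ (2 * K)) * (1 / u\<^sup>2)" by (simp add: power_add power2_eq_square)
      also have "\<dots> \<le> C * (1 / z ^ (2 * K)) * (1 / u\<^sup>2)"
        using u z2 C(1) by (intro mult_right_mono mult_left_mono divide_left_mono power_mono) auto
      finally show "\<bar>stirling_error K (z + real (Suc j)) - stirling_error K (z + real j)\<bar> \<le>
          C / z ^ (2 * K) * (1 / (z + real j)\<^sup>2)" by (simp add: u_def)
    qed
    also have "\<dots> = C / z ^ (2 * K) * (\<Sum>j<N. 1 / (z + real j)\<^sup>2)" by (simp add: sum_distrib_left)
    also have "\<dots> \<le> C / z ^ (2 * K) * 1"
    proof (rule mult_left_mono)
      have "(\<Sum>j<N. 1 / (z + real j)\<^sup>2) \<le> 1 / (z - 1)" by (rule sum_inverse_squares_le) (use z2 in simp)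
      also have "\<dots> \<le> 1" using z2 by simp
      finally show "(\<Sum>j<N. 1 / (z + real j)\<^sup>2) \<le> 1" .
    qed (use C z2 in simp)
    finally show ?thesis by simp
  qed
  have "\<bar>stirling_error K x - stirling_error K y\<bar> \<le> C / x ^ (2 * K) + C / y ^ (2 * K)"
    if x: "x \<ge> Z" and y: "y \<ge> Z" for x y
  proof -
    have "x > 1" "y > 1" using x y by (auto simp: Z_def)
    from tendsto_rabs[OF stirling_error_shift_tendsto[OF this, of K]]
    have "(\<lambda>N. \<bar>stirling_error K (x + real N) - stirling_error K (y + real N)\<bar> +
            (C / x ^ (2 * K) + C / y ^ (2 * K))) \<longlonglongrightarrow> 0 + (C / x ^ (2 * K) + C / y ^ (2 * K))"
      by (intro tendsto_add tendsto_const) simp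
    moreover have "\<bar>stirling_error K x - stirling_error K y\<bar> \<le>
        \<bar>stirling_error K (x + real N) - stirling_error K (y + real N)\<bar> +
            (C / x ^ (2 * K) + C / y ^ (2 * K))" for N
      using far[OF x, of N] far[OF y, of N] by linarith
    ultimately show ?thesis by (metis (no_types, lifting) LIMSEQ_le_const add_0)
  qed
  thus ?thesis using C(1) by (intro exI[of _ C] exI[of _ Z]) (auto simp: Z_def)
qed

lemma sum_ln_Gamma_telescope:
  "(\<Sum>k<n. ln_Gamma (x - real k)) = barnes K x - barnes K (x - real n) + (\<Sum>k<n. stirling_error K (x - real k))"
proof -
  have "(\<Sum>k<n. barnes K (x - real k) - barnes K (x - real (Suc k))) = barnes K x - barnes K (x - real n)"
    using sum_lessThan_telescope'[of "\<lambda>k. barnes K (x - real k)" n] by simp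
  moreover have "ln_Gamma (x - real k) = (barnes K (x - real k) - barnes K (x - real (Suc k))) + stirling_error K (x - real k)" for k
    by (simp add: stirling_error_def algebra_simps)
  ultimately show ?thesis by (simp add: sum.distrib)
qed

section \<open>Expansion of the logarithm of the moments\<close>

context asymptotic_scale
begin

text \<open>Approximants with known series may depend on the order required. Here they are the
expressions built from \<open>barnes K\<close> with growing \<open>K\<close>.\<close>

lemma series_approx:
  assumes "\<And>N. \<exists>g G. asymp_series F e g G \<and> (\<lambda>x. f x - g x) \<in> O[F](\<lambda>x. e x ^ N) \<and>
             (\<forall>k<N. fps_nth G k = fps_nth A k)"
  shows "asymp_series F e f A"
  unfolding asymp_series_def
proof
  fix N
  obtain g G where g: "asymp_series F e g G" "(\<lambda>x. f x - g x) \<in> O[F](\<lambda>x. e x ^ N)"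
    "\<forall>k<N. fps_nth G k = fps_nth A k" using assms by blast
  have "(\<Sum>k<N. fps_nth G k * e x ^ k) = (\<Sum>k<N. fps_nth A k * e x ^ k)" for x
    using g(3) by (intro sum.cong) auto
  with sum_in_bigo(1)[OF g(2) asymp_seriesD[OF g(1), of N]]
  show "(\<lambda>x. f x - (\<Sum>k<N. fps_nth A k * e x ^ k)) \<in> O[F](\<lambda>x. e x ^ N)" by simp
qed

end

interpretation n_scale: asymptotic_scale sequentially "\<lambda>n. 1 / (real n)\<^sup>2"
  by standard real_asymp

text \<open>The logarithm of the \<open>b\<close>th moment of $W_0$ for $n/m = c$. It is defined for all
\<open>n\<close> with $n/c$ in place of $m$, so that the expansion holds as $n$ runs through all natural
numbers, whether $n/c$ is an integer or not.\<close>

definition log_moment :: "real \<Rightarrow> nat \<Rightarrow> nat \<Rightarrow> real" where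
  "log_moment c n b = real b * ln (real n / c) + (\<Sum>j=1..b. ln (1 - c * real j / (real n)\<^sup>2)) +
     (\<Sum>k<n. ln_Gamma (real n / c - real b / real n - real k) - ln_Gamma (real n / c - real k))"

definition barnes_part :: "nat \<Rightarrow> real \<Rightarrow> nat \<Rightarrow> nat \<Rightarrow> real" where
  "barnes_part K c n b = real b * ln (real n / c) + (\<Sum>j=1..b. ln (1 - c * real j / (real n)\<^sup>2)) +
     ((barnes K (real n / c - real b / real n) - barnes K (real n / c - real b / real n - real n)) -
      (barnes K (real n / c) - barnes K (real n / c - real n)))"

text \<open>All arguments of $\ln\Gamma$ are at least $n(1/c-1)$, so that each of the $n$ errors is
$O(n^{-2K})$ and the sum over $k$ is $O(n^{1-2K})$.\<close>

lemma log_moment_barnes: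
  assumes c: "0 < c" "c < 1"
  shows "(\<lambda>n. log_moment c n b - barnes_part (Suc N) c n b) \<in> O(\<lambda>n. (1 / (real n)\<^sup>2) ^ N)"
proof -
  define K where "K = Suc N"
  define v where "v = 1 / c - 1"
  have v: "v > 0" using c by (simp add: v_def field_simps)
  obtain C Z where CZ: "C \<ge> 0" "Z \<ge> 2" "\<And>x y. x \<ge> Z \<Longrightarrow> y \<ge> Z \<Longrightarrow>
     \<bar>stirling_error K x - stirling_error K y\<bar> \<le> C / x ^ (2 * K) + C / y ^ (2 * K)"
    using stirling_error_diff_bound[of K] by blast
  have "eventually (\<lambda>n. real n * v \<ge> Z) sequentially"
    by (intro eventually_compose_filterlim[OF eventually_ge_at_top[of Z]]
          filterlim_at_top_mult_tendsto_pos[OF tendsto_const v filterlim_real_sequentially])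
  moreover have "eventually (\<lambda>n. n \<ge> max 1 b) sequentially" by (rule eventually_ge_at_top)
  ultimately have "eventually (\<lambda>n. norm (log_moment c n b - barnes_part (Suc N) c n b) \<le>
        2 * C / v ^ (2 * K) * norm ((1 / (real n)\<^sup>2) ^ N)) sequentially"
  proof eventually_elim
    case (elim n)
    define U where "U = real n / c"
    define d where "d = real b / real n"
    have n: "real n \<ge> 1" using elim by auto
    have d: "0 \<le> d" "d \<le> 1" using elim n by (auto simp: d_def field_simps)
    have V: "U - real n = real n * v" by (simp add: U_def v_def algebra_simps)
    have "log_moment c n b - barnes_part (Suc N) c n b =
      (\<Sum>k<n. stirling_error K (U - d - real k) - stirling_error K (U - real k))"
      by (simp add: log_moment_def barnes_part_def sum_subtractf sum_ln_Gamma_telescope[of _ _ K]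
            flip: U_def d_def K_def)
    also have "norm \<dots> \<le> (\<Sum>k<n. \<bar>stirling_error K (U - d - real k) - stirling_error K (U - real k)\<bar>)"
      by simp
    also have "\<dots> \<le> (\<Sum>k<n. 2 * C / (real n * v) ^ (2 * K))"
    proof (rule sum_mono)
      fix k assume "k \<in> {..<n}"
      hence "real k + 1 \<le> real n" by auto
      hence ge: "U - d - real k \<ge> real n * v" "U - real k \<ge> real n * v"
        using V d by linarith+
      have "\<bar>stirling_error K (U - d - real k) - stirling_error K (U - real k)\<bar> \<le>
            C / (U - d - real k) ^ (2 * K) + C / (U - real k) ^ (2 * K)"
        by (rule CZ(3)) (use ge elim in linarith)+
      also have "\<dots> \<le> C / (real n * v) ^ (2 * K) + C / (real n * v) ^ (2 * K)"
      proof (intro add_mono divide_left_mono power_mono ge)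
        have "real n * v > 0" using n v by simp
        thus "0 < (U - d - real k) ^ (2 * K) * (real n * v) ^ (2 * K)"
          "0 < (U - real k) ^ (2 * K) * (real n * v) ^ (2 * K)" using ge
          by (auto intro!: mult_pos_pos zero_less_power)
      qed (use n v CZ in auto)
      finally show "\<bar>stirling_error K (U - d - real k) - stirling_error K (U - real k)\<bar> \<le> 2 * C / (real n * v) ^ (2 * K)"
        by simp
    qed
    also have "\<dots> = 2 * C / v ^ (2 * K) * (real n / real n ^ (2 * K))"
      by (simp add: power_mult_distrib mult_ac)
    also have "\<dots> \<le> 2 * C / v ^ (2 * K) * (1 / real n ^ (2 * N))"
    proof (rule mult_left_mono)
      have "real n / real n ^ (2 * K) = 1 / real n ^ (2 * N) * (1 / real n)"
        using n by (simp add: K_def)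
      also have "\<dots> \<le> 1 / real n ^ (2 * N) * 1" using n by (intro mult_left_mono) auto
      finally show "real n / real n ^ (2 * K) \<le> 1 / real n ^ (2 * N)" by simp
    qed (use CZ v in auto)
    also have "1 / real n ^ (2 * N) = norm ((1 / (real n)\<^sup>2) ^ N)"
      by (simp add: power_one_over power_mult)
    finally show ?case .
  qed
  thus ?thesis by (rule bigoI)
qed

text \<open>The series in $n^{-2}$ of \<open>barnes_part\<close>, assembled term by term; \<open>x\<close> and \<open>y\<close> are the
factors for which $n/c-b/n = (n/c)(1+x n^{-2})$ and
$n/c-n-b/n = (n/c-n)(1+y n^{-2})$.\<close>

definition barnes_part_fps :: "nat \<Rightarrow> real \<Rightarrow> nat \<Rightarrow> real fps" where
  "barnes_part_fps K c b =
     (let lin = (\<lambda>a H. Abs_fps (\<lambda>n. a ^ n * fps_nth H n));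
          x = - (c * real b); y = - (c * real b / (1 - c))
      in fps_const (1 / (2 * c\<^sup>2)) * fps_shift 1 (lin x sq_ln_fps)
       - fps_const ((1 - c)\<^sup>2 / (2 * c\<^sup>2)) * fps_shift 1 (lin y sq_ln_fps)
       + fps_const (3 * real b / 2 + real b * (1 - c) / c * ln (1 - c))
       - fps_const ((real b)\<^sup>2 * ln (1 - c) / 2) * fps_X
       - fps_const (1 / 12) * (lin x ln_fps - lin y ln_fps)
       + (\<Sum>k=1..K. fps_const (barnes_coeff k * c ^ (2 * k)) * (fps_X ^ k *
            ((lin x (inverse_power_fps (2 * k)) - 1)
             - fps_const (1 / (1 - c) ^ (2 * k)) * (lin y (inverse_power_fps (2 * k)) - 1))))
       + (\<Sum>j=1..b. lin (- (c * real j)) ln_fps))"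

text \<open>The effect of a small relative change of the argument, separated into terms that depend
on the relative change only and terms with a power of \<open>u\<close>.\<close>

lemma barnes_scaled:
  assumes "u > 0" "x < 1"
  shows "barnes K (u * (1 + - x)) - barnes K u =
     u\<^sup>2 / 2 * ((1 + - x)\<^sup>2 * ln (1 + - x)) + (ln u / 2 - 3 / 4) * (u\<^sup>2 * (- 2 * x + x\<^sup>2)) - ln (1 + - x) / 12
     + (\<Sum>k=1..K. barnes_coeff k / u ^ (2 * k) * (1 / (1 + - x) ^ (2 * k) - 1))"
proof -
  have ln: "ln (u * (1 + - x)) = ln u + ln (1 + - x)" using assms by (intro ln_mult_pos) auto
  have sums: "barnes_coeff k / (u * (1 + - x)) ^ (2 * k) - barnes_coeff k / u ^ (2 * k) =
     barnes_coeff k / u ^ (2 * k) * (1 / (1 + - x) ^ (2 * k) - 1)" for k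
    unfolding power_mult_distrib by (simp add: algebra_simps)
  define l where "l = ln (1 + - x)"
  have "(u * (1 + - x))\<^sup>2 / 2 * (ln u + l) - 3 / 4 * (u * (1 + - x))\<^sup>2 - (ln u + l) / 12 - (u\<^sup>2 / 2 * ln u - 3 / 4 * u\<^sup>2 - ln u / 12) =
     u\<^sup>2 / 2 * ((1 + - x)\<^sup>2 * l) + (ln u / 2 - 3 / 4) * (u\<^sup>2 * (- 2 * x + x\<^sup>2)) - l / 12"
    by (simp add: power2_eq_square algebra_simps add_divide_distrib diff_divide_distrib)
  thus ?thesis unfolding barnes_def ln sums[symmetric] sum_subtractf l_def by linarith
qed

text \<open>Substituting $u = n/c$ and $v = n/c-n$, the powers of $n$ combine to powers of $n^{-2}$,
and the terms with $\ln n$ cancel against $b\ln(n/c)$ because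
$u\cdot b/n - v\cdot b/n = b$.\<close>

lemma barnes_part_series:
  assumes c: "0 < c" "c < 1"
  shows "asymp_series sequentially (\<lambda>n. 1 / (real n)\<^sup>2) (\<lambda>n. barnes_part K c n b) (barnes_part_fps K c b)"
proof -
  define x where "x = - (c * real b)"
  define y where "y = - (c * real b / (1 - c))"
  define e where "e = (\<lambda>n. 1 / (real n)\<^sup>2)"
  define R where "R = (\<lambda>n. 1 / (2 * c\<^sup>2) * (((1 + x * e n)\<^sup>2 * ln (1 + x * e n)) / e n)
       - (1 - c)\<^sup>2 / (2 * c\<^sup>2) * (((1 + y * e n)\<^sup>2 * ln (1 + y * e n)) / e n)
       + (3 * real b / 2 + real b * (1 - c) / c * ln (1 - c))
       - (real b)\<^sup>2 * ln (1 - c) / 2 * e n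
       - 1 / 12 * (ln (1 + x * e n) - ln (1 + y * e n))
       + (\<Sum>k=1..K. barnes_coeff k * c ^ (2 * k) * (e n ^ k *
            ((1 / (1 + x * e n) ^ (2 * k) - 1)
             - 1 / (1 - c) ^ (2 * k) * (1 / (1 + y * e n) ^ (2 * k) - 1))))
       + (\<Sum>j=1..b. ln (1 + (- (c * real j)) * e n)))"
  have nz: "eventually (\<lambda>n. 1 / (real n)\<^sup>2 \<noteq> 0) sequentially"
    using eventually_gt_at_top[of 0] by eventually_elim auto
  have one: "asymp_series sequentially (\<lambda>n. 1 / (real n)\<^sup>2) (\<lambda>_. 1) 1"
    using n_scale.series_const[of 1] by simp
  have "asymp_series sequentially (\<lambda>n. 1 / (real n)\<^sup>2) R (barnes_part_fps K c b)"
    unfolding R_def barnes_part_fps_def Let_def e_def x_def[symmetric] y_def[symmetric]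
    by (intro n_scale.series_add n_scale.series_diff n_scale.series_sum n_scale.series_cmult
      n_scale.series_const n_scale.series_divide_scale nz n_scale.series_mult n_scale.series_scale_power
      n_scale.series_scale one n_scale.series_linear sq_ln_asymp_series ln_asymp_series inverse_power_asymp_series)
     (simp_all add: sq_ln_fps_nth)
  moreover have "eventually (\<lambda>n. R n = barnes_part K c n b) sequentially"
  proof -
    have "((\<lambda>n. c * real b / (1 - c) * e n) \<longlongrightarrow> c * real b / (1 - c) * 0) sequentially"
      unfolding e_def by (intro tendsto_mult tendsto_const n_scale.scale_tendsto_0)
    hence "eventually (\<lambda>n. c * real b / (1 - c) * e n < 1) sequentially"
      by (intro order_tendstoD(2)) auto
    moreover have "eventually (\<lambda>n. n > 0) sequentially" by (rule eventually_gt_at_top)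
    ultimately show ?thesis
    proof eventually_elim
      case (elim n)
      define u where "u = real n / c"
      define v where "v = u * (1 - c)"
      define X where "X = c * real b * e n"
      define Y where "Y = c * real b / (1 - c) * e n"
      have n: "real n > 0" using elim by simp
      have e: "e n > 0" using n by (simp add: e_def)
      have u: "u > 0" and v: "v > 0" using n c by (auto simp: u_def v_def)
      have "X \<le> Y"
        unfolding X_def Y_def using c e by (intro mult_right_mono) (auto simp: field_simps mult_left_le)
      hence XY: "X < 1" "Y < 1" using elim by (auto simp: Y_def)
      have xy: "x * e n = - X" "y * e n = - Y" by (auto simp: x_def y_def X_def Y_def)
      have uX: "u * X = real b / real n" using n c by (simp add: u_def X_def e_def power2_eq_square)
      have vY: "v * Y = real b / real n" using n c by (simp add: u_def v_def Y_def e_def power2_eq_square)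
      have args: "real n / c - real b / real n = u * (1 + - X)" "real n / c - real b / real n - real n = v * (1 + - Y)"
        "real n / c = u" "real n / c - real n = v"
        using uX vY n c by (auto simp: algebra_simps) (auto simp: u_def v_def field_simps)
      have u2: "u\<^sup>2 = 1 / c\<^sup>2 / e n" using n c by (simp add: u_def e_def power_divide)
      have v2: "v\<^sup>2 = (1 - c)\<^sup>2 / c\<^sup>2 / e n" by (simp add: v_def power_mult_distrib u2)
      have u2x: "u\<^sup>2 * (- 2 * X + X\<^sup>2) = - 2 * real b / c + (real b)\<^sup>2 * e n"
      proof -
        have "u\<^sup>2 * (- 2 * X + X\<^sup>2) = - 2 * u * (u * X) + (u * X)\<^sup>2"
          by (simp add: power2_eq_square algebra_simps)
        thus ?thesis unfolding uX using n by (simp add: u_def e_def power_divide)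
      qed
      have v2y: "v\<^sup>2 * (- 2 * Y + Y\<^sup>2) = - 2 * real b * (1 - c) / c + (real b)\<^sup>2 * e n"
      proof -
        have "v\<^sup>2 * (- 2 * Y + Y\<^sup>2) = - 2 * v * (v * Y) + (v * Y)\<^sup>2"
          by (simp add: power2_eq_square algebra_simps)
        thus ?thesis unfolding vY using n by (simp add: v_def u_def e_def power_divide)
      qed
      have lnv: "ln v = ln u + ln (1 - c)" unfolding v_def by (rule ln_mult_pos) (use u c in auto)
      have upow: "1 / u ^ (2 * k) = c ^ (2 * k) * e n ^ k" for k
        by (simp add: power_mult u2 power_divide power_one_over)
           (simp add: power_mult_distrib power_divide flip: power_mult)
      have vpow: "1 / v ^ (2 * k) = c ^ (2 * k) * e n ^ k * (1 / (1 - c) ^ (2 * k))" for k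
        unfolding v_def power_mult_distrib upow[symmetric] by simp
      have sums: "barnes_coeff k * c ^ (2 * k) * (e n ^ k *
            ((1 / (1 + - X) ^ (2 * k) - 1) - 1 / (1 - c) ^ (2 * k) * (1 / (1 + - Y) ^ (2 * k) - 1))) =
          barnes_coeff k / u ^ (2 * k) * (1 / (1 + - X) ^ (2 * k) - 1) -
          barnes_coeff k / v ^ (2 * k) * (1 / (1 + - Y) ^ (2 * k) - 1)" for k
      proof -
        have "barnes_coeff k / u ^ (2 * k) = barnes_coeff k * (1 / u ^ (2 * k))"
          "barnes_coeff k / v ^ (2 * k) = barnes_coeff k * (1 / v ^ (2 * k))" by simp_all
        moreover have "B * C * (E * ((s - 1) - D * (r - 1))) = B * (C * E) * (s - 1) - B * (C * E * D) * (r - 1)"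
          for B C E s D r :: real by (simp add: algebra_simps)
        ultimately show ?thesis by (simp only: upow vpow)
      qed
      have lnj: "ln (1 - c * real j / (real n)\<^sup>2) = ln (1 + (- (c * real j)) * e n)" for j
        by (simp add: e_def)
      \<comment> \<open>The logarithms of $n$ cancel here.\<close>
      have logs: "real b * ln u + (ln u / 2 - 3 / 4) * (- 2 * real b / c + (real b)\<^sup>2 * e n)
          - (ln v / 2 - 3 / 4) * (- 2 * real b * (1 - c) / c + (real b)\<^sup>2 * e n) =
        3 * real b / 2 + real b * (1 - c) / c * ln (1 - c) - (real b)\<^sup>2 * ln (1 - c) / 2 * e n"
        unfolding lnv using c by (simp add: field_simps power2_eq_square)
      have t: "u\<^sup>2 / 2 * B = 1 / (2 * c\<^sup>2) * (B / e n)" "v\<^sup>2 / 2 * B = (1 - c)\<^sup>2 / (2 * c\<^sup>2) * (B / e n)" for B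
        unfolding u2 v2 by simp_all
      have gen: "B + S + (T1 + A1 - L1 / 12 + S1 - (T2 + A2 - L2 / 12 + S2)) =
          T1 - T2 + C - D - 1 / 12 * (L1 - L2) + (S1 - S2) + S"
        if "B + A1 - A2 = C - D" for B S T1 A1 L1 S1 T2 A2 L2 S2 C D :: real
      proof -
        have "1 / 12 * (L1 - L2) = L1 / 12 - L2 / 12" by (simp add: diff_divide_distrib)
        thus ?thesis using that by linarith
      qed
      have "barnes_part K c n b = real b * ln u + (\<Sum>j=1..b. ln (1 + (- (c * real j)) * e n)) +
         ((barnes K (u * (1 + - X)) - barnes K u) - (barnes K (v * (1 + - Y)) - barnes K v))"
        unfolding barnes_part_def lnj args(2) unfolding args(1) unfolding args(4) unfolding args(3)
        by simp
      also have "\<dots> = R n"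
        unfolding R_def xy barnes_scaled[OF u XY(1)] barnes_scaled[OF v XY(2)] sums sum_subtractf u2x v2y
        unfolding t by (rule gen[OF logs])
      finally show ?case ..
    qed
  qed
  ultimately show ?thesis by (rule n_scale.series_cong)
qed

text \<open>The coefficient of $n^{-2q}$ involves the terms $k < q$ of the truncated sum only: the
term $k = q$ contributes $(1+\dots)^{-2q}-1$, which has no constant coefficient.\<close>

lemma barnes_part_fps_nth:
  assumes c: "0 < c" "c < 1" and q: "q \<le> K"
  shows "fps_nth (barnes_part_fps K c b) q = A_coeff b q c"
proof -
  define x where "x = - (c * real b)"
  define y where "y = - (c * real b / (1 - c))"
  have terms: "fps_nth (barnes_part_fps K c b) q =
     1 / (2 * c\<^sup>2) * (x ^ Suc q * fps_nth sq_ln_fps (Suc q))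
     - (1 - c)\<^sup>2 / (2 * c\<^sup>2) * (y ^ Suc q * fps_nth sq_ln_fps (Suc q))
     + (if q = 0 then 3 * real b / 2 + real b * (1 - c) / c * ln (1 - c) else 0)
     - (if q = 1 then (real b)\<^sup>2 * ln (1 - c) / 2 else 0)
     - 1 / 12 * (x ^ q * fps_nth ln_fps q - y ^ q * fps_nth ln_fps q)
     + (\<Sum>k=1..K. barnes_coeff k * c ^ (2 * k) * (if q \<le> k then 0 else
          x ^ (q - k) * fps_nth (inverse_power_fps (2 * k)) (q - k)
          - 1 / (1 - c) ^ (2 * k) * (y ^ (q - k) * fps_nth (inverse_power_fps (2 * k)) (q - k))))
     + (\<Sum>j=1..b. (- (c * real j)) ^ q * fps_nth ln_fps q)"
  proof -
    have "fps_nth (fps_X ^ k * ((Abs_fps (\<lambda>n. x ^ n * fps_nth (inverse_power_fps (2 * k)) n) - 1)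
             - fps_const (1 / (1 - c) ^ (2 * k)) * (Abs_fps (\<lambda>n. y ^ n * fps_nth (inverse_power_fps (2 * k)) n) - 1))) q =
       (if q \<le> k then 0 else
          x ^ (q - k) * fps_nth (inverse_power_fps (2 * k)) (q - k)
          - 1 / (1 - c) ^ (2 * k) * (y ^ (q - k) * fps_nth (inverse_power_fps (2 * k)) (q - k)))" for k
      by (auto simp: fps_X_power_mult_nth inverse_power_fps_def)
    thus ?thesis
      by (simp add: barnes_part_fps_def Let_def fps_sum_nth flip: x_def y_def)
  qed
  have bsum: "(\<Sum>k=1..K. barnes_coeff k * c ^ (2 * k) * (if q \<le> k then 0 else
          x ^ (q - k) * fps_nth (inverse_power_fps (2 * k)) (q - k)
          - 1 / (1 - c) ^ (2 * k) * (y ^ (q - k) * fps_nth (inverse_power_fps (2 * k)) (q - k)))) =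
     (\<Sum>j = 1..q - 1.
             bernoulli (2 * j + 2) * c ^ (2 * j) * pochhammer (real (2 * j)) (q - j)
               * (real b * c) ^ (q - j)
             / (4 * real j * (real j + 1) * fact (q - j))
             * (1 - 1 / (1 - c) ^ (j + q)))"
  proof (rule sum.mono_neutral_cong_right)
    fix k assume k: "k \<in> {1..q - 1}"
    hence kq: "k < q" by auto
    have s: "(- (1::real)) ^ (q - k) * (- 1) ^ (q - k) = 1" by (simp flip: power_mult_distrib)
    define z where "z = pochhammer (real (2 * k)) (q - k) / fact (q - k) * (real b * c) ^ (q - k)"
    have X: "x ^ (q - k) * fps_nth (inverse_power_fps (2 * k)) (q - k) = z"
      unfolding x_def power_minus[of "c * real b"] inverse_power_fps_def z_def
      using s by (simp add: mult_ac)
    have Y: "y ^ (q - k) * fps_nth (inverse_power_fps (2 * k)) (q - k) = z / (1 - c) ^ (q - k)"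
      unfolding y_def power_minus[of "c * real b / (1 - c)"] inverse_power_fps_def z_def power_divide
      using s by (simp add: mult_ac)
    have "1 / (1 - c) ^ (2 * k) * (z / (1 - c) ^ (q - k)) = z / (1 - c) ^ (k + q)"
    proof -
      have "2 * k + (q - k) = k + q" using kq by simp
      thus ?thesis by (simp flip: power_add)
    qed
    thus "barnes_coeff k * c ^ (2 * k) * (if q \<le> k then 0 else
          x ^ (q - k) * fps_nth (inverse_power_fps (2 * k)) (q - k)
          - 1 / (1 - c) ^ (2 * k) * (y ^ (q - k) * fps_nth (inverse_power_fps (2 * k)) (q - k))) =
        bernoulli (2 * k + 2) * c ^ (2 * k) * pochhammer (real (2 * k)) (q - k)
               * (real b * c) ^ (q - k)
             / (4 * real k * (real k + 1) * fact (q - k))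
             * (1 - 1 / (1 - c) ^ (k + q))"
    proof -
      assume *: "1 / (1 - c) ^ (2 * k) * (z / (1 - c) ^ (q - k)) = z / (1 - c) ^ (k + q)"
      have "z - z / (1 - c) ^ (k + q) = z * (1 - 1 / (1 - c) ^ (k + q))" by (simp add: algebra_simps)
      moreover have "barnes_coeff k * c ^ (2 * k) * z = bernoulli (2 * k + 2) * c ^ (2 * k) *
          pochhammer (real (2 * k)) (q - k) * (real b * c) ^ (q - k) / (4 * real k * (real k + 1) * fact (q - k))"
        by (simp add: barnes_coeff_def z_def mult_ac)
      ultimately show ?thesis using kq unfolding X Y * by (simp add: mult.assoc[symmetric])
    qed
  qed (use q in auto)
  have lsum: "(\<Sum>j=1..b. (- (c * real j)) ^ q * fps_nth ln_fps q) = - (c ^ q / real q * (\<Sum>j = 1..b. real j ^ q))"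
  proof -
    have "(- (c * real j)) ^ q * fps_nth ln_fps q = - (c ^ q / real q * real j ^ q)" for j
      unfolding power_minus[of "c * real j"] ln_fps_def
      by (simp add: power_mult_distrib flip: power_mult_distrib[of "-1" "-1"])
    thus ?thesis by (simp add: sum_distrib_left sum_negf)
  qed
  consider "q = 0" | "q = 1" | "q \<ge> 2" by linarith
  thus ?thesis
  proof cases
    case 1
    show ?thesis unfolding terms bsum lsum using c 1
      by (simp add: A_coeff_def sq_ln_fps_nth ln_fps_def x_def y_def)
         (simp add: field_simps power2_eq_square)
  next
    case 2
    have H: "(\<Sum>j = 1..b. real j) = real b * (real b + 1) / 2"
      by (induction b) (simp_all add: field_simps)
    have c1: "1 - c \<noteq> 0" "c - 1 \<noteq> 0" using c by auto
    have y2: "(1 - c)\<^sup>2 * y\<^sup>2 = x\<^sup>2" using c by (simp add: x_def y_def power_divide)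
    show ?thesis unfolding terms bsum lsum using c 2 y2 c1
      apply (simp add: A_coeff_def sq_ln_fps_nth ln_fps_def H[unfolded One_nat_def] flip: power2_eq_square)
      apply (simp add: x_def y_def)
      apply (simp add: divide_simps)
      apply (simp add: algebra_simps power2_eq_square)
      done
  next
    case 3
    define P where "P = (c * real b) ^ q"
    have sg: "(- (1::real)) ^ q * (- 1) ^ q = 1" by (simp flip: power_mult_distrib)
    have X: "x ^ q * fps_nth ln_fps q = - (P / real q)"
      unfolding x_def power_minus[of "c * real b"] ln_fps_def P_def using sg by (simp add: mult_ac)
    have Y: "y ^ q * fps_nth ln_fps q = - (P / (1 - c) ^ q / real q)"
      unfolding y_def power_minus[of "c * real b / (1 - c)"] ln_fps_def P_def power_divide
      using sg by (simp add: mult_ac)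
    define r where "r = real q"
    have r: "r > 1" using 3 by (simp add: r_def)
    have sq: "fps_nth sq_ln_fps (Suc q) = 2 * (- 1) ^ q / ((r + 1) * r * (r - 1))"
      using 3 by (simp add: sq_ln_fps_nth r_def add.commute)
    have X': "x ^ Suc q * fps_nth sq_ln_fps (Suc q) = - (2 * (c * real b) * P / ((r + 1) * r * (r - 1)))"
      unfolding sq x_def power_minus[of "c * real b"] P_def using sg by (simp add: mult_ac)
    have Y': "y ^ Suc q * fps_nth sq_ln_fps (Suc q) =
        - (2 * (c * real b / (1 - c)) * (P / (1 - c) ^ q) / ((r + 1) * r * (r - 1)))"
      unfolding sq y_def power_minus[of "c * real b / (1 - c)"] P_def power_divide using sg by (simp add: mult_ac)
    \<comment> \<open>The contributions of the arguments near $n/c$ and near $n/c-n$ separately.\<close>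
    have i1: "1 / (2 * c\<^sup>2) * - (2 * (c * real b) * P / ((r + 1) * r * (r - 1))) + P / (12 * r) =
      P * (- 12 * real b + c * (r\<^sup>2 - 1)) / (12 * c * r * (r\<^sup>2 - 1))"
    proof -
      have qq: "r\<^sup>2 - 1 = (r + 1) * (r - 1)" by (simp add: power2_eq_square algebra_simps)
      show ?thesis using r c unfolding qq by (simp add: divide_simps power2_eq_square) (simp add: algebra_simps)
    qed
    have i2: "(1 - c)\<^sup>2 / (2 * c\<^sup>2) * - (2 * (c * real b / (1 - c)) * Q / ((r + 1) * r * (r - 1))) + Q / (12 * r) =
      - (Q * (c + 12 * real b - 12 * c * real b - c * r\<^sup>2) / (12 * c * r * (r\<^sup>2 - 1)))" for Q
    proof -
      have qq: "r\<^sup>2 - 1 = (r + 1) * (r - 1)" by (simp add: power2_eq_square algebra_simps)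
      have qq': "c + 12 * real b - 12 * c * real b - c * r\<^sup>2 = 12 * real b * (1 - c) - c * ((r + 1) * (r - 1))"
        by (simp add: power2_eq_square algebra_simps)
      show ?thesis using r c unfolding qq' unfolding qq
        by (simp add: divide_simps power2_eq_square) (simp add: algebra_simps)
    qed
    have A: "A_coeff b q c =
        P / (1 - c) ^ q * (c + 12 * real b - 12 * c * real b - c * r\<^sup>2) / (12 * c * r * (r\<^sup>2 - 1))
        + P * (- 12 * real b + c * (r\<^sup>2 - 1)) / (12 * c * r * (r\<^sup>2 - 1))
        - c ^ q / real q * (\<Sum>j = 1..b. real j ^ q)
        + (\<Sum>j = 1..q - 1.
             bernoulli (2 * j + 2) * c ^ (2 * j) * pochhammer (real (2 * j)) (q - j)
               * (real b * c) ^ (q - j)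
             / (4 * real j * (real j + 1) * fact (q - j))
             * (1 - 1 / (1 - c) ^ (j + q)))"
      using 3 by (simp add: A_coeff_def P_def r_def mult_ac)
    have i0: "(if q = 0 then u else 0) = 0" "(if q = 1 then u else 0) = 0" for u :: real
      using 3 by simp_all
    have e: "s / (12 * r) = s / r / 12" for s by simp
    have gen: "a - b' + 0 - 0 - 1 / 12 * (- s - - t) + B + - H = Z + (a + s / 12) - H + B"
      if "b' + t / 12 = - Z" for a b' s t B H Z :: real
    proof -
      have "1 / 12 * (- s - - t) = t / 12 - s / 12" by (simp add: diff_divide_distrib)
      thus ?thesis using that by linarith
    qed
    show ?thesis unfolding terms bsum lsum X Y X' Y' A i1[symmetric] i0 r_def[symmetric]
      unfolding e by (rule gen[OF i2[unfolded e]])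
  qed
qed

theorem log_moment_series:
  assumes c: "0 < c" "c < 1"
  shows "asymp_series sequentially (\<lambda>n. 1 / (real n)\<^sup>2) (\<lambda>n. log_moment c n b) (Abs_fps (\<lambda>q. A_coeff b q c))"
proof (rule n_scale.series_approx)
  fix N
  show "\<exists>g G. asymp_series sequentially (\<lambda>n. 1 / (real n)\<^sup>2) g G \<and>
     (\<lambda>n. log_moment c n b - g n) \<in> O(\<lambda>n. (1 / (real n)\<^sup>2) ^ N) \<and>
     (\<forall>k<N. fps_nth G k = fps_nth (Abs_fps (\<lambda>q. A_coeff b q c)) k)"
    using barnes_part_series[OF c, of "Suc N" b] log_moment_barnes[OF c, of b N]
      barnes_part_fps_nth[OF c, of _ "Suc N" b]
    by (intro exI[of _ "\<lambda>n. barnes_part (Suc N) c n b"] exI[of _ "barnes_part_fps (Suc N) c b"]) simp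
qed

section \<open>Exponentiating an asymptotic series\<close>

text \<open>The integer partitions of \<open>j\<close> into parts at most \<open>R\<close>, given by the multiplicities of
the parts.\<close>

definition partition_multiplicities :: "nat \<Rightarrow> nat \<Rightarrow> (nat \<Rightarrow> nat) set" where
  "partition_multiplicities R j = {i \<in> {1..R} \<rightarrow>\<^sub>E UNIV. (\<Sum>r = 1..R. r * i r) = j}"

definition partition_sum :: "(nat \<Rightarrow> real) \<Rightarrow> nat \<Rightarrow> nat \<Rightarrow> real" where
  "partition_sum a R j = (\<Sum>i\<in>partition_multiplicities R j. \<Prod>r = 1..R. a r ^ i r / fact (i r))"

lemma partition_multiplicity_bound:
  assumes "i \<in> partition_multiplicities R j" "r \<in> {1..R}" shows "r * i r \<le> j"
  using assms member_le_sum[of r "{1..R}" "\<lambda>r. r * i r"] by (auto simp: partition_multiplicities_def)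

lemma finite_partition_multiplicities: "finite (partition_multiplicities R j)"
proof (rule finite_subset)
  show "partition_multiplicities R j \<subseteq> {1..R} \<rightarrow>\<^sub>E {..j}"
  proof
    fix i assume i: "i \<in> partition_multiplicities R j"
    have "i r \<le> j" if "r \<in> {1..R}" for r
    proof -
      have "i r \<le> r * i r" using that by (cases r) auto
      also have "r * i r \<le> j" by (rule partition_multiplicity_bound[OF i that])
      finally show ?thesis .
    qed
    thus "i \<in> {1..R} \<rightarrow>\<^sub>E {..j}" using i by (auto simp: partition_multiplicities_def PiE_iff)
  qed
  show "finite ({1..R} \<rightarrow>\<^sub>E {..j} :: (nat \<Rightarrow> nat) set)" by (intro finite_PiE) auto
qed

text \<open>Parts larger than \<open>j\<close> have multiplicity $0$.\<close>

lemma partition_sum_stable: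
  assumes "j \<le> R" shows "partition_sum a R j = partition_sum a j j"
  unfolding partition_sum_def
proof (rule sum.reindex_bij_witness[of _
    "\<lambda>i. \<lambda>r\<in>{1..R}. if r \<le> j then i r else 0" "\<lambda>i. restrict i {1..j}"])
  have split: "{1..R} = {1..j} \<union> {Suc j..R}" "{1..j} \<inter> {Suc j..R} = {}" using assms by auto
  fix i assume i: "i \<in> partition_multiplicities R j"
  have z: "i r = 0" if "r \<in> {Suc j..R}" for r
  proof (rule ccontr)
    assume "i r \<noteq> 0"
    hence "r \<le> r * i r" by (cases "i r") auto
    also have "r * i r \<le> j" by (rule partition_multiplicity_bound[OF i]) (use that in auto)
    finally show False using that by simp
  qed
  show "(\<lambda>r\<in>{1..R}. if r \<le> j then restrict i {1..j} r else 0) = i"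
    using i z by (auto simp: partition_multiplicities_def fun_eq_iff PiE_iff extensional_def restrict_def)
  have "(\<Sum>r = 1..R. r * i r) = (\<Sum>r = 1..j. r * i r)"
    unfolding split(1) using z by (subst sum.union_disjoint) auto
  thus "restrict i {1..j} \<in> partition_multiplicities j j"
    using i by (auto simp: partition_multiplicities_def)
  show "(\<Prod>r = 1..j. a r ^ restrict i {1..j} r / fact (restrict i {1..j} r)) = (\<Prod>r = 1..R. a r ^ i r / fact (i r))"
    unfolding split(1) using z by (subst prod.union_disjoint) auto
next
  have split: "{1..R} = {1..j} \<union> {Suc j..R}" using assms by auto
  fix i assume i: "i \<in> partition_multiplicities j j"
  show "restrict (\<lambda>r\<in>{1..R}. if r \<le> j then i r else 0) {1..j} = i"
    using i assms by (auto simp: partition_multiplicities_def fun_eq_iff PiE_iff extensional_def restrict_def)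
  have "(\<Sum>r = 1..R. r * (\<lambda>r\<in>{1..R}. if r \<le> j then i r else 0) r) = (\<Sum>r = 1..j. r * i r)"
    by (rule sum.mono_neutral_cong_right) (use assms in auto)
  thus "(\<lambda>r\<in>{1..R}. if r \<le> j then i r else 0) \<in> partition_multiplicities R j"
    using i by (auto simp: partition_multiplicities_def)
qed

text \<open>Write $j = \sum_r r\, i_r$ in front of each summand and lower the multiplicity of the part $r$
by one. This is the recurrence that $E' = A'E$ gives for the coefficients of $E = \exp A$.\<close>

lemma partition_sum_recurrence:
  "real j * partition_sum a R j =
     (\<Sum>r\<in>{1..R}. if r \<le> j then real r * a r * partition_sum a R (j - r) else 0)"
proof -
  define w where "w = (\<lambda>i :: nat \<Rightarrow> nat. \<Prod>r = 1..R. a r ^ i r / fact (i r))"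
  note fin = finite_partition_multiplicities
  have "real j * partition_sum a R j = (\<Sum>i\<in>partition_multiplicities R j. real j * w i)"
    by (simp add: partition_sum_def w_def sum_distrib_left)
  also have "\<dots> = (\<Sum>i\<in>partition_multiplicities R j. \<Sum>r = 1..R. real r * (real (i r) * w i))"
  proof (rule sum.cong)
    fix i assume "i \<in> partition_multiplicities R j"
    hence "real j = (\<Sum>r = 1..R. real r * real (i r))"
      by (auto simp: partition_multiplicities_def)
    thus "real j * w i = (\<Sum>r = 1..R. real r * (real (i r) * w i))"
      by (simp add: sum_distrib_right mult.assoc)
  qed simp
  also have "\<dots> = (\<Sum>r = 1..R. \<Sum>i\<in>partition_multiplicities R j. real r * (real (i r) * w i))"
    by (rule sum.swap)
  also have "\<dots> = (\<Sum>r = 1..R. if r \<le> j then real r * a r * partition_sum a R (j - r) else 0)"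
  proof (rule sum.cong)
    fix r assume r: "r \<in> {1..R}"
    have "(\<Sum>i\<in>partition_multiplicities R j. real (i r) * w i) =
          (\<Sum>i | i \<in> partition_multiplicities R j \<and> i r \<ge> 1. real (i r) * w i)"
      by (rule sum.mono_neutral_right) (use fin in auto)
    also have "\<dots> = (if r \<le> j then a r * partition_sum a R (j - r) else 0)"
    proof (cases "r \<le> j")
      case False
      have empty: "{i. i \<in> partition_multiplicities R j \<and> i r \<ge> 1} = {}"
      proof -
        have "r \<le> j" if "i \<in> partition_multiplicities R j" "i r \<ge> 1" for i
        proof -
          have "r \<le> r * i r" using that(2) by (cases "i r") auto
          also have "r * i r \<le> j" by (rule partition_multiplicity_bound[OF that(1) r])
          finally show ?thesis .
        qed
        thus ?thesis using False by auto
      qed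
      show ?thesis unfolding empty using False by simp
    next
      case True
      have sum_upd: "(\<Sum>s = 1..R. s * (i(r := v)) s) + r * i r = (\<Sum>s = 1..R. s * i s) + r * v" for i v
      proof -
        have "(\<Sum>s\<in>{1..R} - {r}. s * (i(r := v)) s) = (\<Sum>s\<in>{1..R} - {r}. s * i s)"
          by (intro sum.cong) auto
        thus ?thesis using r by (simp add: sum.remove[of _ r])
      qed
      have w_upd: "real (Suc v) * w (i(r := Suc v)) = a r * w (i(r := v))" for i v
      proof -
        have "(\<Prod>s\<in>{1..R} - {r}. a s ^ (i(r := x)) s / fact ((i(r := x)) s)) =
              (\<Prod>s\<in>{1..R} - {r}. a s ^ i s / fact (i s))" for x
          by (intro prod.cong) auto
        hence w: "w (i(r := x)) = a r ^ x / fact x * (\<Prod>s\<in>{1..R} - {r}. a s ^ i s / fact (i s))" for x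
          using r by (simp add: w_def prod.remove[of _ r])
        have h: "real (Suc v) * (a r ^ Suc v / fact (Suc v)) = a r * (a r ^ v / fact v)"
          by (simp add: field_simps del: of_nat_Suc)
        show ?thesis unfolding w by (simp only: mult.assoc[symmetric] h)
      qed
      have "(\<Sum>i | i \<in> partition_multiplicities R j \<and> i r \<ge> 1. real (i r) * w i) =
            (\<Sum>i\<in>partition_multiplicities R (j - r). a r * w i)"
      proof (rule sum.reindex_bij_witness[of _ "\<lambda>i. i(r := Suc (i r))" "\<lambda>i. i(r := i r - 1)"])
        fix i assume i: "i \<in> {i. i \<in> partition_multiplicities R j \<and> i r \<ge> 1}"
        then obtain v where v: "i r = Suc v" by (cases "i r") auto
        show "(i(r := i r - 1))(r := Suc ((i(r := i r - 1)) r)) = i" by (simp add: v fun_eq_iff)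
        show "i(r := i r - 1) \<in> partition_multiplicities R (j - r)"
          using i r sum_upd[of i v] v by (auto simp: partition_multiplicities_def PiE_iff extensional_def)
        show "a r * w (i(r := i r - 1)) = real (i r) * w i"
          using w_upd[of v i] fun_upd_triv[of i r] by (simp add: v del: of_nat_Suc)
      next
        fix i assume i: "i \<in> partition_multiplicities R (j - r)"
        show "(i(r := Suc (i r)))(r := (i(r := Suc (i r))) r - 1) = i" by simp
        show "i(r := Suc (i r)) \<in> {i. i \<in> partition_multiplicities R j \<and> i r \<ge> 1}"
          using i r sum_upd[of i "Suc (i r)"] True by (auto simp: partition_multiplicities_def PiE_iff extensional_def)
      qed
      thus ?thesis using True by (simp add: partition_sum_def w_def sum_distrib_left)
    qed
    finally show "(\<Sum>i\<in>partition_multiplicities R j. real r * (real (i r) * w i)) =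
      (if r \<le> j then real r * a r * partition_sum a R (j - r) else 0)"
      by (simp flip: sum_distrib_left)
  qed simp
  finally show ?thesis .
qed

text \<open>The coefficients of $E = \exp A$ satisfy the recurrence of the partition sums, because
$E' = A'E$.\<close>

lemma exp_compose_nth:
  assumes "fps_nth A 0 = 0"
  shows "fps_nth (fps_exp 1 oo A) j = partition_sum (fps_nth A) j j"
proof (induction j rule: less_induct)
  case (less j)
  show ?case
  proof (cases j)
    case 0
    have "partition_multiplicities 0 0 = {\<lambda>_. undefined}"
      by (auto simp: partition_multiplicities_def)
    thus ?thesis using 0 by (simp add: partition_sum_def)
  next
    case (Suc n)
    define E where "E = fps_exp 1 oo A"
    have "fps_deriv E = E * fps_deriv A"
      unfolding E_def by (subst fps_compose_deriv[OF assms]) simp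
    hence "fps_nth (fps_deriv E) n = (\<Sum>i=0..n. fps_nth E i * fps_nth (fps_deriv A) (n - i))"
      by (simp only: fps_mult_nth)
    hence "real j * fps_nth E j = (\<Sum>i=0..n. fps_nth E i * (real (n - i + 1) * fps_nth A (n - i + 1)))"
      by (simp add: Suc)
    also have "\<dots> = (\<Sum>r=1..j. real r * fps_nth A r * fps_nth E (j - r))"
      by (rule sum.reindex_bij_witness[of _ "\<lambda>r. j - r" "\<lambda>i. j - i"]) (auto simp: Suc Suc_diff_le)
    also have "\<dots> = (\<Sum>r=1..j. real r * fps_nth A r * partition_sum (fps_nth A) j (j - r))"
    proof (rule sum.cong)
      fix r assume r: "r \<in> {1..j}"
      have "fps_nth E (j - r) = partition_sum (fps_nth A) (j - r) (j - r)"
        unfolding E_def by (rule less.IH) (use r in auto)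
      thus "real r * fps_nth A r * fps_nth E (j - r) = real r * fps_nth A r * partition_sum (fps_nth A) j (j - r)"
        by (simp add: partition_sum_stable[of "j - r" j])
    qed simp
    also have "\<dots> = real j * partition_sum (fps_nth A) j j"
      unfolding partition_sum_recurrence by (intro sum.cong) auto
    finally show ?thesis using Suc by (simp add: E_def)
  qed
qed

lemma exp_asymp_series: "asymp_series (nhds 0) (\<lambda>x. x) exp (fps_exp 1)"
proof (rule asymp_series_nhds_0, rule always_eventually, rule allI)
  fix x :: real
  show "(\<lambda>n. fps_nth (fps_exp 1) n * x ^ n) sums exp x"
    using exp_converges[of x] by (simp add: scaleR_conv_of_real field_simps)
qed

text \<open>The constant coefficient of $\ln\mu_b$ is split off as the factor $e^{A_0}$, because only a
series without constant term can be substituted into the exponential series.\<close>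

lemma moment_series:
  assumes c: "0 < c" "c < 1"
  shows "asymp_series sequentially (\<lambda>n. 1 / (real n)\<^sup>2) (\<lambda>n. exp (log_moment c n b))
           (Abs_fps (\<lambda>j. beta_coeff b j c))"
proof -
  define A where "A = Abs_fps (\<lambda>q. A_coeff b q c)"
  define A' where "A' = A - fps_const (A_coeff b 0 c)"
  have "asymp_series sequentially (\<lambda>n. 1 / (real n)\<^sup>2) (\<lambda>n. log_moment c n b - A_coeff b 0 c) A'"
    unfolding A_def A'_def by (intro n_scale.series_diff n_scale.series_const log_moment_series c)
  from n_scale.series_compose[OF exp_asymp_series this]
  have "asymp_series sequentially (\<lambda>n. 1 / (real n)\<^sup>2) (\<lambda>n. exp (log_moment c n b - A_coeff b 0 c)) (fps_exp 1 oo A')"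
    by (simp add: A'_def A_def)
  from n_scale.series_cmult[OF this, of "exp (A_coeff b 0 c)"]
  have "asymp_series sequentially (\<lambda>n. 1 / (real n)\<^sup>2) (\<lambda>n. exp (log_moment c n b))
     (fps_const (exp (A_coeff b 0 c)) * (fps_exp 1 oo A'))"
    by (simp flip: exp_add)
  also have "fps_const (exp (A_coeff b 0 c)) * (fps_exp 1 oo A') = Abs_fps (\<lambda>j. beta_coeff b j c)"
  proof (rule fps_ext)
    fix j
    have A'0: "fps_nth A' 0 = 0" by (simp add: A'_def A_def)
    have "partition_sum (fps_nth A') j j = partition_sum (\<lambda>r. A_coeff b r c) j j"
      unfolding partition_sum_def by (intro sum.cong prod.cong) (auto simp: A'_def A_def)
    thus "fps_nth (fps_const (exp (A_coeff b 0 c)) * (fps_exp 1 oo A')) j = fps_nth (Abs_fps (\<lambda>j. beta_coeff b j c)) j"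
      using exp_compose_nth[OF A'0, of j] A'0
      by (cases "j = 0") (auto simp: beta_coeff_def partition_sum_def partition_multiplicities_def)
  qed
  finally show ?thesis .
qed

section \<open>Polynomial dependence of the coefficients on the order of the moment\<close>

text \<open>For functions on the natural numbers this says: polynomial of degree less than \<open>k\<close>.\<close>

definition fdiff_vanishes :: "nat \<Rightarrow> (nat \<Rightarrow> real) \<Rightarrow> bool" where
  "fdiff_vanishes k f \<longleftrightarrow> (fdiff ^^ k) f = (\<lambda>_. 0)"

lemma fdiff_vanishes_0 [simp]: "fdiff_vanishes 0 f \<longleftrightarrow> f = (\<lambda>_. 0)"
  by (simp add: fdiff_vanishes_def)

lemma fdiff_vanishes_Suc: "fdiff_vanishes (Suc k) f \<longleftrightarrow> fdiff_vanishes k (fdiff f)"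
  by (simp add: fdiff_vanishes_def funpow_swap1)

lemma fdiff_zero: "fdiff (\<lambda>_. 0) = (\<lambda>_. 0)" by (simp add: fdiff_def fun_eq_iff)

lemma fdiff_vanishes_mono: "fdiff_vanishes k f \<Longrightarrow> k \<le> l \<Longrightarrow> fdiff_vanishes l f"
proof (induction l)
  case (Suc l)
  show ?case
  proof (cases "k = Suc l")
    case False
    hence "(fdiff ^^ l) f = (\<lambda>_. 0)" using Suc by (simp add: fdiff_vanishes_def)
    thus ?thesis by (simp add: fdiff_vanishes_def fdiff_zero)
  qed (use Suc in simp)
qed simp

lemma fdiff_vanishes_add:
  "fdiff_vanishes k f \<Longrightarrow> fdiff_vanishes k g \<Longrightarrow> fdiff_vanishes k (\<lambda>b. f b + g b)"
proof (induction k arbitrary: f g)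
  case (Suc k)
  have "fdiff (\<lambda>b. f b + g b) = (\<lambda>b. fdiff f b + fdiff g b)" by (simp add: fdiff_def fun_eq_iff)
  thus ?case using Suc by (simp add: fdiff_vanishes_Suc)
qed (simp add: fun_eq_iff)

lemma fdiff_vanishes_shift: "fdiff_vanishes k f \<Longrightarrow> fdiff_vanishes k (\<lambda>b. f (Suc b))"
proof (induction k arbitrary: f)
  case (Suc k)
  have "fdiff (\<lambda>b. f (Suc b)) = (\<lambda>b. fdiff f (Suc b))" by (simp add: fdiff_def fun_eq_iff)
  thus ?case using Suc by (simp add: fdiff_vanishes_Suc)
qed (simp add: fun_eq_iff)

text \<open>The degrees of polynomials add, hence the $-1$. The proof uses the product rule
$\Delta(fg)(b) = \Delta f(b)\,g(b+1) + f(b)\,\Delta g(b)$.\<close>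

lemma fdiff_vanishes_mult:
  assumes "fdiff_vanishes k f" "fdiff_vanishes l g"
  shows "fdiff_vanishes (k + l - 1) (\<lambda>b. f b * g b)"
  using assms
proof (induction "k + l" arbitrary: k l f g rule: less_induct)
  case less
  show ?case
  proof (cases "k = 0 \<or> l = 0")
    case True
    hence "(\<lambda>b. f b * g b) = (\<lambda>_. 0)" using less.prems by auto
    thus ?thesis using fdiff_vanishes_mono[of 0 "\<lambda>_. 0" "k + l - 1"] by simp
  next
    case False
    then obtain k' l' where kl: "k = Suc k'" "l = Suc l'" by (meson not0_implies_Suc)
    have "fdiff_vanishes (k' + l - 1) (\<lambda>b. fdiff f b * g (Suc b))"
      by (rule less.hyps) (use less.prems kl in \<open>auto simp: fdiff_vanishes_Suc[of k'] intro: fdiff_vanishes_shift\<close>)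
    moreover have "fdiff_vanishes (k + l' - 1) (\<lambda>b. f b * fdiff g b)"
      by (rule less.hyps) (use less.prems kl in \<open>auto simp: fdiff_vanishes_Suc[of l']\<close>)
    moreover have "k' + l - 1 = k' + l'" "k + l' - 1 = k' + l'" "k + l - 1 = Suc (k' + l')" using kl by auto
    moreover have "fdiff (\<lambda>b. f b * g b) = (\<lambda>b. fdiff f b * g (Suc b) + f b * fdiff g b)"
      by (simp add: fdiff_def fun_eq_iff algebra_simps)
    ultimately show ?thesis using fdiff_vanishes_add by (simp add: fdiff_vanishes_Suc)
  qed
qed

lemma fdiff_vanishes_const: "fdiff_vanishes (Suc 0) (\<lambda>_. a)"
  by (simp add: fdiff_vanishes_Suc fdiff_def fun_eq_iff)

lemma fdiff_vanishes_of_nat: "fdiff_vanishes 2 real"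
  by (simp add: fdiff_vanishes_def numeral_2_eq_2 fdiff_def fun_eq_iff)

lemma fdiff_vanishes_cmult: "fdiff_vanishes k f \<Longrightarrow> fdiff_vanishes k (\<lambda>b. a * f b)"
  using fdiff_vanishes_mult[OF fdiff_vanishes_const, of k f a] by simp

lemma fdiff_vanishes_divide: "fdiff_vanishes k f \<Longrightarrow> fdiff_vanishes k (\<lambda>b. f b / a)"
  using fdiff_vanishes_cmult[of k f "inverse a"] by (simp add: field_simps)

lemma fdiff_vanishes_sum:
  "(\<And>j. j \<in> J \<Longrightarrow> fdiff_vanishes k (f j)) \<Longrightarrow> fdiff_vanishes k (\<lambda>b. \<Sum>j\<in>J. f j b)"
proof (induction J rule: infinite_finite_induct)
  case (insert j J)
  thus ?case by (auto intro!: fdiff_vanishes_add)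
qed (use fdiff_vanishes_mono[of 0 "\<lambda>_. 0" k] in simp_all)

lemma fdiff_vanishes_power: "fdiff_vanishes (Suc n) (\<lambda>b. (a * real b) ^ n)"
proof (induction n)
  case (Suc n)
  from fdiff_vanishes_mult[OF fdiff_vanishes_cmult[OF fdiff_vanishes_of_nat, of a] Suc]
  show ?case by simp
qed (simp add: fdiff_vanishes_const)

lemma fdiff_vanishes_power_sum: "fdiff_vanishes (q + 2) (\<lambda>b. \<Sum>j = 1..b. real j ^ q)"
proof -
  have "fdiff (\<lambda>b. \<Sum>j = 1..b. real j ^ q) = (\<lambda>b. real (Suc b) ^ q)"
    by (simp add: fdiff_def fun_eq_iff)
  moreover have "fdiff_vanishes (Suc q) (\<lambda>b. real (Suc b) ^ q)"
    using fdiff_vanishes_shift[OF fdiff_vanishes_power[of q 1]] by simp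
  ultimately show ?thesis by (simp add: fdiff_vanishes_Suc)
qed

text \<open>The terms of highest degree in $p$ are, for $q > 1$, the power sum and the products of $p^q$
with a linear factor; their degree is $q+1$.\<close>

lemma A_coeff_polynomial: "fdiff_vanishes (q + 2) (\<lambda>b. A_coeff b q c)"
proof -
  consider "q = 0" | "q = 1" | "q \<ge> 2" by linarith
  thus ?thesis
  proof cases
    case 1
    have eq: "(\<lambda>b. A_coeff b q c) = (\<lambda>b. (1 - (1 - 1 / c) * ln (1 - c)) * real b)"
      using 1 by (simp add: A_coeff_def fun_eq_iff algebra_simps)
    have "fdiff_vanishes 2 (\<lambda>b. a * real b)" for a
      by (rule fdiff_vanishes_cmult[OF fdiff_vanishes_of_nat])
    thus ?thesis unfolding eq using 1 by (simp only: add_0)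
  next
    case 2
    have eq: "(\<lambda>b. A_coeff b q c) = (\<lambda>b. (- ln (1 - c) / 2 - c * 6 * (c - 1) / (12 * (c - 1))) * (1 * real b) ^ 2
       + c * (12 - 11 * c + 6 * (c - 1)) / (12 * (c - 1)) * real b)"
      using 2 by (simp add: A_coeff_def fun_eq_iff algebra_simps power2_eq_square add_divide_distrib diff_divide_distrib)
    have "fdiff_vanishes (q + 2) (\<lambda>b. a * (1 * real b) ^ 2 + d * real b)" for a d
      using 2 by (intro fdiff_vanishes_add fdiff_vanishes_cmult)
        (use fdiff_vanishes_power[of 2 1] fdiff_vanishes_mono[OF fdiff_vanishes_of_nat, of 3] in \<open>simp_all add: numeral_3_eq_3 numeral_2_eq_2\<close>)
    thus ?thesis unfolding eq .
  next
    case 3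
    have lin: "fdiff_vanishes (q + 2) (\<lambda>b. (c * real b) ^ q * (u + v * real b))" for u v
    proof -
      have "fdiff_vanishes 2 (\<lambda>b. u + v * real b)"
        by (intro fdiff_vanishes_add fdiff_vanishes_cmult fdiff_vanishes_of_nat
              fdiff_vanishes_mono[OF fdiff_vanishes_const]) simp
      from fdiff_vanishes_mult[OF fdiff_vanishes_power this, of q c] show ?thesis by simp
    qed
    have pow: "fdiff_vanishes (q + 2) (\<lambda>b. a * (c * real b) ^ (q - j))" for a j
      by (intro fdiff_vanishes_cmult fdiff_vanishes_mono[OF fdiff_vanishes_power]) simp
    have "(\<lambda>b. A_coeff b q c) = (\<lambda>b.
        (c * real b) ^ q * ((c - c * (real q)\<^sup>2) + (12 - 12 * c) * real b) / (12 * c * real q * ((real q)\<^sup>2 - 1) * (1 - c) ^ q)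
        + (c * real b) ^ q * (c * ((real q)\<^sup>2 - 1) + (- 12) * real b) / (12 * c * real q * ((real q)\<^sup>2 - 1))
        + (- (c ^ q / real q)) * (\<Sum>j = 1..b. real j ^ q)
        + (\<Sum>j = 1..q - 1.
             (bernoulli (2 * j + 2) * c ^ (2 * j) * pochhammer (real (2 * j)) (q - j)
             / (4 * real j * (real j + 1) * fact (q - j))
             * (1 - 1 / (1 - c) ^ (j + q))) * (c * real b) ^ (q - j)))" (is "?l = ?r")
    proof
      fix b :: nat
      have 1: "c + 12 * real b - 12 * c * real b - c * (real q)\<^sup>2 = (c - c * (real q)\<^sup>2) + (12 - 12 * c) * real b"
        by (simp add: algebra_simps)
      have 2: "- 12 * real b + c * ((real q)\<^sup>2 - 1) = c * ((real q)\<^sup>2 - 1) + (- 12) * real b" by simp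
      have 4: "bernoulli (2 * j + 2) * c ^ (2 * j) * pochhammer (real (2 * j)) (q - j) * (real b * c) ^ (q - j) 
         / (4 * real j * (real j + 1) * fact (q - j)) * (1 - 1 / (1 - c) ^ (j + q)) = 
       (bernoulli (2 * j + 2) * c ^ (2 * j) * pochhammer (real (2 * j)) (q - j)
                 / (4 * real j * (real j + 1) * fact (q - j))
                 * (1 - 1 / (1 - c) ^ (j + q))) * (c * real b) ^ (q - j)" for j
        by (simp add: mult_ac)
      show "?l b = ?r b" unfolding A_coeff_def 1 2 4 using 3 by simp
    qed
    moreover have "fdiff_vanishes (q + 2) (\<lambda>b.
        (c * real b) ^ q * ((c - c * (real q)\<^sup>2) + (12 - 12 * c) * real b) / (12 * c * real q * ((real q)\<^sup>2 - 1) * (1 - c) ^ q)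
        + (c * real b) ^ q * (c * ((real q)\<^sup>2 - 1) + (- 12) * real b) / (12 * c * real q * ((real q)\<^sup>2 - 1))
        + (- (c ^ q / real q)) * (\<Sum>j = 1..b. real j ^ q)
        + (\<Sum>j = 1..q - 1.
             (bernoulli (2 * j + 2) * c ^ (2 * j) * pochhammer (real (2 * j)) (q - j)
             / (4 * real j * (real j + 1) * fact (q - j))
             * (1 - 1 / (1 - c) ^ (j + q))) * (c * real b) ^ (q - j)))"
      by (rule fdiff_vanishes_add fdiff_vanishes_divide lin fdiff_vanishes_sum pow
            fdiff_vanishes_cmult[OF fdiff_vanishes_power_sum])+
    ultimately show ?thesis by simp
  qed
qed

section \<open>Expansion of the cumulants\<close>

lemma log_moment_0: "log_moment c n 0 = 0" by (simp add: log_moment_def)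

text \<open>Differences in $b$ act on the coefficients of the series, and the $k$th difference kills
the coefficients of index $q < k-1$.\<close>

lemma log_moment_fdiff_bigo:
  assumes c: "0 < c" "c < 1" and k: "k \<ge> 1"
  shows "(\<lambda>n. (fdiff ^^ k) (log_moment c n) 0) \<in> O(\<lambda>n. (1 / (real n)\<^sup>2) ^ (k - 1))"
proof -
  have "asymp_series sequentially (\<lambda>n. 1 / (real n)\<^sup>2) (\<lambda>n. (fdiff ^^ k) (log_moment c n) i)
     (Abs_fps (\<lambda>q. (fdiff ^^ k) (\<lambda>b. A_coeff b q c) i))" for k i
  proof (induction k arbitrary: i)
    case (Suc k)
    from n_scale.series_diff[OF Suc[of "Suc i"] Suc[of i]]
    have "asymp_series sequentially (\<lambda>n. 1 / (real n)\<^sup>2)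
      (\<lambda>n. (fdiff ^^ k) (log_moment c n) (Suc i) - (fdiff ^^ k) (log_moment c n) i)
      (Abs_fps (\<lambda>q. (fdiff ^^ k) (\<lambda>b. A_coeff b q c) (Suc i)) - Abs_fps (\<lambda>q. (fdiff ^^ k) (\<lambda>b. A_coeff b q c) i))" .
    moreover have "Abs_fps (\<lambda>q. (fdiff ^^ k) (\<lambda>b. A_coeff b q c) (Suc i)) - Abs_fps (\<lambda>q. (fdiff ^^ k) (\<lambda>b. A_coeff b q c) i) =
       Abs_fps (\<lambda>q. (fdiff ^^ Suc k) (\<lambda>b. A_coeff b q c) i)"
      by (simp add: fps_eq_iff fdiff_def[of "(fdiff ^^ k) _"])
    moreover have "(fdiff ^^ Suc k) f i = (fdiff ^^ k) f (Suc i) - (fdiff ^^ k) f i" for f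
      by (simp add: fdiff_def[of "(fdiff ^^ k) f"])
    ultimately show ?case by simp
  qed (use log_moment_series[OF c] in simp)
  from asymp_seriesD[OF this, of k 0 "k - 1"]
  have "(\<lambda>n. (fdiff ^^ k) (log_moment c n) 0 -
       (\<Sum>q<k - 1. (fdiff ^^ k) (\<lambda>b. A_coeff b q c) 0 * (1 / (real n)\<^sup>2) ^ q)) \<in> O(\<lambda>n. (1 / (real n)\<^sup>2) ^ (k - 1))"
    by simp
  also have "(\<lambda>n. (fdiff ^^ k) (log_moment c n) 0 -
       (\<Sum>q<k - 1. (fdiff ^^ k) (\<lambda>b. A_coeff b q c) 0 * (1 / (real n)\<^sup>2) ^ q)) =
     (\<lambda>n. (fdiff ^^ k) (log_moment c n) 0)"
  proof -
    have "(fdiff ^^ k) (\<lambda>b. A_coeff b q c) 0 = 0" if "q < k - 1" for q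
      using fdiff_vanishes_mono[OF A_coeff_polynomial, of q k] that by (simp add: fdiff_vanishes_def)
    thus ?thesis by simp
  qed
  finally show ?thesis .
qed

text \<open>The recursion for cumulants gives some series for the cumulant. Its coefficients below
order $p-1$ vanish because the cumulant is of that order, and the remaining ones satisfy the
recursion that defines \<open>alpha_coeff\<close>.\<close>

theorem cumulant_series:
  assumes c: "0 < c" "c < 1" and p: "p \<ge> 1"
  shows "asymp_series sequentially (\<lambda>n. 1 / (real n)\<^sup>2) (\<lambda>n. cumulant (\<lambda>b. exp (log_moment c n b)) p)
           (fps_X ^ (p - 1) * Abs_fps (\<lambda>j. alpha_coeff p j c))"
  using p
proof (induction p rule: less_induct)
  case (less p)
  define e where "e = (\<lambda>n. 1 / (real n)\<^sup>2)"
  define B where "B = (\<lambda>b. Abs_fps (\<lambda>j. beta_coeff b j c))"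
  define K where "K = (\<lambda>r. fps_X ^ (r - 1) * Abs_fps (\<lambda>j. alpha_coeff r j c))"
  define C where "C = B p - (\<Sum>r = 1..p - 1. fps_const (real ((p - 1) choose (r - 1))) * (K r * B (p - r)))"
  have Bs: "asymp_series sequentially (\<lambda>n. 1 / (real n)\<^sup>2) (\<lambda>n. exp (log_moment c n b)) (B b)" for b
    unfolding B_def by (rule moment_series[OF c])
  have "asymp_series sequentially e (\<lambda>n. exp (log_moment c n p) -
     (\<Sum>r = 1..p - 1. real ((p - 1) choose (r - 1)) * (cumulant (\<lambda>b. exp (log_moment c n b)) r * exp (log_moment c n (p - r))))) C"
    unfolding C_def e_def
  proof (intro n_scale.series_diff n_scale.series_sum n_scale.series_cmult n_scale.series_mult)
    fix r assume "r \<in> {1..p - 1}"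
    thus "asymp_series sequentially (\<lambda>n. 1 / (real n)\<^sup>2) (\<lambda>n. cumulant (\<lambda>b. exp (log_moment c n b)) r) (K r)"
      unfolding K_def by (intro less.IH) auto
  qed (rule Bs)+
  hence series: "asymp_series sequentially e (\<lambda>n. cumulant (\<lambda>b. exp (log_moment c n b)) p) C"
    by (subst cumulant.simps) (simp add: mult.assoc)
  have nz: "eventually (\<lambda>n. e n \<noteq> 0) sequentially"
    using eventually_gt_at_top[of 0] by eventually_elim (simp add: e_def)
  have "(\<lambda>n. cumulant (\<lambda>b. exp (log_moment c n b)) p) \<in> O(\<lambda>n. e n ^ (p - 1))"
    unfolding e_def
    by (rule n_scale.cumulant_bigo[OF log_moment_0
          log_moment_fdiff_bigo[OF c] less.prems])
  \<comment> \<open>The cancellation of the low orders.\<close>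
  hence small: "fps_nth C k = 0" if "k < p - 1" for k
    using n_scale.series_coeff_zero[of _ C "p - 1" k] series nz that unfolding e_def by simp
  have "C = K p"
  proof (rule fps_ext)
    fix k
    show "fps_nth C k = fps_nth (K p) k"
    proof (cases "k < p - 1")
      case True
      thus ?thesis using small by (simp add: K_def fps_X_power_mult_nth)
    next
      case False
      define j where "j = k - (p - 1)"
      have k: "k = p - 1 + j" using False by (simp add: j_def)
      have KB: "fps_nth (K r * B (p - r)) k = (\<Sum>l = 0..p - r + j. alpha_coeff r l c * beta_coeff (p - r) (p - r + j - l) c)"
        if r: "r \<in> {1..p - 1}" for r
      proof -
        have kr: "(k < r - 1) = False" "k - (r - 1) = p - r + j" using r k by auto
        have "K r * B (p - r) = fps_X ^ (r - 1) * (Abs_fps (\<lambda>j. alpha_coeff r j c) * B (p - r))"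
          by (simp add: K_def mult.assoc)
        hence "fps_nth (K r * B (p - r)) k = fps_nth (Abs_fps (\<lambda>j. alpha_coeff r j c) * B (p - r)) (p - r + j)"
          by (simp only: fps_X_power_mult_nth kr if_False)
        thus ?thesis by (simp add: B_def fps_mult_nth)
      qed
      have "fps_nth C k = beta_coeff p k c -
          (\<Sum>r = 1..p - 1. real ((p - 1) choose (r - 1)) * fps_nth (K r * B (p - r)) k)"
        by (simp add: C_def fps_sum_nth B_def)
      also have "\<dots> = alpha_coeff p j c"
      proof -
        have "(\<Sum>r = 1..p - 1. real ((p - 1) choose (r - 1)) * fps_nth (K r * B (p - r)) k) =
          (\<Sum>r = 1..p - 1. real ((p - 1) choose (r - 1)) *
             (\<Sum>l = 0..p - r + j. alpha_coeff r l c * beta_coeff (p - r) (p - r + j - l) c))"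
          by (intro sum.cong refl) (simp only: KB)
        thus ?thesis by (subst alpha_coeff.simps) (simp only: k)
      qed
      finally show ?thesis using k by (simp add: K_def fps_X_power_mult_nth)
    qed
  qed
  thus ?case using series by (simp add: K_def e_def)
qed

corollary cumulant_expansion:
  assumes c: "0 < c" "c < 1" and p: "p \<ge> 1"
  shows "(\<lambda>n. cumulant (\<lambda>b. exp (log_moment c n b)) p
            - (\<Sum>j = 0..N. alpha_coeff p j c / real n ^ (2 * (p - 1 + j))))
         \<in> O(\<lambda>n. 1 / real n ^ (2 * (p + N)))"
proof -
  define f where "f = (\<lambda>k n. fps_nth (fps_X ^ (p - 1) * Abs_fps (\<lambda>j. alpha_coeff p j c)) k * (1 / (real n)\<^sup>2) ^ k)"
  have eq1: "(\<Sum>k<p + N. f k n) = (\<Sum>j = 0..N. alpha_coeff p j c / real n ^ (2 * (p - 1 + j)))" for n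
  proof -
    have "(\<Sum>k<p + N. f k n) = (\<Sum>k\<in>{p - 1..<p + N}. f k n)"
      by (rule sum.mono_neutral_right) (auto simp: f_def fps_X_power_mult_nth)
    also have "\<dots> = (\<Sum>j = 0..N. alpha_coeff p j c / real n ^ (2 * (p - 1 + j)))"
    proof (rule sum.reindex_bij_witness[of _ "\<lambda>j. p - 1 + j" "\<lambda>k. k - (p - 1)"])
      fix k assume k: "k \<in> {p - 1..<p + N}"
      hence "p - 1 + (k - (p - 1)) = k" by auto
      thus "alpha_coeff p (k - (p - 1)) c / real n ^ (2 * (p - 1 + (k - (p - 1)))) = f k n"
        using k unfolding f_def fps_X_power_mult_nth by (simp add: power_one_over power_mult)
    qed (use p in auto)
    finally show ?thesis .
  qed
  have eq2: "1 / real n ^ (2 * (p + N)) = (1 / (real n)\<^sup>2) ^ (p + N)" for n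
    by (simp only: power_one_over power_mult)
  have "(\<lambda>n. cumulant (\<lambda>b. exp (log_moment c n b)) p - (\<Sum>k<p + N. f k n)) \<in> O(\<lambda>n. (1 / (real n)\<^sup>2) ^ (p + N))"
    using asymp_seriesD[OF cumulant_series[OF c p], of "p + N"] unfolding f_def .
  thus ?thesis by (simp only: eq1 eq2)
qed

section \<open>Joint laws and characteristic functions\<close>

lemma finite_measure_scale_prob:
  assumes "finite_measure N" "measure N (space N) = m" "m > 0"
  shows "prob_space (density N (\<lambda>_. ennreal (1 / m)))"
proof
  interpret finite_measure N by fact
  have "emeasure (density N (\<lambda>_. ennreal (1 / m))) (space N) = ennreal (1 / m) * emeasure N (space N)"
    by (simp add: emeasure_density nn_integral_cmult)
  also have "\<dots> = 1"
    using assms by (simp add: emeasure_eq_measure flip: ennreal_mult)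
  finally show "emeasure (density N (\<lambda>_. ennreal (1 / m))) (space (density N (\<lambda>_. ennreal (1 / m)))) = 1"
    by simp
qed

text \<open>Levy's uniqueness theorem after normalisation; the total mass is the value at $0$.\<close>

lemma finite_measure_char_unique:
  fixes N1 N2 :: "real measure"
  assumes f: "finite_measure N1" "finite_measure N2"
    and s: "sets N1 = sets borel" "sets N2 = sets borel"
    and ch: "\<And>t. (CLINT x|N1. iexp (t * x)) = (CLINT x|N2. iexp (t * x))"
  shows "N1 = N2"
proof -
  interpret N1: finite_measure N1 by fact
  interpret N2: finite_measure N2 by fact
  have sp: "space N1 = UNIV" "space N2 = UNIV"
    using s by (auto dest: sets_eq_imp_space_eq)
  define m where "m = measure N1 UNIV"
  have m2: "measure N2 UNIV = m" using ch[of 0] by (simp add: sp m_def scaleR_conv_of_real)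
  show ?thesis
  proof (cases "m = 0")
    case True
    have z: "emeasure N1 UNIV = 0" "emeasure N2 UNIV = 0"
      using True m2 by (simp_all add: N1.emeasure_eq_measure N2.emeasure_eq_measure m_def)
    have "emeasure N1 A = 0" "emeasure N2 A = 0" for A
      using emeasure_space[of N1 A] emeasure_space[of N2 A] z sp by simp_all
    thus ?thesis by (intro measure_eqI) (simp_all add: s)
  next
    case False
    hence m: "m > 0" using measure_nonneg[of N1 UNIV] unfolding m_def by linarith
    define D where "D = (\<lambda>N :: real measure. density N (\<lambda>_. ennreal (1 / m)))"
    have prob: "prob_space (D N1)" "prob_space (D N2)"
      unfolding D_def using finite_measure_scale_prob[OF f(1) _ m] finite_measure_scale_prob[OF f(2) _ m] m2
      by (simp_all add: sp m_def)
    have "real_distribution (D N1)" "real_distribution (D N2)"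
      using prob by (auto simp: real_distribution_def real_distribution_axioms_def D_def s)
    moreover have "char (D N1) = char (D N2)"
    proof
      fix t
      have "iexp \<in> borel_measurable borel" by simp
      hence meas: "(\<lambda>x. iexp (t * x)) \<in> borel_measurable N1" "(\<lambda>x. iexp (t * x)) \<in> borel_measurable N2"
        using s by (auto simp: measurable_cong_sets[OF s(1) refl] measurable_cong_sets[OF s(2) refl])
      show "char (D N1) t = char (D N2) t"
        unfolding char_def D_def using meas m ch[of t] by (simp add: integral_density)
    qed
    ultimately have "D N1 = D N2" by (rule Levy_uniqueness)
    hence "density (D N1) (\<lambda>_. ennreal m) = density (D N2) (\<lambda>_. ennreal m)" by simp
    moreover have "density (D N) (\<lambda>_. ennreal m) = N" for N :: "real measure"
      using m unfolding D_def by (subst density_density_eq) (auto simp: density_1 simp flip: ennreal_mult)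
    ultimately show ?thesis by simp
  qed
qed

lemma integral_of_real_plus_i_of_real:
  assumes "integrable L f" "integrable L h"
  shows "(CLINT \<omega>|L. complex_of_real (f \<omega>) + \<i> * complex_of_real (h \<omega>)) =
    complex_of_real (integral\<^sup>L L f) + \<i> * complex_of_real (integral\<^sup>L L h)"
proof -
  have "(CLINT \<omega>|L. complex_of_real (f \<omega>) + \<i> * complex_of_real (h \<omega>)) =
    (CLINT \<omega>|L. complex_of_real (f \<omega>)) + (CLINT \<omega>|L. \<i> * complex_of_real (h \<omega>))"
    using assms by (intro Bochner_Integration.integral_add integrable_mult_right integrable_of_real)
  thus ?thesis by (simp add: integral_complex_of_real)
qed

text \<open>The one-dimensional uniqueness theorem suffices, by induction on the number of
coordinates. Reweighting by $1+\cos(S+\theta)$, where $S$ is a linear form in the other coordinates,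
keeps a measure positive, and the characteristic function of one coordinate under the new measure
is expressed by the joint one. This gives the integrals of $\cos(S+\theta)$ over events of the single
coordinate, hence the joint characteristic function of the others after restriction to such an
event, and the induction hypothesis applies to the restricted measures. Finite measures rather
than probability measures make the restriction unproblematic.\<close>

lemma finite_measure_joint_char_unique:
  fixes Y :: "'i \<Rightarrow> 'w \<Rightarrow> real" and Y' :: "'i \<Rightarrow> 'v \<Rightarrow> real"
  assumes "finite I" "finite_measure M" "finite_measure M'"
    and "\<And>i. i \<in> I \<Longrightarrow> Y i \<in> borel_measurable M" "\<And>i. i \<in> I \<Longrightarrow> Y' i \<in> borel_measurable M'"
    and "\<And>a. (CLINT \<omega>|M. iexp (\<Sum>i\<in>I. a i * Y i \<omega>)) = (CLINT \<omega>|M'. iexp (\<Sum>i\<in>I. a i * Y' i \<omega>))"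
    and "\<And>i. i \<in> I \<Longrightarrow> B i \<in> sets borel"
  shows "measure M {\<omega>\<in>space M. \<forall>i\<in>I. Y i \<omega> \<in> B i} = measure M' {\<omega>\<in>space M'. \<forall>i\<in>I. Y' i \<omega> \<in> B i}"
  using assms
proof (induction I arbitrary: M M' rule: finite_induct)
  case empty
  have "complex_of_real (measure M (space M)) = complex_of_real (measure M' (space M'))"
    using empty(5)[of undefined] by (simp add: scaleR_conv_of_real)
  thus ?case by simp
next
  case (insert i I)
  interpret M: finite_measure M by fact
  interpret M': finite_measure M' by fact
  have meas [measurable]: "Y i \<in> borel_measurable M" "Y' i \<in> borel_measurable M'"
    "\<And>j. j \<in> I \<Longrightarrow> Y j \<in> borel_measurable M" "\<And>j. j \<in> I \<Longrightarrow> Y' j \<in> borel_measurable M'"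
    using insert.prems by auto
  have Bi [measurable]: "B i \<in> sets borel" using insert.prems by auto
  define S where "S = (\<lambda>a \<omega>. \<Sum>j\<in>I. a j * Y j \<omega>)"
  define S' where "S' = (\<lambda>a \<omega>. \<Sum>j\<in>I. a j * Y' j \<omega>)"
  have S [measurable]: "\<And>a. S a \<in> borel_measurable M" "\<And>a. S' a \<in> borel_measurable M'"
    unfolding S_def S'_def by measurable
  have ch: "(CLINT \<omega>|M. iexp (t * Y i \<omega> + s * S a \<omega>)) = (CLINT \<omega>|M'. iexp (t * Y' i \<omega> + s * S' a \<omega>))" for t s a
  proof -
    have "(\<Sum>j\<in>insert i I. (if j = i then t else s * a j) * Z j) = t * Z i + s * (\<Sum>j\<in>I. a j * Z j)" for Z :: "'i \<Rightarrow> real"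
    proof -
      have "(\<Sum>j\<in>I. (if j = i then t else s * a j) * Z j) = (\<Sum>j\<in>I. s * (a j * Z j))"
        using insert.hyps by (intro sum.cong) auto
      thus ?thesis using insert.hyps by (simp add: sum_distrib_left)
    qed
    from this[of "\<lambda>j. Y j _"] this[of "\<lambda>j. Y' j _"] show ?thesis
      using insert.prems(5)[of "\<lambda>j. if j = i then t else s * a j"] by (simp add: S_def S'_def)
  qed
  have bounded: "integrable M (\<lambda>\<omega>. iexp (f \<omega>))" if "f \<in> borel_measurable M" for f
    by (rule M.integrable_const_bound[where B = 1]) (use that in auto)
  have bounded': "integrable M' (\<lambda>\<omega>. iexp (f \<omega>))" if "f \<in> borel_measurable M'" for f
    by (rule M'.integrable_const_bound[where B = 1]) (use that in auto)
  define N where "N = (\<lambda>a \<theta>. distr (density M (\<lambda>\<omega>. ennreal (1 + cos (S a \<omega> + \<theta>)))) borel (Y i))"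
  define N' where "N' = (\<lambda>a \<theta>. distr (density M' (\<lambda>\<omega>. ennreal (1 + cos (S' a \<omega> + \<theta>)))) borel (Y' i))"
  have nonneg: "0 \<le> 1 + cos x" for x :: real using cos_ge_minus_one[of x] by linarith
  have le2: "1 + cos x \<le> 2" for x :: real using cos_le_one[of x] by linarith
  \<comment> \<open>Euler: the reweighted exponential is a combination of exponentials of joint linear forms.\<close>
  have weight: "(1 + cos (s + \<theta>)) *\<^sub>R iexp u =
     iexp u + (iexp \<theta> / 2) * iexp (u + s) + (iexp (- \<theta>) / 2) * iexp (u - s)" for s \<theta> u
  proof -
    have "complex_of_real (cos (s + \<theta>)) = (iexp (s + \<theta>) + iexp (- (s + \<theta>))) / 2"
      by (simp add: cos_exp_eq algebra_simps flip: cos_of_real)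
    moreover have "(1 + cos (s + \<theta>)) *\<^sub>R iexp u = iexp u + complex_of_real (cos (s + \<theta>)) * iexp u"
      by (simp add: scaleR_conv_of_real algebra_simps)
    ultimately have "(1 + cos (s + \<theta>)) *\<^sub>R iexp u = iexp u + (iexp (s + \<theta>) + iexp (- (s + \<theta>))) / 2 * iexp u"
      by (simp only:)
    also have "\<dots> = iexp u + (iexp \<theta> / 2) * iexp (u + s) + (iexp (- \<theta>) / 2) * iexp (u - s)"
      by (simp add: exp_add exp_diff exp_minus field_simps flip: exp_add)
    finally show ?thesis .
  qed
  have NN: "N a \<theta> = N' a \<theta>" for a \<theta>
  proof (rule finite_measure_char_unique)
    have bd: "emeasure (density M (\<lambda>\<omega>. ennreal (1 + cos (S a \<omega> + \<theta>)))) (space M) \<noteq> \<top>"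
    proof -
      have "emeasure (density M (\<lambda>\<omega>. ennreal (1 + cos (S a \<omega> + \<theta>)))) (space M) = (\<integral>\<^sup>+ \<omega>. ennreal (1 + cos (S a \<omega> + \<theta>)) \<partial>M)"
        by (subst emeasure_density) (auto intro!: nn_integral_cong)
      also have "\<dots> \<le> (\<integral>\<^sup>+ \<omega>. ennreal 2 \<partial>M)"
        by (intro nn_integral_mono ennreal_leI le2)
      also have "\<dots> < \<top>"
        by (simp add: ennreal_mult_eq_top_iff flip: less_top)
      finally show ?thesis by simp
    qed
    have bd': "emeasure (density M' (\<lambda>\<omega>. ennreal (1 + cos (S' a \<omega> + \<theta>)))) (space M') \<noteq> \<top>"
    proof -
      have "emeasure (density M' (\<lambda>\<omega>. ennreal (1 + cos (S' a \<omega> + \<theta>)))) (space M') = (\<integral>\<^sup>+ \<omega>. ennreal (1 + cos (S' a \<omega> + \<theta>)) \<partial>M')"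
        by (subst emeasure_density) (auto intro!: nn_integral_cong)
      also have "\<dots> \<le> (\<integral>\<^sup>+ \<omega>. ennreal 2 \<partial>M')"
        by (intro nn_integral_mono ennreal_leI le2)
      also have "\<dots> < \<top>"
        by (simp add: ennreal_mult_eq_top_iff flip: less_top)
      finally show ?thesis by simp
    qed
    show "finite_measure (N a \<theta>)" unfolding N_def
      by (rule finite_measure.finite_measure_distr) (auto intro!: finite_measureI simp: bd)
    show "finite_measure (N' a \<theta>)" unfolding N'_def
      by (rule finite_measure.finite_measure_distr) (auto intro!: finite_measureI simp: bd')
    fix t
    have [measurable]: "iexp \<in> borel_measurable borel" by simp
    have "(CLINT x|N a \<theta>. iexp (t * x)) = (CLINT \<omega>|M. (1 + cos (S a \<omega> + \<theta>)) *\<^sub>R iexp (t * Y i \<omega>))"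
      unfolding N_def using nonneg by (subst integral_distr) (auto intro!: integral_density)
    also have "\<dots> = (CLINT \<omega>|M. iexp (t * Y i \<omega>) + (iexp \<theta> / 2) * iexp (t * Y i \<omega> + S a \<omega>) + (iexp (- \<theta>) / 2) * iexp (t * Y i \<omega> - S a \<omega>))"
      unfolding weight ..
    also have "\<dots> = (CLINT \<omega>|M. iexp (t * Y i \<omega>)) + (iexp \<theta> / 2) * (CLINT \<omega>|M. iexp (t * Y i \<omega> + S a \<omega>))
        + (iexp (- \<theta>) / 2) * (CLINT \<omega>|M. iexp (t * Y i \<omega> - S a \<omega>))"
      by (subst Bochner_Integration.integral_add Bochner_Integration.integral_mult_right_zero;
          (intro bounded integrable_mult_right Bochner_Integration.integrable_add)?; measurable?)+
    also have "\<dots> = (CLINT \<omega>|M'. iexp (t * Y' i \<omega>)) + (iexp \<theta> / 2) * (CLINT \<omega>|M'. iexp (t * Y' i \<omega> + S' a \<omega>))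
        + (iexp (- \<theta>) / 2) * (CLINT \<omega>|M'. iexp (t * Y' i \<omega> - S' a \<omega>))"
      using ch[of t 0 a] ch[of t 1 a] ch[of t "-1" a] by simp
    also have "\<dots> = (CLINT \<omega>|M'. iexp (t * Y' i \<omega>) + (iexp \<theta> / 2) * iexp (t * Y' i \<omega> + S' a \<omega>) + (iexp (- \<theta>) / 2) * iexp (t * Y' i \<omega> - S' a \<omega>))"
      by (subst Bochner_Integration.integral_add Bochner_Integration.integral_mult_right_zero;
          (intro bounded' integrable_mult_right Bochner_Integration.integrable_add)?; measurable?)+
    also have "\<dots> = (CLINT \<omega>|M'. (1 + cos (S' a \<omega> + \<theta>)) *\<^sub>R iexp (t * Y' i \<omega>))"
      unfolding weight ..
    also have "\<dots> = (CLINT x|N' a \<theta>. iexp (t * x))"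
      unfolding N'_def using nonneg by (subst integral_distr) (auto intro!: integral_density[symmetric])
    finally show "(CLINT x|N a \<theta>. iexp (t * x)) = (CLINT x|N' a \<theta>. iexp (t * x))" .
  qed (simp_all add: N_def N'_def)
  define g where "g = (\<lambda>a \<theta>. \<integral>\<omega>. (1 + cos (S a \<omega> + \<theta>)) * indicator (B i) (Y i \<omega>) \<partial>M)"
  define g' where "g' = (\<lambda>a \<theta>. \<integral>\<omega>. (1 + cos (S' a \<omega> + \<theta>)) * indicator (B i) (Y' i \<omega>) \<partial>M')"
  have gg: "g a \<theta> = g' a \<theta>" for a \<theta>
  proof -
    have "g a \<theta> = (\<integral>x. indicator (B i) x \<partial>N a \<theta>)"
      unfolding g_def N_def using nonneg
      by (subst integral_distr) (auto simp: integral_real_density)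
    also have "\<dots> = (\<integral>x. indicator (B i) x \<partial>N' a \<theta>)" by (simp only: NN)
    also have "\<dots> = g' a \<theta>"
      unfolding g'_def N'_def using nonneg
      by (subst integral_distr) (auto simp: integral_real_density)
    finally show ?thesis .
  qed
  define J where "J = (\<lambda>\<omega>. indicator (B i) (Y i \<omega>) :: real)"
  define J' where "J' = (\<lambda>\<omega>. indicator (B i) (Y' i \<omega>) :: real)"
  have [measurable]: "J \<in> borel_measurable M" "J' \<in> borel_measurable M'" by (auto simp: J_def J'_def)
  have Jint: "integrable M (\<lambda>\<omega>. J \<omega> * cos (S a \<omega> + \<theta>))" "integrable M J" for a \<theta>
    by (rule M.integrable_const_bound[where B = 1]; auto simp: J_def indicator_def)+
  have Jint': "integrable M' (\<lambda>\<omega>. J' \<omega> * cos (S' a \<omega> + \<theta>))" "integrable M' J'" for a \<theta>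
    by (rule M'.integrable_const_bound[where B = 1]; auto simp: J'_def indicator_def)+
  have g: "g a \<theta> = (\<integral>\<omega>. J \<omega> \<partial>M) + (\<integral>\<omega>. J \<omega> * cos (S a \<omega> + \<theta>) \<partial>M)" for a \<theta>
    unfolding g_def using Jint by (simp add: J_def algebra_simps flip: Bochner_Integration.integral_add)
  have g': "g' a \<theta> = (\<integral>\<omega>. J' \<omega> \<partial>M') + (\<integral>\<omega>. J' \<omega> * cos (S' a \<omega> + \<theta>) \<partial>M')" for a \<theta>
    unfolding g'_def using Jint' by (simp add: J'_def algebra_simps flip: Bochner_Integration.integral_add)
  have J0: "(\<integral>\<omega>. J \<omega> \<partial>M) = (\<integral>\<omega>. J' \<omega> \<partial>M')"
    using gg[of "\<lambda>_. 0" 0] unfolding g g' by (simp add: S_def S'_def)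
  have Jcos: "(\<integral>\<omega>. J \<omega> * cos (S a \<omega> + \<theta>) \<partial>M) = (\<integral>\<omega>. J' \<omega> * cos (S' a \<omega> + \<theta>) \<partial>M')" for a \<theta>
    using gg[of a \<theta>] J0 unfolding g g' by simp
  have shift: "cos (x + - (pi / 2)) = sin x" for x :: real by (simp add: cos_diff)
  have Jiexp: "(CLINT \<omega>|M. J \<omega> *\<^sub>R iexp (S a \<omega>)) = (CLINT \<omega>|M'. J' \<omega> *\<^sub>R iexp (S' a \<omega>))" for a
  proof -
    have e: "j *\<^sub>R iexp x = complex_of_real (j * cos (x + 0)) + \<i> * complex_of_real (j * cos (x + - (pi / 2)))" for j x :: real
      unfolding shift by (simp add: complex_eq_iff Re_exp Im_exp)
    show ?thesis unfolding e
      by (simp only: integral_of_real_plus_i_of_real[OF Jint(1) Jint(1)]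
            integral_of_real_plus_i_of_real[OF Jint'(1) Jint'(1)] Jcos)
  qed
  \<comment> \<open>The restrictions of the measures to an event of the coordinate \<open>i\<close>.\<close>
  define M1 where "M1 = density M (\<lambda>\<omega>. ennreal (J \<omega>))"
  define M1' where "M1' = density M' (\<lambda>\<omega>. ennreal (J' \<omega>))"
  have M1: "emeasure M1 A = emeasure M {\<omega>\<in>A. Y i \<omega> \<in> B i}" if A: "A \<in> sets M" for A
  proof -
    have "emeasure M1 A = (\<integral>\<^sup>+\<omega>. ennreal (J \<omega>) * indicator A \<omega> \<partial>M)"
      unfolding M1_def using A by (subst emeasure_density) auto
    also have "\<dots> = (\<integral>\<^sup>+\<omega>. indicator (A \<inter> {\<omega>\<in>space M. Y i \<omega> \<in> B i}) \<omega> \<partial>M)"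
      by (rule nn_integral_cong) (auto simp: J_def split: split_indicator)
    also have "\<dots> = emeasure M (A \<inter> {\<omega>\<in>space M. Y i \<omega> \<in> B i})"
      by (rule nn_integral_indicator) (use A in measurable)
    also have "A \<inter> {\<omega>\<in>space M. Y i \<omega> \<in> B i} = {\<omega>\<in>A. Y i \<omega> \<in> B i}"
      using sets.sets_into_space[OF A] by auto
    finally show ?thesis .
  qed
  have M1': "emeasure M1' A = emeasure M' {\<omega>\<in>A. Y' i \<omega> \<in> B i}" if A: "A \<in> sets M'" for A
  proof -
    have "emeasure M1' A = (\<integral>\<^sup>+\<omega>. ennreal (J' \<omega>) * indicator A \<omega> \<partial>M')"
      unfolding M1'_def using A by (subst emeasure_density) auto
    also have "\<dots> = (\<integral>\<^sup>+\<omega>. indicator (A \<inter> {\<omega>\<in>space M'. Y' i \<omega> \<in> B i}) \<omega> \<partial>M')"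
      by (rule nn_integral_cong) (auto simp: J'_def split: split_indicator)
    also have "\<dots> = emeasure M' (A \<inter> {\<omega>\<in>space M'. Y' i \<omega> \<in> B i})"
      by (rule nn_integral_indicator) (use A in measurable)
    also have "A \<inter> {\<omega>\<in>space M'. Y' i \<omega> \<in> B i} = {\<omega>\<in>A. Y' i \<omega> \<in> B i}"
      using sets.sets_into_space[OF A] by auto
    finally show ?thesis .
  qed
  have [simp]: "sets M1 = sets M" "space M1 = space M" "sets M1' = sets M'" "space M1' = space M'"
    by (simp_all add: M1_def M1'_def)
  have "measure M1 {\<omega>\<in>space M1. \<forall>j\<in>I. Y j \<omega> \<in> B j} = measure M1' {\<omega>\<in>space M1'. \<forall>j\<in>I. Y' j \<omega> \<in> B j}"
  proof (rule insert.IH)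
    show "finite_measure M1" by (rule finite_measureI) (simp add: M1 M.emeasure_finite)
    show "finite_measure M1'" by (rule finite_measureI) (simp add: M1' M'.emeasure_finite)
    show "Y j \<in> borel_measurable M1" if "j \<in> I" for j using meas(3)[OF that] by (simp add: M1_def)
    show "Y' j \<in> borel_measurable M1'" if "j \<in> I" for j using meas(4)[OF that] by (simp add: M1'_def)
    show "B j \<in> sets borel" if "j \<in> I" for j using insert.prems that by auto
    fix a
    have [measurable]: "iexp \<in> borel_measurable borel" by simp
    have "(CLINT \<omega>|M1. iexp (S a \<omega>)) = (CLINT \<omega>|M. J \<omega> *\<^sub>R iexp (S a \<omega>))"
      unfolding M1_def by (rule integral_density) (auto simp: J_def)
    also have "\<dots> = (CLINT \<omega>|M'. J' \<omega> *\<^sub>R iexp (S' a \<omega>))" by (rule Jiexp)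
    also have "\<dots> = (CLINT \<omega>|M1'. iexp (S' a \<omega>))"
      unfolding M1'_def by (rule integral_density[symmetric]) (auto simp: J'_def)
    finally show "(CLINT \<omega>|M1. iexp (\<Sum>j\<in>I. a j * Y j \<omega>)) = (CLINT \<omega>|M1'. iexp (\<Sum>j\<in>I. a j * Y' j \<omega>))"
      by (simp add: S_def S'_def)
  qed
  moreover have "{\<omega>\<in>space M. \<forall>j\<in>I. Y j \<omega> \<in> B j} \<in> sets M"
    using insert.hyps insert.prems by measurable
  moreover have "{\<omega>\<in>space M'. \<forall>j\<in>I. Y' j \<omega> \<in> B j} \<in> sets M'"
    using insert.hyps insert.prems by measurable
  moreover have "{\<omega> \<in> {\<omega>\<in>space M. \<forall>j\<in>I. Y j \<omega> \<in> B j}. Y i \<omega> \<in> B i} = {\<omega>\<in>space M. \<forall>j\<in>insert i I. Y j \<omega> \<in> B j}"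
    "{\<omega> \<in> {\<omega>\<in>space M'. \<forall>j\<in>I. Y' j \<omega> \<in> B j}. Y' i \<omega> \<in> B i} = {\<omega>\<in>space M'. \<forall>j\<in>insert i I. Y' j \<omega> \<in> B j}"
    by auto
  ultimately show ?case by (simp add: measure_def M1 M1')
qed

text \<open>Boxes generate the product $\sigma$-algebra and are stable under intersection, so that the
joint law is determined by its values on boxes.\<close>

lemma joint_law_eqI:
  fixes Y :: "'i \<Rightarrow> 'w \<Rightarrow> real" and Y' :: "'i \<Rightarrow> 'v \<Rightarrow> real"
  assumes I: "finite I" and M: "prob_space M" "prob_space M'"
    and meas: "\<And>i. i \<in> I \<Longrightarrow> Y i \<in> borel_measurable M" "\<And>i. i \<in> I \<Longrightarrow> Y' i \<in> borel_measurable M'"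
    and ch: "\<And>a. (CLINT \<omega>|M. iexp (\<Sum>i\<in>I. a i * Y i \<omega>)) = (CLINT \<omega>|M'. iexp (\<Sum>i\<in>I. a i * Y' i \<omega>))"
  shows "distr M (PiM I (\<lambda>_. borel)) (\<lambda>\<omega>. \<lambda>i\<in>I. Y i \<omega>) = distr M' (PiM I (\<lambda>_. borel)) (\<lambda>\<omega>. \<lambda>i\<in>I. Y' i \<omega>)"
proof (rule measure_eqI_PiM_finite[OF I])
  interpret M: prob_space M by fact
  interpret M': prob_space M' by fact
  have m [measurable]: "(\<lambda>\<omega>. \<lambda>i\<in>I. Y i \<omega>) \<in> measurable M (PiM I (\<lambda>_. borel))"
    "(\<lambda>\<omega>. \<lambda>i\<in>I. Y' i \<omega>) \<in> measurable M' (PiM I (\<lambda>_. borel))"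
    using meas by (auto intro!: measurable_restrict)
  show "range (\<lambda>_::nat. \<Pi>\<^sub>E i\<in>I. (UNIV :: real set)) \<subseteq> prod_algebra I (\<lambda>_. borel)"
    using I by (auto intro!: prod_algebraI_finite)
  show "(\<Union>_::nat. \<Pi>\<^sub>E i\<in>I. (UNIV :: real set)) = space (PiM I (\<lambda>_. borel))" by (simp add: space_PiM)
  show "emeasure (distr M (PiM I (\<lambda>_. borel)) (\<lambda>\<omega>. \<lambda>i\<in>I. Y i \<omega>)) (\<Pi>\<^sub>E i\<in>I. UNIV) \<noteq> \<infinity>"
  proof -
    interpret D: prob_space "distr M (PiM I (\<lambda>_. borel)) (\<lambda>\<omega>. \<lambda>i\<in>I. Y i \<omega>)" by (rule M.prob_space_distr) simp
    show ?thesis by (simp add: D.emeasure_eq_measure)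
  qed
  fix A :: "'i \<Rightarrow> real set" assume A: "\<And>i. i \<in> I \<Longrightarrow> A i \<in> sets borel"
  have "(\<lambda>\<omega>. \<lambda>i\<in>I. Y i \<omega>) -` Pi\<^sub>E I A \<inter> space M = {\<omega>\<in>space M. \<forall>i\<in>I. Y i \<omega> \<in> A i}"
    "(\<lambda>\<omega>. \<lambda>i\<in>I. Y' i \<omega>) -` Pi\<^sub>E I A \<inter> space M' = {\<omega>\<in>space M'. \<forall>i\<in>I. Y' i \<omega> \<in> A i}"
    by (auto simp: PiE_iff)
  moreover have "Pi\<^sub>E I A \<in> sets (PiM I (\<lambda>_. borel))" using A I by (intro sets_PiM_I_finite) auto
  moreover have "measure M {\<omega>\<in>space M. \<forall>i\<in>I. Y i \<omega> \<in> A i} = measure M' {\<omega>\<in>space M'. \<forall>i\<in>I. Y' i \<omega> \<in> A i}"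
    by (rule finite_measure_joint_char_unique[OF I]) (use meas ch A in \<open>auto intro: M.finite_measure_axioms M'.finite_measure_axioms\<close>)
  ultimately show "emeasure (distr M (PiM I (\<lambda>_. borel)) (\<lambda>\<omega>. \<lambda>i\<in>I. Y i \<omega>)) (Pi\<^sub>E I A) =
    emeasure (distr M' (PiM I (\<lambda>_. borel)) (\<lambda>\<omega>. \<lambda>i\<in>I. Y' i \<omega>)) (Pi\<^sub>E I A)"
    by (simp add: emeasure_distr M.emeasure_eq_measure M'.emeasure_eq_measure)
qed simp_all

section \<open>The standard complex Gaussian law\<close>

definition cgauss_part :: "real measure" where
  "cgauss_part = density lborel (normal_density 0 (sqrt (1 / 2)))"

text \<open>Variance \<open>1 / 2\<close> in the real and in the imaginary part, so that the squared modulus has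
mean $1$.\<close>

definition cgauss :: "complex measure" where
  "cgauss = distr (cgauss_part \<Otimes>\<^sub>M cgauss_part) borel (\<lambda>(x, y). Complex x y)"

lemma prob_space_cgauss_part: "prob_space cgauss_part"
  unfolding cgauss_part_def by (rule prob_space_normal_density) simp

lemma sets_cgauss_part [simp, measurable_cong]: "sets cgauss_part = sets borel"
  by (simp add: cgauss_part_def)

lemma measurable_Complex [measurable]: "(\<lambda>(x, y). Complex x y) \<in> borel_measurable (cgauss_part \<Otimes>\<^sub>M cgauss_part)"
proof -
  have "(\<lambda>(x, y). complex_of_real x + \<i> * complex_of_real y) \<in> borel_measurable (cgauss_part \<Otimes>\<^sub>M cgauss_part)"
    by measurable
  thus ?thesis by (simp add: Complex_eq)
qed

lemma sets_cgauss [simp, measurable_cong]: "sets cgauss = sets borel" by (simp add: cgauss_def)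
lemma space_cgauss [simp]: "space cgauss = UNIV" by (simp add: cgauss_def)

lemma prob_space_cgauss: "prob_space cgauss"
proof -
  interpret p: prob_space cgauss_part by (rule prob_space_cgauss_part)
  interpret pp: pair_prob_space cgauss_part cgauss_part ..
  show ?thesis unfolding cgauss_def by (rule pp.prob_space_distr) measurable
qed

lemma char_cgauss_part: "(CLINT x|cgauss_part. iexp (t * x)) = complex_of_real (exp (- (t\<^sup>2 / 4)))"
proof -
  interpret N: prob_space "density lborel std_normal_density" by (rule prob_space_normal_density) simp
  have "distributed (density lborel std_normal_density) lborel (\<lambda>x. x) std_normal_density"
    by (auto simp: distributed_def distr_id2 intro!: distr_cong)
  from N.normal_density_affine[OF this, of "sqrt (1 / 2)" 0]
  have "distributed (density lborel std_normal_density) lborel (\<lambda>x. 0 + sqrt (1 / 2) * x) (normal_density 0 (sqrt (1 / 2)))"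
    by simp
  hence d: "cgauss_part = distr (density lborel std_normal_density) lborel (\<lambda>x. sqrt (1 / 2) * x)"
    by (simp add: distributed_def cgauss_part_def)
  have "(CLINT x|cgauss_part. iexp (t * x)) = (CLINT x|density lborel std_normal_density. iexp (t * (sqrt (1 / 2) * x)))"
    unfolding d by (rule integral_distr) auto
  also have "\<dots> = char (density lborel std_normal_density) (t * sqrt (1 / 2))"
    by (simp add: char_def mult.assoc)
  also have "\<dots> = complex_of_real (exp (- (t * sqrt (1 / 2))\<^sup>2 / 2))"
    by (simp add: char_std_normal_distribution)
  also have "- (t * sqrt (1 / 2))\<^sup>2 / 2 = - (t\<^sup>2 / 4)" by (simp add: power_mult_distrib)
  finally show ?thesis .
qed

lemma char_cgauss: "(CLINT z|cgauss. iexp (Re (cnj a * z))) = complex_of_real (exp (- ((cmod a)\<^sup>2 / 4)))"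
proof -
  interpret p: prob_space cgauss_part by (rule prob_space_cgauss_part)
  interpret pp: pair_prob_space cgauss_part cgauss_part ..
  have "(CLINT z|cgauss. iexp (Re (cnj a * z))) =
        (CLINT w|cgauss_part \<Otimes>\<^sub>M cgauss_part. iexp (Re a * fst w) * iexp (Im a * snd w))"
    unfolding cgauss_def by (subst integral_distr) (auto simp: case_prod_beta exp_add[symmetric] algebra_simps)
  also have "\<dots> = (CLINT x|cgauss_part. CLINT y|cgauss_part. iexp (Re a * x) * iexp (Im a * y))"
  proof (subst pp.integral_fst'[symmetric])
    show "integrable (cgauss_part \<Otimes>\<^sub>M cgauss_part) (\<lambda>w. iexp (Re a * fst w) * iexp (Im a * snd w))"
      by (rule pp.integrable_const_bound[where B = 1]) (auto simp: norm_mult)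
  qed simp
  also have "\<dots> = complex_of_real (exp (- ((Re a)\<^sup>2 / 4))) * complex_of_real (exp (- ((Im a)\<^sup>2 / 4)))"
    using char_cgauss_part[of "Re a"] char_cgauss_part[of "Im a"] by simp
  also have "\<dots> = complex_of_real (exp (- ((cmod a)\<^sup>2 / 4)))"
    by (simp add: cmod_power2 add_divide_distrib flip: of_real_mult exp_add)
  finally show ?thesis .
qed

lemma measurable_fst_snd_borel [measurable]:
  "(fst :: real \<times> real \<Rightarrow> real) \<in> borel_measurable borel" "(snd :: real \<times> real \<Rightarrow> real) \<in> borel_measurable borel"
  by (intro borel_measurable_continuous_onI continuous_intros)+

text \<open>The disc of squared radius $r$ has area $\pi r$, and such discs determine the image
measure.\<close>

lemma distr_lborel_sum_squares:
  "distr (lborel :: (real \<times> real) measure) borel (\<lambda>w. (fst w)\<^sup>2 + (snd w)\<^sup>2) =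
   density lborel (\<lambda>t. ennreal pi * indicator {0..} t)"
proof (rule measure_eqI_generator_eq[where E = "range atMost" and \<Omega> = UNIV and A = "\<lambda>n. {..real n}"])
  show "Int_stable (range atMost :: real set set)" by (auto simp: Int_stable_def)
  have sets: "{w :: real \<times> real. (fst w)\<^sup>2 + (snd w)\<^sup>2 \<le> r} = (if r < 0 then {} else cball 0 (sqrt r))" for r
    by (auto simp: norm_prod_def real_sqrt_le_iff intro: order_trans[OF add_nonneg_nonneg])
       (metis add_nonneg_nonneg order_trans leD zero_le_power2)+
  have left: "emeasure (distr (lborel :: (real \<times> real) measure) borel (\<lambda>w. (fst w)\<^sup>2 + (snd w)\<^sup>2)) {..r} =
     (if r < 0 then 0 else ennreal (pi * r))" for r
  proof -
    have "emeasure (distr (lborel :: (real \<times> real) measure) borel (\<lambda>w. (fst w)\<^sup>2 + (snd w)\<^sup>2)) {..r} =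
          emeasure lborel {w :: real \<times> real. (fst w)\<^sup>2 + (snd w)\<^sup>2 \<le> r}"
      by (subst emeasure_distr) (auto intro!: arg_cong[of _ _ "emeasure lborel"])
    also have "\<dots> = (if r < 0 then 0 else ennreal (pi * r))"
      unfolding sets by (auto simp: emeasure_cball unit_ball_vol_2)
    finally show ?thesis .
  qed
  have right: "emeasure (density lborel (\<lambda>t. ennreal pi * indicator {0..} t)) {..r} = (if r < 0 then 0 else ennreal (pi * r))"
    for r :: real
  proof -
    have "emeasure (density lborel (\<lambda>t. ennreal pi * indicator {0..} t)) {..r} = (\<integral>\<^sup>+t. ennreal pi * indicator {0..r} t \<partial>lborel)"
      by (subst emeasure_density) (auto intro!: nn_integral_cong split: split_indicator)
    also have "\<dots> = ennreal pi * emeasure lborel {0..r}" by (simp add: nn_integral_cmult)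
    also have "\<dots> = (if r < 0 then 0 else ennreal (pi * r))" by (auto simp: ennreal_mult)
    finally show ?thesis .
  qed
  show "emeasure (distr (lborel :: (real \<times> real) measure) borel (\<lambda>w. (fst w)\<^sup>2 + (snd w)\<^sup>2)) X =
      emeasure (density lborel (\<lambda>t. ennreal pi * indicator {0..} t)) X" if "X \<in> range atMost" for X
    using that by (auto simp: left right)
  show "sets (distr (lborel :: (real \<times> real) measure) borel (\<lambda>w. (fst w)\<^sup>2 + (snd w)\<^sup>2)) = sigma_sets UNIV (range atMost)"
    by (simp add: borel_eq_atMost)
  show "sets (density lborel (\<lambda>t::real. ennreal pi * indicator {0..} t)) = sigma_sets UNIV (range atMost)"
    by (simp add: borel_eq_atMost)
  show "(\<Union>n. {..real n}) = UNIV" by (auto intro: real_arch_simple)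
  show "emeasure (distr (lborel :: (real \<times> real) measure) borel (\<lambda>w. (fst w)\<^sup>2 + (snd w)\<^sup>2)) {..real n} \<noteq> \<infinity>" for n
    by (simp add: left)
qed auto

text \<open>The density $e^{-|z|^2}/\pi$ depends on the squared modulus only, and the constant $\pi$ from
the area of the discs turns it into the exponential density.\<close>

lemma nn_integral_cgauss_norm_squared:
  assumes [measurable]: "g \<in> borel_measurable borel"
  shows "(\<integral>\<^sup>+z. g ((cmod z)\<^sup>2) \<partial>cgauss) = (\<integral>\<^sup>+t. ennreal (exponential_density 1 t) * g t \<partial>lborel)"
proof -
  have d: "normal_density 0 (sqrt (1 / 2)) x * normal_density 0 (sqrt (1 / 2)) y = exp (- (x\<^sup>2 + y\<^sup>2)) / pi" for x y
    by (simp add: normal_density_def exp_add[symmetric] real_sqrt_mult[symmetric] algebra_simps)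
  have "(\<integral>\<^sup>+z. g ((cmod z)\<^sup>2) \<partial>cgauss) = (\<integral>\<^sup>+w. g ((fst w)\<^sup>2 + (snd w)\<^sup>2) \<partial>(cgauss_part \<Otimes>\<^sub>M cgauss_part))"
    unfolding cgauss_def by (subst nn_integral_distr) (auto simp: case_prod_beta cmod_power2)
  also have "cgauss_part \<Otimes>\<^sub>M cgauss_part =
     density (lborel \<Otimes>\<^sub>M lborel) (\<lambda>(x, y). ennreal (normal_density 0 (sqrt (1 / 2)) x) * ennreal (normal_density 0 (sqrt (1 / 2)) y))"
    unfolding cgauss_part_def
    by (rule pair_measure_density)
       (use prob_space_cgauss_part in \<open>auto simp: cgauss_part_def lborel.sigma_finite_measure_axioms prob_space_def finite_measure_def\<close>)
  also have "\<dots> = density lborel (\<lambda>w. ennreal (exp (- ((fst w)\<^sup>2 + (snd w)\<^sup>2)) / pi))"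
    by (simp add: lborel_prod case_prod_beta' ennreal_mult[symmetric] d)
  also have "(\<integral>\<^sup>+w. g ((fst w)\<^sup>2 + (snd w)\<^sup>2) \<partial>\<dots>) =
     (\<integral>\<^sup>+w. ennreal (exp (- ((fst w)\<^sup>2 + (snd w)\<^sup>2)) / pi) * g ((fst w)\<^sup>2 + (snd w)\<^sup>2) \<partial>lborel)"
    by (rule nn_integral_density) auto
  also have "\<dots> = (\<integral>\<^sup>+t. ennreal (exp (- t) / pi) * g t \<partial>distr lborel borel (\<lambda>w :: real \<times> real. (fst w)\<^sup>2 + (snd w)\<^sup>2))"
    by (subst nn_integral_distr) auto
  also have "\<dots> = (\<integral>\<^sup>+t. (ennreal pi * indicator {0..} t) * (ennreal (exp (- t) / pi) * g t) \<partial>lborel)"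
    unfolding distr_lborel_sum_squares by (rule nn_integral_density) auto
  also have "\<dots> = (\<integral>\<^sup>+t. ennreal (exponential_density 1 t) * g t \<partial>lborel)"
  proof (rule nn_integral_cong)
    fix t :: real
    have "ennreal pi * ennreal (exp (- t) / pi) = ennreal (exp (- t))"
      by (simp flip: ennreal_mult)
    hence "ennreal pi * (ennreal (exp (- t) / pi) * g t) = ennreal (exp (- t)) * g t"
      by (simp only: mult.assoc[symmetric])
    thus "(ennreal pi * indicator {0..} t) * (ennreal (exp (- t) / pi) * g t) = ennreal (exponential_density 1 t) * g t"
      by (auto simp: exponential_density_def split: split_indicator)
  qed
  finally show ?thesis .
qed

interpretation cg: prob_space cgauss by (rule prob_space_cgauss)
interpretation cgp: product_sigma_finite "\<lambda>_ :: 'i. cgauss" ..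

abbreviation cgaussM :: "'i set \<Rightarrow> ('i \<Rightarrow> complex) measure" where
  "cgaussM I \<equiv> PiM I (\<lambda>_. cgauss)"

lemma prob_space_cgaussM: "prob_space (cgaussM I)"
  by (rule prob_space_PiM) (rule prob_space_cgauss)

text \<open>A sum of independent exponential variables has an Erlang law, by convolution of the
densities.\<close>

lemma nn_integral_cgaussM_norm_squared:
  assumes J: "finite J" "J \<noteq> {}" and g: "g \<in> borel_measurable borel"
  shows "(\<integral>\<^sup>+f. g (\<Sum>j\<in>J. (cmod (f j))\<^sup>2) \<partial>cgaussM J) = (\<integral>\<^sup>+t. ennreal (erlang_density (card J - 1) 1 t) * g t \<partial>lborel)"
  using J g
proof (induction J arbitrary: g rule: finite_ne_induct)
  case (singleton j)
  note [measurable] = singleton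
  have "(\<integral>\<^sup>+f. g (\<Sum>j\<in>{j}. (cmod (f j))\<^sup>2) \<partial>cgaussM {j}) = (\<integral>\<^sup>+f. (\<lambda>z. g ((cmod z)\<^sup>2)) (f j) \<partial>cgaussM {j})"
    by simp
  also have "\<dots> = (\<integral>\<^sup>+z. g ((cmod z)\<^sup>2) \<partial>cgauss)"
    by (rule cgp.product_nn_integral_singleton) measurable
  finally show ?case by (simp add: nn_integral_cgauss_norm_squared[OF singleton])
next
  case (insert i J)
  note [measurable] = insert.prems
  define k where "k = card J - 1"
  have card: "card (insert i J) - 1 = Suc k" using insert.hyps by (simp add: k_def card_gt_0_iff)
  have "(\<integral>\<^sup>+f. g (\<Sum>j\<in>insert i J. (cmod (f j))\<^sup>2) \<partial>cgaussM (insert i J)) =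
        (\<integral>\<^sup>+f. (\<integral>\<^sup>+z. g (\<Sum>j\<in>insert i J. (cmod ((f(i := z)) j))\<^sup>2) \<partial>cgauss) \<partial>cgaussM J)"
    by (rule cgp.product_nn_integral_insert) (use insert.hyps in measurable)
  also have "\<dots> = (\<integral>\<^sup>+f. (\<integral>\<^sup>+z. g ((cmod z)\<^sup>2 + (\<Sum>j\<in>J. (cmod (f j))\<^sup>2)) \<partial>cgauss) \<partial>cgaussM J)"
  proof -
    have "(\<Sum>j\<in>J. (cmod ((f(i := z)) j))\<^sup>2) = (\<Sum>j\<in>J. (cmod (f j))\<^sup>2)" for f z
      using insert.hyps by (intro sum.cong) auto
    thus ?thesis using insert.hyps by simp
  qed
  also have "\<dots> = (\<integral>\<^sup>+f. (\<integral>\<^sup>+t. ennreal (exponential_density 1 t) * g (t + (\<Sum>j\<in>J. (cmod (f j))\<^sup>2)) \<partial>lborel) \<partial>cgaussM J)"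
    by (intro nn_integral_cong nn_integral_cgauss_norm_squared[of "\<lambda>t. g (t + _)"]) measurable
  also have "\<dots> = (\<integral>\<^sup>+u. ennreal (erlang_density k 1 u) * (\<integral>\<^sup>+t. ennreal (exponential_density 1 t) * g (t + u) \<partial>lborel) \<partial>lborel)"
    unfolding k_def by (rule insert.IH[of "\<lambda>u. \<integral>\<^sup>+t. ennreal (exponential_density 1 t) * g (t + u) \<partial>lborel"]) measurable
  also have "\<dots> = (\<integral>\<^sup>+u. ennreal (erlang_density k 1 u) * (\<integral>\<^sup>+w. ennreal (exponential_density 1 (w - u)) * g w \<partial>lborel) \<partial>lborel)"
  proof (rule nn_integral_cong, rule arg_cong[of _ _ "(*) _"])
    fix u :: real
    have "(\<integral>\<^sup>+w. ennreal (exponential_density 1 (w - u)) * g w \<partial>lborel) =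
      ennreal \<bar>1\<bar> * (\<integral>\<^sup>+t. ennreal (exponential_density 1 ((u + 1 * t) - u)) * g (u + 1 * t) \<partial>lborel)"
      by (rule nn_integral_real_affine) auto
    thus "(\<integral>\<^sup>+t. ennreal (exponential_density 1 t) * g (t + u) \<partial>lborel) = (\<integral>\<^sup>+w. ennreal (exponential_density 1 (w - u)) * g w \<partial>lborel)"
      by (simp add: add.commute)
  qed
  also have "\<dots> = (\<integral>\<^sup>+u. \<integral>\<^sup>+w. ennreal (erlang_density k 1 u) * (ennreal (exponential_density 1 (w - u)) * g w) \<partial>lborel \<partial>lborel)"
    by (subst nn_integral_cmult) auto
  also have "\<dots> = (\<integral>\<^sup>+w. \<integral>\<^sup>+u. ennreal (erlang_density k 1 u) * (ennreal (exponential_density 1 (w - u)) * g w) \<partial>lborel \<partial>lborel)"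
    by (rule lborel_pair.Fubini') measurable
  also have "\<dots> = (\<integral>\<^sup>+w. (\<integral>\<^sup>+u. ennreal (exponential_density 1 (w - u)) * ennreal (erlang_density k 1 u) \<partial>lborel) * g w \<partial>lborel)"
  proof (rule nn_integral_cong)
    fix w :: real
    have "(\<integral>\<^sup>+u. (ennreal (exponential_density 1 (w - u)) * ennreal (erlang_density k 1 u)) * g w \<partial>lborel) =
          (\<integral>\<^sup>+u. ennreal (exponential_density 1 (w - u)) * ennreal (erlang_density k 1 u) \<partial>lborel) * g w"
      by (rule nn_integral_multc) measurable
    thus "(\<integral>\<^sup>+u. ennreal (erlang_density k 1 u) * (ennreal (exponential_density 1 (w - u)) * g w) \<partial>lborel) =
          (\<integral>\<^sup>+u. ennreal (exponential_density 1 (w - u)) * ennreal (erlang_density k 1 u) \<partial>lborel) * g w"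
      by (simp add: mult_ac)
  qed
  also have "\<dots> = (\<integral>\<^sup>+w. ennreal (erlang_density (Suc k) 1 w) * g w \<partial>lborel)"
    using fun_cong[OF convolution_erlang_density[of 1 0 k]] by simp
  finally show ?case unfolding card .
qed

section \<open>Gamma-type moments and families of independent Gaussians\<close>

text \<open>Euler's integral at $k-s+p$, since
$\Gamma(k-s+p) = \Gamma(k-s)\,(k-s)_p$.\<close>

lemma nn_integral_erlang_moment:
  assumes a: "real k - s > 0" and k: "k \<ge> 1"
  shows "(\<integral>\<^sup>+t. ennreal (erlang_density (k - 1) 1 t) * ennreal (t powr (- s) * t ^ p) \<partial>lborel) =
     ennreal (Gamma (real k - s) / Gamma (real k) * pochhammer (real k - s) p)"
proof -
  define b where "b = real k - s + real p"
  have b: "b > 0" using a by (simp add: b_def)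
  have "((\<lambda>t. t powr (b - 1) / exp t) has_integral Gamma b) {0..}" by (rule Gamma_integral_real[OF b])
  from nn_integral_has_integral_lebesgue[OF _ this]
  have I: "(\<integral>\<^sup>+t. ennreal (indicator {0..} t * (t powr (b - 1) / exp t)) \<partial>lborel) = ennreal (Gamma b)"
    by simp
  have "(\<integral>\<^sup>+t. ennreal (erlang_density (k - 1) 1 t) * ennreal (t powr (- s) * t ^ p) \<partial>lborel) =
        (\<integral>\<^sup>+t. ennreal (1 / fact (k - 1)) * ennreal (indicator {0..} t * (t powr (b - 1) / exp t)) \<partial>lborel)"
  proof (rule nn_integral_cong_AE)
    have "AE t in lborel. t \<noteq> (0::real)" by (rule AE_lborel_singleton)
    thus "AE t in lborel. ennreal (erlang_density (k - 1) 1 t) * ennreal (t powr (- s) * t ^ p) =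
        ennreal (1 / fact (k - 1)) * ennreal (indicator {0..} t * (t powr (b - 1) / exp t))"
    proof eventually_elim
      case (elim t)
      show ?case
      proof (cases "t < 0")
        case False
        hence t: "t > 0" using elim by simp
        have "t ^ (k - 1) * (t powr (- s) * t ^ p) = t powr (b - 1)"
          using t k by (simp add: b_def of_nat_diff algebra_simps flip: powr_realpow powr_add)
        hence "erlang_density (k - 1) 1 t * (t powr (- s) * t ^ p) = 1 / fact (k - 1) * (t powr (b - 1) / exp t)"
          using t by (simp add: erlang_density_def exp_minus field_simps)
        thus ?thesis using t by (simp flip: ennreal_mult)
      qed (simp add: erlang_density_def)
    qed
  qed
  also have "\<dots> = ennreal (1 / fact (k - 1)) * ennreal (Gamma b)"
    by (subst nn_integral_cmult, measurable) (simp only: I)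
  also have "\<dots> = ennreal (Gamma b / fact (k - 1))"
    using b by (simp add: ennreal_mult[symmetric] Gamma_real_nonneg)
  also have "fact (k - 1) = Gamma (real k)" using k Gamma_fact[of "k - 1", where 'a = real] by (simp add: of_nat_diff)
  also have "Gamma b = Gamma (real k - s) * pochhammer (real k - s) p"
  proof -
    have "real k - s \<notin> \<int>\<^sub>\<le>\<^sub>0" using a nonpos_Ints_nonpos[of "real k - s"] by auto
    from pochhammer_Gamma[OF this, of p] show ?thesis
      using Gamma_real_pos[OF a] by (simp add: b_def)
  qed
  finally show ?thesis by simp
qed

text \<open>The moments of \<open>U\<close> under the weight \<open>w\<close> are those of a Gamma law with shape \<open>a\<close>, times
the constant \<open>C\<close>. For \<open>w = 1\<close> and \<open>C = 1\<close> this says that \<open>U\<close> has the moments of a Gamma variable.\<close>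

definition gamma_moments :: "'a measure \<Rightarrow> ('a \<Rightarrow> real) \<Rightarrow> ('a \<Rightarrow> real) \<Rightarrow> real \<Rightarrow> real \<Rightarrow> bool" where
  "gamma_moments M w U C a \<longleftrightarrow>
     (\<forall>p. (\<integral>\<^sup>+x. ennreal (w x * U x ^ p) \<partial>M) = ennreal (C * pochhammer a p))"

lemma gamma_moments_cgaussM:
  assumes J: "finite J" "J \<noteq> {}" and s: "real (card J) > s"
  shows "gamma_moments (cgaussM J) (\<lambda>f. (\<Sum>j\<in>J. (cmod (f j))\<^sup>2) powr (- s)) (\<lambda>f. \<Sum>j\<in>J. (cmod (f j))\<^sup>2)
     (Gamma (real (card J) - s) / Gamma (real (card J))) (real (card J) - s)"
  unfolding gamma_moments_def
proof
  fix p
  have [measurable]: "(\<lambda>t. ennreal (t powr (- s) * t ^ p)) \<in> borel_measurable borel" by measurable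
  have "card J \<ge> 1" using J by (simp add: Suc_le_eq card_gt_0_iff)
  thus "(\<integral>\<^sup>+f. ennreal ((\<Sum>j\<in>J. (cmod (f j))\<^sup>2) powr (- s) * (\<Sum>j\<in>J. (cmod (f j))\<^sup>2) ^ p) \<partial>cgaussM J) =
      ennreal (Gamma (real (card J) - s) / Gamma (real (card J)) * pochhammer (real (card J) - s) p)"
    using nn_integral_cgaussM_norm_squared[OF J, of "\<lambda>t. ennreal (t powr (- s) * t ^ p)"]
      nn_integral_erlang_moment[of "card J" s p] s by simp
qed

text \<open>This is more than the weighted case for $s = 0$: the weight $0^0$ has the value $0$ under
\<open>powr\<close>, and \<open>J\<close> may be empty, which gives a variable of shape $0$, that is, the constant $0$.\<close>

lemma gamma_moments_cgaussM_unweighted: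
  assumes J: "finite J"
  shows "gamma_moments (cgaussM J) (\<lambda>f. 1) (\<lambda>f. \<Sum>j\<in>J. (cmod (f j))\<^sup>2) 1 (real (card J))"
proof (cases "J = {}")
  case True
  interpret prob_space "cgaussM J" by (rule prob_space_cgaussM)
  show ?thesis unfolding gamma_moments_def
  proof
    fix p
    show "(\<integral>\<^sup>+f. ennreal (1 * (\<Sum>j\<in>J. (cmod (f j))\<^sup>2) ^ p) \<partial>cgaussM J) = ennreal (1 * pochhammer (real (card J)) p)"
      using True emeasure_space_1 by (cases p) (simp_all add: pochhammer_0_left)
  qed
next
  case False
  have "real (card J) > 0" using J False by (simp add: card_gt_0_iff)
  show ?thesis unfolding gamma_moments_def
  proof
    fix p
    have k: "card J \<ge> 1" using J False by (simp add: Suc_le_eq card_gt_0_iff)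
    hence "Gamma (real (card J)) > 0" by (intro Gamma_real_pos) simp
    hence rhs: "Gamma (real (card J) - 0) / Gamma (real (card J)) * pochhammer (real (card J) - 0) p = pochhammer (real (card J)) p"
      by simp
    have "(\<integral>\<^sup>+t. ennreal (erlang_density (card J - 1) 1 t) * ennreal (t powr (- 0) * t ^ p) \<partial>lborel) =
       ennreal (Gamma (real (card J) - 0) / Gamma (real (card J)) * pochhammer (real (card J) - 0) p)"
      by (rule nn_integral_erlang_moment) (use k in auto)
    hence eq: "(\<integral>\<^sup>+t. ennreal (erlang_density (card J - 1) 1 t) * ennreal (t powr (- 0) * t ^ p) \<partial>lborel) =
       ennreal (pochhammer (real (card J)) p)" unfolding rhs .
    have "(\<integral>\<^sup>+t. ennreal (erlang_density (card J - 1) 1 t) * ennreal (t ^ p) \<partial>lborel) =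
          (\<integral>\<^sup>+t. ennreal (erlang_density (card J - 1) 1 t) * ennreal (t powr (- 0) * t ^ p) \<partial>lborel)"
    proof (rule nn_integral_cong_AE)
      have "AE t in lborel. t \<noteq> (0::real)" by (rule AE_lborel_singleton)
      thus "AE t in lborel. ennreal (erlang_density (card J - 1) 1 t) * ennreal (t ^ p) =
          ennreal (erlang_density (card J - 1) 1 t) * ennreal (t powr (- 0) * t ^ p)"
        by eventually_elim simp
    qed
    also note eq
    finally have "(\<integral>\<^sup>+t. ennreal (erlang_density (card J - 1) 1 t) * ennreal (t ^ p) \<partial>lborel) =
       ennreal (pochhammer (real (card J)) p)" .
    thus "(\<integral>\<^sup>+f. ennreal (1 * (\<Sum>j\<in>J. (cmod (f j))\<^sup>2) ^ p) \<partial>cgaussM J) = ennreal (1 * pochhammer (real (card J)) p)"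
      using nn_integral_cgaussM_norm_squared[OF J False, of "\<lambda>t. ennreal (t ^ p)"] by simp
  qed
qed

text \<open>Independent Gamma variables add up to a Gamma variable, and their shapes add. On the level
of moments this is the binomial theorem for rising factorials.\<close>

lemma gamma_moments_add:
  assumes U: "gamma_moments M w U C a" and V: "gamma_moments N v V D b"
    and meas: "w \<in> borel_measurable M" "U \<in> borel_measurable M" "v \<in> borel_measurable N" "V \<in> borel_measurable N"
    and nonneg: "\<And>x. w x \<ge> 0" "\<And>x. U x \<ge> 0" "\<And>y. v y \<ge> 0" "\<And>y. V y \<ge> 0" "C \<ge> 0" "D \<ge> 0" "a \<ge> 0" "b \<ge> 0"
  shows "(\<integral>\<^sup>+x. (\<integral>\<^sup>+y. ennreal (w x * v y * (U x + V y) ^ p) \<partial>N) \<partial>M) = ennreal (C * D * pochhammer (a + b) p)"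
proof -
  note [measurable] = meas
  have poch: "pochhammer x n \<ge> 0" if "x \<ge> 0" for x :: real and n
    using that by (cases "x = 0") (auto simp: pochhammer_0_left intro!: pochhammer_nonneg)
  have e: "w x * v y * (U x + V y) ^ p = (\<Sum>k\<le>p. real (p choose k) * (w x * U x ^ k) * (v y * V y ^ (p - k)))" for x y
    by (simp add: binomial_ring sum_distrib_left mult_ac)
  have "(\<integral>\<^sup>+x. (\<integral>\<^sup>+y. ennreal (w x * v y * (U x + V y) ^ p) \<partial>N) \<partial>M) =
        (\<integral>\<^sup>+x. (\<integral>\<^sup>+y. (\<Sum>k\<le>p. ennreal (real (p choose k) * (w x * U x ^ k)) * ennreal (v y * V y ^ (p - k))) \<partial>N) \<partial>M)"
    unfolding e using nonneg by (intro nn_integral_cong) (simp add: sum_ennreal[symmetric] ennreal_mult)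
  also have "\<dots> = (\<integral>\<^sup>+x. (\<Sum>k\<le>p. ennreal (real (p choose k) * (w x * U x ^ k)) * ennreal (D * pochhammer b (p - k))) \<partial>M)"
    using V unfolding gamma_moments_def by (simp add: nn_integral_sum nn_integral_cmult)
  also have "\<dots> = (\<integral>\<^sup>+x. (\<Sum>k\<le>p. ennreal (real (p choose k) * D * pochhammer b (p - k)) * ennreal (w x * U x ^ k)) \<partial>M)"
    using nonneg poch by (intro nn_integral_cong sum.cong) (auto simp: mult_ac simp flip: ennreal_mult)
  also have "\<dots> = (\<Sum>k\<le>p. ennreal (real (p choose k) * D * pochhammer b (p - k)) * ennreal (C * pochhammer a k))"
    using U unfolding gamma_moments_def by (simp add: nn_integral_sum nn_integral_cmult)
  also have "\<dots> = ennreal (\<Sum>k\<le>p. (real (p choose k) * D * pochhammer b (p - k)) * (C * pochhammer a k))"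
    using nonneg poch by (subst sum_ennreal[symmetric]) (auto simp: ennreal_mult intro!: sum.cong)
  also have "(\<Sum>k\<le>p. (real (p choose k) * D * pochhammer b (p - k)) * (C * pochhammer a k)) = C * D * pochhammer (a + b) p"
    by (simp add: pochhammer_binomial_sum sum_distrib_left mult_ac)
  finally show ?thesis .
qed

lemma char_cgaussM:
  assumes "finite I"
  shows "(CLINT f|cgaussM I. iexp (\<Sum>i\<in>I. Re (cnj (a i) * f i))) = complex_of_real (exp (- (\<Sum>i\<in>I. (cmod (a i))\<^sup>2) / 4))"
proof -
  have "(CLINT f|cgaussM I. iexp (\<Sum>i\<in>I. Re (cnj (a i) * f i))) = (CLINT f|cgaussM I. (\<Prod>i\<in>I. iexp (Re (cnj (a i) * f i))))"
    using assms by (simp only: of_real_sum sum_distrib_left exp_sum)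
  also have "\<dots> = (\<Prod>i\<in>I. CLINT z|cgauss. iexp (Re (cnj (a i) * z)))"
    by (rule cgp.product_integral_prod[OF assms]) (rule cg.integrable_const_bound[where B = 1], auto)
  also have "\<dots> = complex_of_real (exp (- (\<Sum>i\<in>I. (cmod (a i))\<^sup>2) / 4))"
    by (simp only: char_cgauss of_real_prod[symmetric] exp_sum[OF assms, symmetric])
       (simp add: sum_negf sum_divide_distrib)
  finally show ?thesis .
qed

lemma sets_cgaussM: "sets (cgaussM I) = sets (PiM I (\<lambda>_. borel :: complex measure))"
  by (intro sets_PiM_cong) simp_all

lemma measurable_cgaussM_component: "i \<in> I \<Longrightarrow> (\<lambda>f. f i) \<in> borel_measurable (cgaussM I)"
  using measurable_component_singleton[of i I "\<lambda>_. cgauss"]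
  by (simp add: measurable_cong_sets[OF refl sets_cgauss])

text \<open>The real and imaginary parts of all coordinates form a real family to which the
uniqueness theorem applies.\<close>

lemma distr_eq_cgaussM:
  fixes Z :: "'i \<Rightarrow> 'w \<Rightarrow> complex"
  assumes I: "finite I" and M: "prob_space M"
    and meas: "\<And>i. i \<in> I \<Longrightarrow> Z i \<in> borel_measurable M"
    and ch: "\<And>a. (CLINT \<omega>|M. iexp (\<Sum>i\<in>I. Re (cnj (a i) * Z i \<omega>))) = complex_of_real (exp (- (\<Sum>i\<in>I. (cmod (a i))\<^sup>2) / 4))"
  shows "distr M (PiM I (\<lambda>_. borel)) (\<lambda>\<omega>. \<lambda>i\<in>I. Z i \<omega>) = cgaussM I"
proof -
  define part where "part = (\<lambda>(b::bool) z. if b then Re z else Im z)"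
  define K where "K = I \<times> (UNIV :: bool set)"
  have K: "finite K" using I by (simp add: K_def)
  have [measurable]: "part b \<in> borel_measurable borel" for b
    unfolding part_def by (cases b) auto
  define h where "h = (\<lambda>g :: 'i \<times> bool \<Rightarrow> real. \<lambda>i\<in>I. complex_of_real (g (i, True)) + \<i> * complex_of_real (g (i, False)))"
  have h [measurable]: "h \<in> measurable (PiM K (\<lambda>_. borel)) (PiM I (\<lambda>_. borel))"
    unfolding h_def by (intro measurable_restrict borel_measurable_add borel_measurable_times
        borel_measurable_const borel_measurable_of_real measurable_component_singleton) (auto simp: K_def)
  interpret M: prob_space M by fact
  have lin: "(\<Sum>k\<in>K. c k * part (snd k) (F (fst k))) = (\<Sum>i\<in>I. Re (cnj (Complex (c (i, True)) (c (i, False))) * F i))" for c F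
  proof -
    have "(\<Sum>k\<in>K. G k) = (\<Sum>i\<in>I. \<Sum>b\<in>UNIV. G (i, b))" for G :: "'i \<times> bool \<Rightarrow> real"
      unfolding K_def by (simp add: sum.cartesian_product)
    thus ?thesis by (simp add: part_def UNIV_bool add.commute)
  qed
  have "distr M (PiM K (\<lambda>_. borel)) (\<lambda>\<omega>. \<lambda>k\<in>K. part (snd k) (Z (fst k) \<omega>)) =
        distr (cgaussM I) (PiM K (\<lambda>_. borel)) (\<lambda>f. \<lambda>k\<in>K. part (snd k) (f (fst k)))"
  proof (rule joint_law_eqI[OF K M prob_space_cgaussM])
    show "(\<lambda>\<omega>. part (snd k) (Z (fst k) \<omega>)) \<in> borel_measurable M" if "k \<in> K" for k
      using that by (intro measurable_compose[OF meas]) (auto simp: K_def)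
    show "(\<lambda>f. part (snd k) (f (fst k))) \<in> borel_measurable (cgaussM I)" if "k \<in> K" for k
    proof -
      have "(\<lambda>f. f (fst k)) \<in> borel_measurable (cgaussM I)"
        using that by (intro measurable_cgaussM_component) (auto simp: K_def)
      thus ?thesis by (rule measurable_compose) measurable
    qed
    show "(CLINT \<omega>|M. iexp (\<Sum>k\<in>K. c k * part (snd k) (Z (fst k) \<omega>))) =
          (CLINT f|cgaussM I. iexp (\<Sum>k\<in>K. c k * part (snd k) (f (fst k))))" for c
      unfolding lin[of c "\<lambda>i. Z i _"] lin ch char_cgaussM[OF I] ..
  qed
  hence "distr (distr M (PiM K (\<lambda>_. borel)) (\<lambda>\<omega>. \<lambda>k\<in>K. part (snd k) (Z (fst k) \<omega>))) (PiM I (\<lambda>_. borel)) h =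
         distr (distr (cgaussM I) (PiM K (\<lambda>_. borel)) (\<lambda>f. \<lambda>k\<in>K. part (snd k) (f (fst k)))) (PiM I (\<lambda>_. borel)) h"
    by simp
  also have "distr (distr M (PiM K (\<lambda>_. borel)) (\<lambda>\<omega>. \<lambda>k\<in>K. part (snd k) (Z (fst k) \<omega>))) (PiM I (\<lambda>_. borel)) h =
     distr M (PiM I (\<lambda>_. borel)) (\<lambda>\<omega>. \<lambda>i\<in>I. Z i \<omega>)"
  proof (subst distr_distr[OF h])
    show "(\<lambda>\<omega>. \<lambda>k\<in>K. part (snd k) (Z (fst k) \<omega>)) \<in> measurable M (PiM K (\<lambda>_. borel))"
      by (intro measurable_restrict measurable_compose[OF meas]) (auto simp: K_def)
    show "distr M (PiM I (\<lambda>_. borel)) (h \<circ> (\<lambda>\<omega>. \<lambda>k\<in>K. part (snd k) (Z (fst k) \<omega>))) =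
          distr M (PiM I (\<lambda>_. borel)) (\<lambda>\<omega>. \<lambda>i\<in>I. Z i \<omega>)"
      by (intro distr_cong) (auto simp: h_def K_def part_def fun_eq_iff complex_eq_iff restrict_def)
  qed
  also have "distr (distr (cgaussM I) (PiM K (\<lambda>_. borel)) (\<lambda>f. \<lambda>k\<in>K. part (snd k) (f (fst k)))) (PiM I (\<lambda>_. borel)) h =
     distr (cgaussM I) (PiM I (\<lambda>_. borel)) (\<lambda>f. f)"
  proof (subst distr_distr[OF h])
    show "(\<lambda>f. \<lambda>k\<in>K. part (snd k) (f (fst k))) \<in> measurable (cgaussM I) (PiM K (\<lambda>_. borel))"
    proof (intro measurable_restrict)
      fix k assume k: "k \<in> K"
      have "(\<lambda>f. f (fst k)) \<in> borel_measurable (cgaussM I)"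
        using k by (intro measurable_cgaussM_component) (auto simp: K_def)
      thus "(\<lambda>f. part (snd k) (f (fst k))) \<in> borel_measurable (cgaussM I)" by (rule measurable_compose) measurable
    qed
    show "distr (cgaussM I) (PiM I (\<lambda>_. borel)) (h \<circ> (\<lambda>f. \<lambda>k\<in>K. part (snd k) (f (fst k)))) =
          distr (cgaussM I) (PiM I (\<lambda>_. borel)) (\<lambda>f. f)"
      by (intro distr_cong) (auto simp: h_def K_def part_def fun_eq_iff complex_eq_iff restrict_def space_PiM PiE_iff extensional_def)
  qed
  also have "\<dots> = cgaussM I" by (rule distr_id2) (simp add: sets_cgaussM)
  finally show ?thesis .
qed

section \<open>Gram determinants and rotations of their rows\<close>

definition gram_mat :: "nat \<Rightarrow> nat \<Rightarrow> (nat \<times> nat \<Rightarrow> complex) \<Rightarrow> complex mat" where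
  "gram_mat n m f = mat n n (\<lambda>(i, k). \<Sum>j<m. f (i, j) * cnj (f (k, j)))"

text \<open>The Gram determinant of the \<open>n\<close> rows of length \<open>m\<close>. The matrix is given by its entries
as a function on index pairs, a point of a product space.\<close>

definition gram_det :: "nat \<Rightarrow> nat \<Rightarrow> (nat \<times> nat \<Rightarrow> complex) \<Rightarrow> real" where
  "gram_det n m f = Re (det (gram_mat n m f))"

definition sq_norm_on :: "'i set \<Rightarrow> ('i \<Rightarrow> complex) \<Rightarrow> real" where
  "sq_norm_on I f = (\<Sum>i\<in>I. (cmod (f i))\<^sup>2)"

lemma gram_mat_carrier [simp]: "gram_mat n m f \<in> carrier_mat n n" by (simp add: gram_mat_def)

lemma gram_mat_cong:
  assumes "\<And>i j. i < n \<Longrightarrow> j < m \<Longrightarrow> f (i, j) = g (i, j)"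
  shows "gram_mat n m f = gram_mat n m g"
  unfolding gram_mat_def by (rule eq_matI) (auto simp: assms intro!: sum.cong)

lemma gram_det_cong:
  assumes "\<And>i j. i < n \<Longrightarrow> j < m \<Longrightarrow> f (i, j) = g (i, j)"
  shows "gram_det n m f = gram_det n m g"
  unfolding gram_det_def using gram_mat_cong[of n m f g] assms by simp

lemma sq_norm_on_nonneg: "sq_norm_on I f \<ge> 0" by (simp add: sq_norm_on_def sum_nonneg)

lemma det_last_row:
  assumes A: "(A :: 'a :: comm_ring_1 mat) \<in> carrier_mat (Suc n) (Suc n)"
    and z: "\<And>j. j < n \<Longrightarrow> A $$ (n, j) = 0"
  shows "det A = A $$ (n, n) * det (mat_delete A n n)"
proof -
  have "det A = (\<Sum>j<Suc n. A $$ (n, j) * cofactor A n j)"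
    by (rule laplace_expansion_row[OF A]) simp
  also have "\<dots> = A $$ (n, n) * cofactor A n n" by (simp add: z)
  finally show ?thesis by (simp add: cofactor_def)
qed

lemma det_last_column:
  assumes A: "(A :: 'a :: comm_ring_1 mat) \<in> carrier_mat (Suc n) (Suc n)"
    and z: "\<And>i. i < n \<Longrightarrow> A $$ (i, n) = 0"
  shows "det A = A $$ (n, n) * det (mat_delete A n n)"
proof -
  have "det A = (\<Sum>i<Suc n. A $$ (i, n) * cofactor A i n)"
    by (rule laplace_expansion_column[OF A]) simp
  also have "\<dots> = A $$ (n, n) * cofactor A n n" by (simp add: z)
  finally show ?thesis by (simp add: cofactor_def)
qed

text \<open>If the last row is a multiple $r$ of the last unit vector and $y$ denotes the last column
above it, the Gram matrix is the product of the block upper triangular matrix with rows $(S, y)$,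
$(0, r)$ and the block lower triangular one with rows $(I, 0)$, $(y^\dagger, \bar r)$,
with $S$ the Gram matrix of the remaining $n$ rows and $m$ columns. No division by $r$ occurs, so
that $r = 0$ is included.\<close>

lemma det_gram_mat_step:
  assumes z: "\<And>j. j < m \<Longrightarrow> f (n, j) = 0"
  shows "det (gram_mat (Suc n) (Suc m) f) = complex_of_real ((cmod (f (n, m)))\<^sup>2) * det (gram_mat n m f)"
proof -
  define S where "S = (\<lambda>i k. \<Sum>j<m. f (i, j) * cnj (f (k, j)))"
  define A where "A = mat (Suc n) (Suc n) (\<lambda>(i, l). if l < n then (if i < n then S i l else 0) else f (i, m))"
  define B where "B = mat (Suc n) (Suc n) (\<lambda>(l, k). if l < n then (if l = k then 1 else 0) else cnj (f (k, m)))"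
  have AB: "gram_mat (Suc n) (Suc m) f = A * B"
  proof (rule eq_matI)
    fix i k assume ik: "i < dim_row (A * B)" "k < dim_col (A * B)"
    hence i: "i < Suc n" and k: "k < Suc n" by (auto simp: A_def B_def)
    have "(A * B) $$ (i, k) = (\<Sum>l<Suc n. A $$ (i, l) * B $$ (l, k))"
      using i k by (simp add: A_def B_def scalar_prod_def atLeast0LessThan)
    also have "\<dots> = (\<Sum>l<n. A $$ (i, l) * B $$ (l, k)) + f (i, m) * cnj (f (k, m))"
      using i k by (simp add: A_def B_def)
    also have "(\<Sum>l<n. A $$ (i, l) * B $$ (l, k)) = (\<Sum>l<n. if l = k then A $$ (i, l) else 0)"
      using i k by (intro sum.cong) (auto simp: B_def)
    also have "\<dots> = (if k < n then A $$ (i, k) else 0)" by simp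
    also have "\<dots> = S i k"
    proof -
      have "S i k = 0" if "i = n \<or> k = n" using that z by (auto simp: S_def)
      thus ?thesis using i k by (auto simp: A_def less_Suc_eq)
    qed
    finally show "gram_mat (Suc n) (Suc m) f $$ (i, k) = (A * B) $$ (i, k)"
      using i k by (simp add: gram_mat_def S_def)
  qed (auto simp: gram_mat_def A_def B_def)
  have "det A = A $$ (n, n) * det (mat_delete A n n)"
    by (rule det_last_row) (auto simp: A_def)
  also have "mat_delete A n n = gram_mat n m f"
    by (rule eq_matI) (auto simp: mat_delete_def A_def gram_mat_def S_def)
  finally have dA: "det A = f (n, m) * det (gram_mat n m f)" by (simp add: A_def)
  have "det B = B $$ (n, n) * det (mat_delete B n n)"
    by (rule det_last_column) (auto simp: B_def)
  also have "mat_delete B n n = 1\<^sub>m n"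
    by (rule eq_matI) (auto simp: mat_delete_def B_def)
  finally have dB: "det B = cnj (f (n, m))" by (simp add: B_def)
  have "det (A * B) = det A * det B" by (rule det_mult) (auto simp: A_def B_def)
  thus ?thesis unfolding AB dA dB by (simp add: complex_norm_square[symmetric] mult_ac del: of_real_power)
qed

definition unitary_on :: "'j set \<Rightarrow> ('j \<Rightarrow> 'j \<Rightarrow> complex) \<Rightarrow> bool" where
  "unitary_on J U \<longleftrightarrow>
     (\<forall>i\<in>J. \<forall>k\<in>J. (\<Sum>j\<in>J. U i j * cnj (U k j)) = (if i = k then 1 else 0)) \<and>
     (\<forall>j\<in>J. \<forall>l\<in>J. (\<Sum>i\<in>J. cnj (U i j) * U i l) = (if j = l then 1 else 0))"

text \<open>The reflection that exchanges $z$ with the vector $w$ of the same length along the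
coordinate $m$, where the phase of $w_m$ is that of $z_m$; this makes the inner product of $z$ and $w$
real, as a reflection requires.\<close>

lemma householder:
  assumes J: "finite J" and m: "m \<in> J"
  shows "\<exists>U. unitary_on J U \<and> (\<forall>j\<in>J - {m}. (\<Sum>i\<in>J. z i * U i j) = 0)"
proof -
  define r where "r = sqrt (\<Sum>i\<in>J. (cmod (z i))\<^sup>2)"
  obtain ph where ph: "cmod ph = 1" "z m = complex_of_real (cmod (z m)) * ph"
  proof (cases "z m = 0")
    case False
    show ?thesis by (rule that[of "z m / complex_of_real (cmod (z m))"]) (use False in \<open>auto simp: norm_divide\<close>)
  qed (use that[of 1] in simp)
  \<comment> \<open>The difference $z - w$, where $w_m = r\cdot ph$ and the other coordinates of $w$ are $0$.\<close>
  define v where "v = (\<lambda>i. if i = m then complex_of_real (cmod (z m) - r) * ph else z i)"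
  define V where "V = (\<Sum>i\<in>J. (cmod (v i))\<^sup>2)"
  \<comment> \<open>For $v = 0$ the fraction is $0$ and \<open>U\<close> is the identity, as it should be.\<close>
  define U where "U = (\<lambda>i j. (if i = j then 1 else 0) - 2 * cnj (v i) * v j / complex_of_real V)"
  have herm: "cnj (U k j) = U j k" for j k by (auto simp: U_def mult_ac)
  have vv: "(\<Sum>j\<in>J. v j * cnj (v j)) = complex_of_real V"
    by (simp only: V_def of_real_sum complex_norm_square)
  have UU: "(\<Sum>j\<in>J. U i j * U j k) = (if i = k then 1 else 0)" if "i \<in> J" "k \<in> J" for i k
  proof -
    define c where "c = complex_of_real V"
    have "(\<Sum>j\<in>J. U i j * U j k) = (\<Sum>j\<in>J. (if i = j then (if j = k then 1 else 0) else 0)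
        - (if i = j then 2 * cnj (v i) * v k / c else 0) - (if j = k then 2 * cnj (v i) * v k / c else 0)
        + 4 * cnj (v i) * v k / (c * c) * (v j * cnj (v j)))"
      by (intro sum.cong) (auto simp: U_def c_def algebra_simps)
    also have "\<dots> = (if i = k then 1 else 0) - 2 * cnj (v i) * v k / c - 2 * cnj (v i) * v k / c + 4 * cnj (v i) * v k / (c * c) * c"
    proof -
      have s4: "(\<Sum>j\<in>J. 4 * cnj (v i) * v k / (c * c) * (v j * cnj (v j))) = 4 * cnj (v i) * v k / (c * c) * c"
        by (simp only: sum_distrib_left[symmetric] vv c_def)
      show ?thesis using J that by (simp only: sum.distrib sum_subtractf s4) simp
    qed
    also have "\<dots> = (if i = k then 1 else 0)" by (cases "c = 0") (auto simp: field_simps)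
    finally show ?thesis .
  qed
  have "unitary_on J U" unfolding unitary_on_def herm using UU by auto
  moreover have "(\<Sum>i\<in>J. z i * U i j) = 0" if j: "j \<in> J - {m}" for j
  proof -
    define rest where "rest = (\<Sum>i\<in>J - {m}. (cmod (z i))\<^sup>2)"
    have r2: "r\<^sup>2 = (cmod (z m))\<^sup>2 + rest"
      using J m by (simp add: r_def rest_def sum.remove sum_nonneg)
    have "V = (cmod (v m))\<^sup>2 + (\<Sum>i\<in>J - {m}. (cmod (v i))\<^sup>2)" unfolding V_def by (rule sum.remove[OF J m])
    also have "(\<Sum>i\<in>J - {m}. (cmod (v i))\<^sup>2) = rest" unfolding rest_def by (intro sum.cong) (auto simp: v_def)
    also have "(cmod (v m))\<^sup>2 = (cmod (z m) - r)\<^sup>2" using ph by (simp add: v_def norm_mult flip: of_real_diff)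
    finally have V: "V = 2 * (r\<^sup>2 - cmod (z m) * r)" using r2 by (simp add: power2_eq_square algebra_simps)
    have "(\<Sum>i\<in>J. z i * cnj (v i)) = z m * cnj (v m) + (\<Sum>i\<in>J - {m}. z i * cnj (v i))" by (rule sum.remove[OF J m])
    also have "(\<Sum>i\<in>J - {m}. z i * cnj (v i)) = complex_of_real rest"
      unfolding rest_def of_real_sum by (intro sum.cong) (auto simp: v_def complex_norm_square simp del: of_real_power)
    also have "z m * cnj (v m) = complex_of_real (cmod (z m) * (cmod (z m) - r)) * (ph * cnj ph)"
      by (subst ph(2)) (simp add: v_def)
    also have "ph * cnj ph = 1" using ph(1) complex_norm_square[of ph] by simp
    also have "complex_of_real (cmod (z m) * (cmod (z m) - r)) * 1 + complex_of_real rest = complex_of_real (V / 2)"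
      unfolding V mult_1_right of_real_add[symmetric] of_real_eq_iff using r2 by (simp add: power2_eq_square algebra_simps)
    finally have S: "(\<Sum>i\<in>J. z i * cnj (v i)) = complex_of_real (V / 2)" .
    have vj: "v j = z j" using j by (simp add: v_def)
    have "(\<Sum>i\<in>J. z i * U i j) = (\<Sum>i\<in>J. (if i = j then z i else 0) - 2 * v j / complex_of_real V * (z i * cnj (v i)))"
      by (intro sum.cong) (auto simp: U_def algebra_simps)
    also have "\<dots> = z j - 2 * v j / complex_of_real V * complex_of_real (V / 2)"
    proof -
      have "(\<Sum>i\<in>J. 2 * v j / complex_of_real V * (z i * cnj (v i))) = 2 * v j / complex_of_real V * complex_of_real (V / 2)"
        by (simp only: sum_distrib_left[symmetric] S)
      thus ?thesis using J j by (simp only: sum_subtractf) simp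
    qed
    also have "\<dots> = 0"
    proof (cases "V = 0")
      case True
      have "(cmod (v j))\<^sup>2 \<le> V" unfolding V_def by (rule member_le_sum) (use J j in auto)
      thus ?thesis using True vj by simp
    qed (simp add: vj)
    finally show ?thesis .
  qed
  ultimately show ?thesis by blast
qed

definition rotate_rows :: "nat \<Rightarrow> (nat \<Rightarrow> nat \<Rightarrow> complex) \<Rightarrow> (nat \<times> nat \<Rightarrow> complex) \<Rightarrow> nat \<times> nat \<Rightarrow> complex" where
  "rotate_rows m U f = (\<lambda>(k, j). \<Sum>i<m. f (k, i) * U i j)"

lemma unitary_inner:
  fixes m :: nat
  assumes U: "unitary_on {..<m} U"
  shows "(\<Sum>j<m. (\<Sum>i<m. a i * U i j) * cnj (\<Sum>i<m. b i * U i j)) = (\<Sum>i<m. a i * cnj (b i))"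
proof -
  have "(\<Sum>j<m. (\<Sum>i<m. a i * U i j) * cnj (\<Sum>i<m. b i * U i j)) =
        (\<Sum>j<m. \<Sum>i<m. \<Sum>k<m. a i * cnj (b k) * (U i j * cnj (U k j)))"
    by (simp add: sum_product mult_ac)
  also have "\<dots> = (\<Sum>i<m. \<Sum>j<m. \<Sum>k<m. a i * cnj (b k) * (U i j * cnj (U k j)))"
    by (rule sum.swap)
  also have "\<dots> = (\<Sum>i<m. \<Sum>k<m. \<Sum>j<m. a i * cnj (b k) * (U i j * cnj (U k j)))"
    by (intro sum.cong refl sum.swap)
  also have "\<dots> = (\<Sum>i<m. \<Sum>k<m. a i * cnj (b k) * (if i = k then 1 else 0))"
    using U by (intro sum.cong refl) (auto simp: unitary_on_def simp flip: sum_distrib_left)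
  also have "\<dots> = (\<Sum>i<m. a i * cnj (b i))"
  proof (rule sum.cong)
    fix i assume "i \<in> {..<m}"
    have "(\<Sum>k<m. a i * cnj (b k) * (if i = k then 1 else 0)) = (\<Sum>k<m. if k = i then a i * cnj (b k) else 0)"
      by (intro sum.cong) auto
    thus "(\<Sum>k<m. a i * cnj (b k) * (if i = k then 1 else 0)) = a i * cnj (b i)"
      using \<open>i \<in> {..<m}\<close> by simp
  qed simp
  finally show ?thesis .
qed

lemma gram_mat_rotate:
  assumes "unitary_on {..<m} U" shows "gram_mat n m (rotate_rows m U f) = gram_mat n m f"
  unfolding gram_mat_def rotate_rows_def by (rule eq_matI) (auto simp: unitary_inner[OF assms] simp del: cnj_sum)

lemma sq_norm_row_rotate:
  assumes "unitary_on {..<m} U"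
  shows "(\<Sum>j<m. (cmod (rotate_rows m U f (k, j)))\<^sup>2) = (\<Sum>j<m. (cmod (f (k, j)))\<^sup>2)"
proof -
  have "complex_of_real (\<Sum>j<m. (cmod (rotate_rows m U f (k, j)))\<^sup>2) =
        (\<Sum>j<m. rotate_rows m U f (k, j) * cnj (rotate_rows m U f (k, j)))"
    by (simp only: of_real_sum complex_norm_square)
  also have "\<dots> = (\<Sum>j<m. f (k, j) * cnj (f (k, j)))"
    unfolding rotate_rows_def prod.case by (rule unitary_inner[OF assms])
  also have "\<dots> = complex_of_real (\<Sum>j<m. (cmod (f (k, j)))\<^sup>2)"
    by (simp only: of_real_sum complex_norm_square)
  finally show ?thesis by (simp only: of_real_eq_iff)
qed

lemma sq_norm_on_rows: "sq_norm_on (K \<times> {..<m}) f = (\<Sum>k\<in>K. \<Sum>j<m. (cmod (f (k, j)))\<^sup>2)"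
  by (simp add: sq_norm_on_def sum.cartesian_product case_prod_beta)

lemma sq_norm_rotate:
  assumes "unitary_on {..<m} U"
  shows "sq_norm_on (K \<times> {..<m}) (rotate_rows m U f) = sq_norm_on (K \<times> {..<m}) f"
  by (simp add: sq_norm_on_rows sq_norm_row_rotate[OF assms])

text \<open>The rotation leaves the Gram matrix unchanged and brings the last row into the form
that the factorisation requires; its last entry then carries the norm of the whole row.\<close>

lemma rotated_row:
  assumes U: "unitary_on {..<Suc m} U" and z: "\<And>j. j < m \<Longrightarrow> (\<Sum>i<Suc m. f (n, i) * U i j) = 0"
  shows "det (gram_mat (Suc n) (Suc m) f) =
      complex_of_real (sq_norm_on ({n} \<times> {..<Suc m}) f) * det (gram_mat n m (rotate_rows (Suc m) U f))"
proof -
  let ?g = "rotate_rows (Suc m) U f"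
  have z': "?g (n, j) = 0" if "j < m" for j using z[OF that] by (simp add: rotate_rows_def del: sum.lessThan_Suc)
  have "det (gram_mat (Suc n) (Suc m) f) = det (gram_mat (Suc n) (Suc m) ?g)"
    by (simp add: gram_mat_rotate[OF U])
  also have "\<dots> = complex_of_real ((cmod (?g (n, m)))\<^sup>2) * det (gram_mat n m ?g)"
    by (rule det_gram_mat_step) (rule z')
  also have "(cmod (?g (n, m)))\<^sup>2 = sq_norm_on ({n} \<times> {..<Suc m}) ?g"
    using z' by (simp add: sq_norm_on_rows)
  also have "\<dots> = sq_norm_on ({n} \<times> {..<Suc m}) f" by (rule sq_norm_rotate[OF U])
  finally show ?thesis .
qed

text \<open>Each step of the reduction splits off a squared norm.\<close>

lemma gram_det_nonneg: "n \<le> m \<Longrightarrow> gram_det n m f \<ge> 0"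
proof (induction n arbitrary: m f)
  case 0
  show ?case by (simp add: gram_det_def gram_mat_def det_dim_zero)
next
  case (Suc n)
  then obtain m' where m: "m = Suc m'" "n \<le> m'" by (cases m) auto
  obtain U where U: "unitary_on {..<Suc m'} U" "\<And>j. j < m' \<Longrightarrow> (\<Sum>i<Suc m'. f (n, i) * U i j) = 0"
    using householder[of "{..<Suc m'}" m' "\<lambda>i. f (n, i)"] by (auto simp del: sum.lessThan_Suc)
  have "gram_det (Suc n) (Suc m') f = sq_norm_on ({n} \<times> {..<Suc m'}) f * gram_det n m' (rotate_rows (Suc m') U f)"
  proof -
    have "det (gram_mat (Suc n) (Suc m') f) = complex_of_real (sq_norm_on ({n} \<times> {..<Suc m'}) f) *
        det (gram_mat n m' (rotate_rows (Suc m') U f))"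
      by (rule rotated_row[OF U(1)]) (rule U(2))
    thus ?thesis by (simp add: gram_det_def)
  qed
  thus ?case using Suc.IH[OF m(2)] m(1) by (simp add: sq_norm_on_nonneg)
qed

text \<open>The characteristic function depends only on the Euclidean norm of its argument, which the
adjoint rotation preserves.\<close>

lemma rotate_rows_distr:
  assumes U: "unitary_on {..<m} U" and K: "finite K"
  shows "distr (cgaussM (K \<times> {..<m})) (PiM (K \<times> {..<m}) (\<lambda>_. borel)) (\<lambda>f. \<lambda>ij\<in>K \<times> {..<m}. rotate_rows m U f ij) =
         cgaussM (K \<times> {..<m})"
proof (rule distr_eq_cgaussM)
  fix a :: "nat \<times> nat \<Rightarrow> complex"
  define b where "b = (\<lambda>(k, i). \<Sum>j<m. a (k, j) * cnj (U i j))"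
  have lin: "(\<Sum>ij\<in>K \<times> {..<m}. Re (cnj (a ij) * rotate_rows m U f ij)) = (\<Sum>ij\<in>K \<times> {..<m}. Re (cnj (b ij) * f ij))" for f
  proof -
    have "(\<Sum>j<m. cnj (a (k, j)) * (\<Sum>i<m. f (k, i) * U i j)) = (\<Sum>i<m. cnj (b (k, i)) * f (k, i))" for k
    proof -
      have "(\<Sum>j<m. cnj (a (k, j)) * (\<Sum>i<m. f (k, i) * U i j)) = (\<Sum>j<m. \<Sum>i<m. cnj (a (k, j)) * U i j * f (k, i))"
        by (simp add: sum_distrib_left mult_ac)
      also have "\<dots> = (\<Sum>i<m. \<Sum>j<m. cnj (a (k, j)) * U i j * f (k, i))" by (rule sum.swap)
      also have "\<dots> = (\<Sum>i<m. cnj (b (k, i)) * f (k, i))" by (simp add: b_def sum_distrib_right)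
      finally show ?thesis .
    qed
    hence "Re (\<Sum>k\<in>K. \<Sum>j<m. cnj (a (k, j)) * (\<Sum>i<m. f (k, i) * U i j)) = Re (\<Sum>k\<in>K. \<Sum>i<m. cnj (b (k, i)) * f (k, i))"
      by simp
    thus ?thesis
      by (simp only: Re_sum sum.cartesian_product rotate_rows_def case_prod_beta prod.collapse)
  qed
  have "unitary_on {..<m} (\<lambda>j i. cnj (U i j))"
    using U unfolding unitary_on_def by (auto simp: mult.commute)
  from sq_norm_rotate[OF this, of K a]
  have norm: "(\<Sum>ij\<in>K \<times> {..<m}. (cmod (b ij))\<^sup>2) = (\<Sum>ij\<in>K \<times> {..<m}. (cmod (a ij))\<^sup>2)"
    by (simp add: sq_norm_on_def b_def rotate_rows_def)
  show "(CLINT f|cgaussM (K \<times> {..<m}). iexp (\<Sum>ij\<in>K \<times> {..<m}. Re (cnj (a ij) * rotate_rows m U f ij))) =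
        complex_of_real (exp (- (\<Sum>ij\<in>K \<times> {..<m}. (cmod (a ij))\<^sup>2) / 4))"
    unfolding lin norm[symmetric] by (rule char_cgaussM) (use K in simp)
next
  fix ij assume ij: "ij \<in> K \<times> {..<m}"
  show "(\<lambda>f. rotate_rows m U f ij) \<in> borel_measurable (cgaussM (K \<times> {..<m}))"
    unfolding rotate_rows_def case_prod_beta
    by (intro borel_measurable_sum borel_measurable_times borel_measurable_const measurable_cgaussM_component)
       (use ij in auto)
qed (use K prob_space_cgaussM in auto)

lemma measurable_gram_det:
  assumes "{..<n} \<times> {..<m} \<subseteq> I" shows "gram_det n m \<in> borel_measurable (cgaussM I)"
proof -
  have pl: "p i < n" if "p permutes {0..<n}" "i < n" for p i
    using permutes_in_image[OF that(1), of i] that(2) by simp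
  have "(\<lambda>f. det (gram_mat n m f)) = (\<lambda>f. \<Sum>p | p permutes {0..<n}. signof p *
      (\<Prod>i=0..<n. if i < n \<and> p i < n then \<Sum>j<m. f (i, j) * cnj (f (p i, j)) else gram_mat n m f $$ (i, p i)))"
    by (subst det_def'[OF gram_mat_carrier]) (auto simp: gram_mat_def fun_eq_iff intro!: sum.cong prod.cong)
  also have "\<dots> = (\<lambda>f. \<Sum>p | p permutes {0..<n}. signof p *
      (\<Prod>i=0..<n. \<Sum>j<m. f (i, j) * cnj (f (p i, j))))"
    by (auto simp: fun_eq_iff pl intro!: sum.cong prod.cong)
  also have "\<dots> \<in> borel_measurable (cgaussM I)"
  proof (intro borel_measurable_sum borel_measurable_times borel_measurable_const borel_measurable_prod)
    fix p i j assume "p \<in> {p. p permutes {0..<n}}" "i \<in> {0..<n}" "j \<in> {..<m}"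
    hence "(i, j) \<in> I" "(p i, j) \<in> I" using assms by (auto simp: pl)
    note [measurable] = measurable_cgaussM_component[OF this(1)] measurable_cgaussM_component[OF this(2)]
    show "(\<lambda>f. f (i, j)) \<in> borel_measurable (cgaussM I)" by measurable
    show "(\<lambda>f. cnj (f (p i, j))) \<in> borel_measurable (cgaussM I)"
      by (intro borel_measurable_continuous_on[OF _ measurable_cgaussM_component] continuous_intros) fact
  qed
  finally show ?thesis unfolding gram_det_def by (rule measurable_compose) simp
qed

lemma measurable_sq_norm_on: "J \<subseteq> I \<Longrightarrow> sq_norm_on J \<in> borel_measurable (cgaussM I)"
  unfolding sq_norm_on_def
  by (intro borel_measurable_sum borel_measurable_power measurable_compose[OF measurable_cgaussM_component])
     auto

section \<open>Moments of the Gram determinant\<close>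

text \<open>Condition on the last row $x$ and rotate the other rows by a unitary matrix that takes
$x$ to a multiple of the last unit vector. The rotated rows have the same law, so that for every
$x$ the inner integral is that of
$(|x|^2 D')^{-s}(|x|^2+|y|^2+T')^p$, where $y$ is the last column of the remaining rows and $D'$, $T'$
belong to the remaining $n\times m$ block. Thus $|x|^2$, $|y|^2$ and $T'$ act as independent
Gamma variables with shapes $m+1-s$, $n$ and $n(m-s)$, which add up to $(n+1)(m+1-s)$.\<close>

theorem gamma_moments_gram_det:
  assumes "n \<le> m" "s < real m - real n + 1"
  shows "gamma_moments (cgaussM ({..<n} \<times> {..<m})) (\<lambda>f. gram_det n m f powr (- s)) (sq_norm_on ({..<n} \<times> {..<m}))
     (\<Prod>k<n. Gamma (real m - real k - s) / Gamma (real m - real k)) (real n * (real m - s))"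
  using assms
proof (induction n arbitrary: m)
  case 0
  interpret prob_space "cgaussM ({} :: (nat \<times> nat) set)" by (rule prob_space_cgaussM)
  have "gram_det 0 m f = 1" for f by (simp add: gram_det_def gram_mat_def det_dim_zero)
  moreover have "(\<integral>\<^sup>+f. ennreal (0 ^ p) \<partial>cgaussM ({} :: (nat \<times> nat) set)) = ennreal (pochhammer 0 p)" for p
    using emeasure_space_1 by (cases p) (simp_all add: pochhammer_0_left)
  ultimately show ?case by (simp add: gamma_moments_def sq_norm_on_def)
next
  case (Suc n)
  then obtain m' where m: "m = Suc m'" by (cases m) auto
  have nm: "n \<le> m'" "s < real m' - real n + 1" using Suc.prems m by auto
  have s: "s < real (Suc m')" using nm by linarith
  define R where "R = {n} \<times> {..<Suc m'}"
  define L where "L = {..<n} \<times> {..<Suc m'}"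
  define L1 where "L1 = {..<n} \<times> {m'}"
  define L2 where "L2 = {..<n} \<times> {..<m'}"
  define C where "C = (\<Prod>k<n. Gamma (real m' - real k - s) / Gamma (real m' - real k))"
  define b where "b = real n + real n * (real m' - s)"
  have Cpos: "C \<ge> 0"
    unfolding C_def using nm by (intro prod_nonneg divide_nonneg_nonneg) (auto intro!: Gamma_real_nonneg)
  have fin: "finite R" "finite L" "finite L1" "finite L2" by (auto simp: R_def L_def L1_def L2_def)
  have RL: "R \<inter> L = {}" "{..<Suc n} \<times> {..<Suc m'} = R \<union> L" by (auto simp: R_def L_def)
  have LL: "L1 \<inter> L2 = {}" "L = L1 \<union> L2" by (auto simp: L_def L1_def L2_def)
  have IH: "gamma_moments (cgaussM L2) (\<lambda>f. gram_det n m' f powr (- s)) (sq_norm_on L2) C (real n * (real m' - s))"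
    unfolding L2_def C_def by (rule Suc.IH[OF nm])
  have gdn: "gram_det n m' f \<ge> 0" for f by (rule gram_det_nonneg[OF nm(1)])
  have m_gd: "(\<lambda>f. gram_det n m' f powr (- s)) \<in> borel_measurable (cgaussM I)" if "L2 \<subseteq> I" for I
    using measurable_gram_det[of n m' I] that unfolding L2_def by measurable

  \<comment> \<open>The remaining rows, with the column \<open>m'\<close> integrated separately from the block.\<close>
  have left: "gamma_moments (cgaussM L) (\<lambda>f. gram_det n m' f powr (- s)) (sq_norm_on L) C b"
    unfolding gamma_moments_def
  proof
    fix p
    have "(\<integral>\<^sup>+f. ennreal (gram_det n m' f powr (- s) * sq_norm_on L f ^ p) \<partial>cgaussM L) =
       (\<integral>\<^sup>+x. \<integral>\<^sup>+y. ennreal (gram_det n m' (merge L1 L2 (x, y)) powr (- s) * sq_norm_on L (merge L1 L2 (x, y)) ^ p) \<partial>cgaussM L2 \<partial>cgaussM L1)"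
      unfolding LL(2)
    proof (rule cgp.product_nn_integral_fold[OF LL(1) fin(3,4)])
      have [measurable]: "(\<lambda>f. gram_det n m' f powr (- s)) \<in> borel_measurable (cgaussM (L1 \<union> L2))"
        "sq_norm_on (L1 \<union> L2) \<in> borel_measurable (cgaussM (L1 \<union> L2))"
        using m_gd measurable_sq_norm_on by auto
      show "(\<lambda>f. ennreal (gram_det n m' f powr (- s) * sq_norm_on (L1 \<union> L2) f ^ p)) \<in> borel_measurable (cgaussM (L1 \<union> L2))"
        by measurable
    qed
    also have "\<dots> = (\<integral>\<^sup>+x. \<integral>\<^sup>+y. ennreal (1 * gram_det n m' y powr (- s) * (sq_norm_on L1 x + sq_norm_on L2 y) ^ p) \<partial>cgaussM L2 \<partial>cgaussM L1)"
    proof -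
      have "gram_det n m' (merge L1 L2 (x, y)) = gram_det n m' y" for x y
        by (rule gram_det_cong) (use LL in \<open>auto simp: merge_def L1_def L2_def\<close>)
      moreover have "sq_norm_on L (merge L1 L2 (x, y)) = sq_norm_on L1 x + sq_norm_on L2 y" for x y
      proof -
        have "sq_norm_on L (merge L1 L2 (x, y)) = sq_norm_on L1 (merge L1 L2 (x, y)) + sq_norm_on L2 (merge L1 L2 (x, y))"
          unfolding sq_norm_on_def LL(2) by (rule sum.union_disjoint) (use fin LL in auto)
        also have "sq_norm_on L1 (merge L1 L2 (x, y)) = sq_norm_on L1 x"
          unfolding sq_norm_on_def by (intro sum.cong) (auto simp: merge_def)
        also have "sq_norm_on L2 (merge L1 L2 (x, y)) = sq_norm_on L2 y"
          unfolding sq_norm_on_def by (intro sum.cong) (use LL in \<open>auto simp: merge_def\<close>)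
        finally show ?thesis .
      qed
      ultimately show ?thesis by simp
    qed
    also have "\<dots> = ennreal (1 * C * pochhammer (real (card L1) + real n * (real m' - s)) p)"
    proof (rule gamma_moments_add[OF _ IH])
      show "gamma_moments (cgaussM L1) (\<lambda>x. 1) (sq_norm_on L1) 1 (real (card L1))"
        using gamma_moments_cgaussM_unweighted[OF fin(3)] by (simp add: sq_norm_on_def[abs_def])
      show "0 \<le> real n * (real m' - s)"
        by (cases "n = 0") (use nm in \<open>auto intro!: mult_nonneg_nonneg\<close>)
    qed (use Cpos in \<open>auto simp: sq_norm_on_nonneg intro!: m_gd measurable_sq_norm_on\<close>)
    also have "real (card L1) + real n * (real m' - s) = b" by (simp add: L1_def b_def)
    finally show "(\<integral>\<^sup>+f. ennreal (gram_det n m' f powr (- s) * sq_norm_on L f ^ p) \<partial>cgaussM L) = ennreal (C * pochhammer b p)"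
      by simp
  qed

  \<comment> \<open>The rotation depends on \<open>x\<close>, but the resulting integral only on its norm.\<close>
  have inner: "(\<integral>\<^sup>+y. ennreal (gram_det (Suc n) (Suc m') (merge R L (x, y)) powr (- s) * sq_norm_on (R \<union> L) (merge R L (x, y)) ^ p) \<partial>cgaussM L) =
      (\<integral>\<^sup>+y. ennreal (sq_norm_on R x powr (- s) * gram_det n m' y powr (- s) * (sq_norm_on R x + sq_norm_on L y) ^ p) \<partial>cgaussM L)" for x p
  proof -
    obtain U where U: "unitary_on {..<Suc m'} U" "\<And>j. j < m' \<Longrightarrow> (\<Sum>i<Suc m'. x (n, i) * U i j) = 0"
      using householder[of "{..<Suc m'}" m' "\<lambda>i. x (n, i)"] by (auto simp del: sum.lessThan_Suc)
    define rot where "rot = (\<lambda>y. \<lambda>ij\<in>L. rotate_rows (Suc m') U y ij)"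
    define G where "G = (\<lambda>y. ennreal (sq_norm_on R x powr (- s) * gram_det n m' y powr (- s) * (sq_norm_on R x + sq_norm_on L y) ^ p))"
    have G [measurable]: "G \<in> borel_measurable (PiM L (\<lambda>_. borel))"
    proof -
      have [measurable]: "(\<lambda>f. gram_det n m' f powr (- s)) \<in> borel_measurable (cgaussM L)"
        "sq_norm_on L \<in> borel_measurable (cgaussM L)"
        using m_gd LL measurable_sq_norm_on by auto
      have "G \<in> borel_measurable (cgaussM L)" unfolding G_def by measurable
      thus ?thesis by (simp add: measurable_cong_sets[OF sets_cgaussM refl])
    qed
    have rot_meas: "rot \<in> measurable (cgaussM L) (PiM L (\<lambda>_. borel))"
      unfolding rot_def
    proof (intro measurable_restrict)
      fix ij assume ij: "ij \<in> L"
      show "(\<lambda>y. rotate_rows (Suc m') U y ij) \<in> borel_measurable (cgaussM L)"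
        unfolding rotate_rows_def case_prod_beta
        by (intro borel_measurable_sum borel_measurable_times borel_measurable_const measurable_cgaussM_component)
           (use ij in \<open>auto simp: L_def\<close>)
    qed
    have point: "ennreal (gram_det (Suc n) (Suc m') (merge R L (x, y)) powr (- s) * sq_norm_on (R \<union> L) (merge R L (x, y)) ^ p) = G (rot y)" for y
    proof -
      define f where "f = merge R L (x, y)"
      have fR: "f (n, j) = x (n, j)" if "j < Suc m'" for j using that by (auto simp: f_def merge_def R_def)
      have fL: "f ij = y ij" if "ij \<in> L" for ij using that RL by (auto simp: f_def merge_def)
      have nR: "sq_norm_on R f = sq_norm_on R x"
        unfolding sq_norm_on_def by (intro sum.cong) (auto simp: R_def fR)
      have det: "det (gram_mat (Suc n) (Suc m') f) = complex_of_real (sq_norm_on ({n} \<times> {..<Suc m'}) f) *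
          det (gram_mat n m' (rotate_rows (Suc m') U f))"
      proof (rule rotated_row[OF U(1)])
        fix j assume "j < m'"
        thus "(\<Sum>i<Suc m'. f (n, i) * U i j) = 0" using U(2)[of j] by (simp add: fR)
      qed
      have rf: "rotate_rows (Suc m') U f ij = rot y ij" if "ij \<in> L" for ij
      proof -
        obtain k j where ij: "ij = (k, j)" by (cases ij)
        have "f (k, i) = y (k, i)" if "i < Suc m'" for i
          using \<open>ij \<in> L\<close> that by (intro fL) (auto simp: ij L_def)
        thus ?thesis using that unfolding rot_def ij by (auto simp: rotate_rows_def intro!: sum.cong)
      qed
      have "gram_det n m' (rotate_rows (Suc m') U f) = gram_det n m' (rot y)"
        by (rule gram_det_cong) (auto intro!: rf simp: L_def)
      hence gd: "gram_det (Suc n) (Suc m') f = sq_norm_on R x * gram_det n m' (rot y)"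
        using det nR by (simp add: gram_det_def R_def)
      have "sq_norm_on L (rot y) = sq_norm_on L (rotate_rows (Suc m') U y)"
        unfolding sq_norm_on_def by (intro sum.cong) (auto simp: rot_def)
      also have "\<dots> = sq_norm_on L y" unfolding L_def by (rule sq_norm_rotate[OF U(1)])
      also have "\<dots> = sq_norm_on L f" unfolding sq_norm_on_def by (intro sum.cong) (auto simp: fL)
      finally have "sq_norm_on (R \<union> L) f = sq_norm_on R x + sq_norm_on L (rot y)"
        using RL(1) fin nR by (simp add: sq_norm_on_def sum.union_disjoint)
      thus ?thesis using gd gdn[of "rot y"] sq_norm_on_nonneg[of R x]
        by (simp add: G_def f_def powr_mult)
    qed
    have "(\<integral>\<^sup>+y. G (rot y) \<partial>cgaussM L) = (\<integral>\<^sup>+y. G y \<partial>distr (cgaussM L) (PiM L (\<lambda>_. borel)) rot)"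
      by (rule nn_integral_distr[symmetric]) (use rot_meas in measurable)
    also have "distr (cgaussM L) (PiM L (\<lambda>_. borel)) rot = cgaussM L"
      unfolding rot_def L_def by (rule rotate_rows_distr[OF U(1)]) simp
    finally show ?thesis unfolding point G_def .
  qed

  have "(n, 0) \<in> R" by (simp add: R_def)
  hence "R \<noteq> {}" by auto
  moreover have "s < real (card R)" using s by (simp add: R_def)
  ultimately have "gamma_moments (cgaussM R) (\<lambda>f. sq_norm_on R f powr (- s)) (sq_norm_on R)
     (Gamma (real (card R) - s) / Gamma (real (card R))) (real (card R) - s)"
    using gamma_moments_cgaussM[OF fin(1)] unfolding sq_norm_on_def[abs_def] by blast
  hence right: "gamma_moments (cgaussM R) (\<lambda>f. sq_norm_on R f powr (- s)) (sq_norm_on R)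
     (Gamma (real (Suc m') - s) / Gamma (real (Suc m'))) (real (Suc m') - s)" by (simp add: R_def)

  show ?case unfolding gamma_moments_def
  proof
    fix p
    have "(\<integral>\<^sup>+f. ennreal (gram_det (Suc n) m f powr (- s) * sq_norm_on ({..<Suc n} \<times> {..<m}) f ^ p) \<partial>cgaussM ({..<Suc n} \<times> {..<m})) =
       (\<integral>\<^sup>+x. \<integral>\<^sup>+y. ennreal (gram_det (Suc n) (Suc m') (merge R L (x, y)) powr (- s) * sq_norm_on (R \<union> L) (merge R L (x, y)) ^ p) \<partial>cgaussM L \<partial>cgaussM R)"
      unfolding m RL(2)
    proof (rule cgp.product_nn_integral_fold[OF RL(1) fin(1,2)])
      have "gram_det (Suc n) (Suc m') \<in> borel_measurable (cgaussM (R \<union> L))"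
        by (rule measurable_gram_det) (simp add: RL(2))
      moreover have "sq_norm_on (R \<union> L) \<in> borel_measurable (cgaussM (R \<union> L))"
        by (rule measurable_sq_norm_on) simp
      ultimately show "(\<lambda>f. ennreal (gram_det (Suc n) (Suc m') f powr (- s) * sq_norm_on (R \<union> L) f ^ p)) \<in> borel_measurable (cgaussM (R \<union> L))"
        by measurable
    qed
    also have "\<dots> = (\<integral>\<^sup>+x. \<integral>\<^sup>+y. ennreal (sq_norm_on R x powr (- s) * gram_det n m' y powr (- s) * (sq_norm_on R x + sq_norm_on L y) ^ p) \<partial>cgaussM L \<partial>cgaussM R)"
      by (simp only: inner)
    also have "\<dots> = ennreal (Gamma (real (Suc m') - s) / Gamma (real (Suc m')) * C * pochhammer (real (Suc m') - s + b) p)"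
    proof (rule gamma_moments_add[OF right left])
      have [measurable]: "sq_norm_on R \<in> borel_measurable (cgaussM R)" by (rule measurable_sq_norm_on) simp
      show "(\<lambda>f. sq_norm_on R f powr (- s)) \<in> borel_measurable (cgaussM R)" by measurable
      show "0 \<le> b" unfolding b_def
        by (cases "n = 0") (use nm in \<open>auto simp flip: distrib_left[of "real n" 1, simplified] intro!: mult_nonneg_nonneg\<close>)
      show "0 \<le> Gamma (real (Suc m') - s) / Gamma (real (Suc m'))"
        using s by (intro divide_nonneg_nonneg Gamma_real_nonneg) auto
    qed (use Cpos s LL in \<open>auto simp: sq_norm_on_nonneg intro!: m_gd measurable_sq_norm_on\<close>)
    also have "real (Suc m') - s + b = real (Suc n) * (real m - s)" by (simp add: b_def m algebra_simps)
    also have "Gamma (real (Suc m') - s) / Gamma (real (Suc m')) * C =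
        (\<Prod>k<Suc n. Gamma (real m - real k - s) / Gamma (real m - real k))"
      unfolding C_def m by (subst prod.lessThan_Suc_shift) simp
    finally show "(\<integral>\<^sup>+f. ennreal (gram_det (Suc n) m f powr (- s) * sq_norm_on ({..<Suc n} \<times> {..<m}) f ^ p) \<partial>cgaussM ({..<Suc n} \<times> {..<m})) =
       ennreal ((\<Prod>k<Suc n. Gamma (real m - real k - s) / Gamma (real m - real k)) * pochhammer (real (Suc n) * (real m - s)) p)" .
  qed
qed

section \<open>The entries of a Gaussian matrix\<close>

text \<open>Both the degenerate and the proper normal laws are affine images of the standard one.\<close>

lemma normal_rv_affine:
  assumes M: "prob_space M" and Y: "normal_rv M Y"
  obtains \<mu> \<sigma> where "distr M borel Y = distr std_normal_distribution borel (\<lambda>x. \<mu> + \<sigma> * x)"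
proof -
  interpret N: prob_space std_normal_distribution by (rule prob_space_normal_density) simp
  obtain \<mu> \<sigma> where \<sigma>: "\<sigma> \<ge> 0" and d: "distr M borel Y =
        (if \<sigma> = 0 then return borel \<mu> else density lborel (normal_density \<mu> \<sigma>))"
    using Y by (auto simp: normal_rv_def)
  show ?thesis
  proof (cases "\<sigma> = 0")
    case True
    have "distr std_normal_distribution borel (\<lambda>x. \<mu>) = return borel \<mu>" by (rule N.distr_const) simp
    thus ?thesis using that[of \<mu> 0] d True by simp
  next
    case False
    have "distributed std_normal_distribution lborel (\<lambda>x. x) std_normal_density"
      by (auto simp: distributed_def distr_id2 intro!: distr_cong)
    from N.normal_density_affine[OF this, of \<sigma> \<mu>] False \<sigma>
    have "distr std_normal_distribution lborel (\<lambda>x. \<mu> + \<sigma> * x) = density lborel (normal_density \<mu> \<sigma>)"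
      by (simp add: distributed_def)
    moreover have "distr std_normal_distribution lborel (\<lambda>x. \<mu> + \<sigma> * x) = distr std_normal_distribution borel (\<lambda>x. \<mu> + \<sigma> * x)"
      by (rule distr_cong) simp_all
    ultimately show ?thesis using that[of \<mu> \<sigma>] d False by simp
  qed
qed

text \<open>The second moment of a centred normal variable determines its characteristic function. The
form $\mu+\sigma x$ of the variable treats the degenerate and the proper laws at once.\<close>

lemma normal_rv_moments:
  assumes M: "prob_space M" and Y: "normal_rv M Y"
  shows "integrable M Y" "integrable M (\<lambda>\<omega>. (Y \<omega>)\<^sup>2)"
    "(\<integral>\<omega>. Y \<omega> \<partial>M) = 0 \<Longrightarrow>
       (CLINT \<omega>|M. iexp (Y \<omega>)) = complex_of_real (exp (- (\<integral>\<omega>. (Y \<omega>)\<^sup>2 \<partial>M) / 2))"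
proof -
  interpret N: prob_space std_normal_distribution by (rule prob_space_normal_density) simp
  have [measurable]: "Y \<in> borel_measurable M" using Y by (simp add: normal_rv_def)
  obtain \<mu> \<sigma> where d: "distr M borel Y = distr std_normal_distribution borel (\<lambda>x. \<mu> + \<sigma> * x)"
    by (rule normal_rv_affine[OF M Y])
  have int_iff: "integrable M (\<lambda>\<omega>. g (Y \<omega>)) \<longleftrightarrow> integrable std_normal_distribution (\<lambda>x. g (\<mu> + \<sigma> * x))"
    if "g \<in> borel_measurable borel" for g :: "real \<Rightarrow> real"
  proof -
    have "integrable M (\<lambda>\<omega>. g (Y \<omega>)) \<longleftrightarrow> integrable (distr M borel Y) g"
      by (rule integrable_distr_eq[symmetric]) (use that in auto)
    also have "\<dots> \<longleftrightarrow> integrable std_normal_distribution (\<lambda>x. g (\<mu> + \<sigma> * x))"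
      unfolding d by (rule integrable_distr_eq) (use that in auto)
    finally show ?thesis .
  qed
  have int_eq: "(\<integral>\<omega>. g (Y \<omega>) \<partial>M) = (\<integral>x. g (\<mu> + \<sigma> * x) \<partial>std_normal_distribution)"
    if "g \<in> borel_measurable borel" for g :: "real \<Rightarrow> 'z :: {banach, second_countable_topology}"
  proof -
    have "(\<integral>\<omega>. g (Y \<omega>) \<partial>M) = (\<integral>x. g x \<partial>distr M borel Y)"
      by (rule integral_distr[symmetric]) (use that in auto)
    also have "\<dots> = (\<integral>x. g (\<mu> + \<sigma> * x) \<partial>std_normal_distribution)"
      unfolding d by (rule integral_distr) (use that in auto)
    finally show ?thesis .
  qed
  have m1: "integrable std_normal_distribution (\<lambda>x. x)" "(\<integral>x. x \<partial>std_normal_distribution) = 0"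
    using integrable_std_normal_distribution_moment[of 1] integral_std_normal_distribution_moment_odd[of 1] by simp_all
  have m2: "integrable std_normal_distribution (\<lambda>x. x\<^sup>2)" "(\<integral>x. x\<^sup>2 \<partial>std_normal_distribution) = 1"
    using std_normal_distribution_even_moments[of 1] by simp_all
  have one: "(\<integral>x. c \<partial>std_normal_distribution) = c" for c :: real using N.prob_space by simp
  have sq: "(\<mu> + \<sigma> * x)\<^sup>2 = \<mu>\<^sup>2 + (2 * \<mu> * \<sigma>) * x + \<sigma>\<^sup>2 * x\<^sup>2" for x
    by (simp add: power2_eq_square algebra_simps)
  have lin: "integrable std_normal_distribution (\<lambda>x. \<mu> + \<sigma> * x)"
    by (intro Bochner_Integration.integrable_add integrable_mult_right m1 N.integrable_const)
  show "integrable M Y" by (rule int_iff[of "\<lambda>x. x", THEN iffD2, OF _ lin]) simp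
  have quad: "integrable std_normal_distribution (\<lambda>x. (\<mu> + \<sigma> * x)\<^sup>2)"
    unfolding sq by (intro Bochner_Integration.integrable_add integrable_mult_right m1 m2 N.integrable_const)
  show "integrable M (\<lambda>\<omega>. (Y \<omega>)\<^sup>2)" by (rule int_iff[of "\<lambda>x. x\<^sup>2", THEN iffD2, OF _ quad]) simp
  assume mean: "(\<integral>\<omega>. Y \<omega> \<partial>M) = 0"
  have "(\<integral>\<omega>. Y \<omega> \<partial>M) = (\<integral>x. \<mu> + \<sigma> * x \<partial>std_normal_distribution)" by (rule int_eq) simp
  also have "\<dots> = (\<integral>x. \<mu> \<partial>std_normal_distribution) + (\<integral>x. \<sigma> * x \<partial>std_normal_distribution)"
    by (intro Bochner_Integration.integral_add integrable_mult_right m1 N.integrable_const)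
  also have "\<dots> = \<mu>" using m1(2) by (simp only: one integral_mult_right_zero mult_zero_right add_0_right)
  finally have \<mu>: "\<mu> = 0" using mean by simp
  have "(\<integral>\<omega>. (Y \<omega>)\<^sup>2 \<partial>M) = (\<integral>x. (\<mu> + \<sigma> * x)\<^sup>2 \<partial>std_normal_distribution)" by (rule int_eq[of "\<lambda>x. x\<^sup>2"]) simp
  also have "\<dots> = (\<integral>x. \<sigma>\<^sup>2 * x\<^sup>2 \<partial>std_normal_distribution)" by (simp only: \<mu> add_0 power_mult_distrib)
  also have "\<dots> = \<sigma>\<^sup>2" by (simp only: integral_mult_right_zero m2(2) mult_1_right)
  finally have \<sigma>: "(\<integral>\<omega>. (Y \<omega>)\<^sup>2 \<partial>M) = \<sigma>\<^sup>2" .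
  have "(CLINT \<omega>|M. iexp (Y \<omega>)) = (CLINT x|std_normal_distribution. iexp (\<mu> + \<sigma> * x))" by (rule int_eq) simp
  also have "\<dots> = char std_normal_distribution \<sigma>" by (simp add: \<mu> char_def)
  also have "\<dots> = complex_of_real (exp (- \<sigma>\<^sup>2 / 2))" by (simp add: char_std_normal_distribution)
  finally show "(CLINT \<omega>|M. iexp (Y \<omega>)) = complex_of_real (exp (- (\<integral>\<omega>. (Y \<omega>)\<^sup>2 \<partial>M) / 2))"
    by (simp add: \<sigma>)
qed

lemma random_vec_component:
  assumes "random_vec M n Z" "i < n" shows "(\<lambda>\<omega>. Z \<omega> $ i) \<in> borel_measurable M"
proof -
  have "(\<lambda>\<omega>. coords n (Z \<omega>)) \<in> measurable M (coord_space n)" using assms by (simp add: random_vec_def)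
  moreover have "(\<lambda>x. x i) \<in> borel_measurable (coord_space n)"
    unfolding coord_space_def by (rule measurable_component_singleton) (use assms in simp)
  ultimately have "(\<lambda>\<omega>. coords n (Z \<omega>) i) \<in> borel_measurable M" by (rule measurable_compose)
  thus ?thesis using assms by (simp add: coords_def)
qed

lemma measurable_coord_form:
  "(\<lambda>x. Re (\<Sum>i<n. cnj (a i) * x i)) \<in> borel_measurable (coord_space n)"
proof -
  have "(\<lambda>x. x i) \<in> borel_measurable (coord_space n)" if "i < n" for i
    unfolding coord_space_def by (rule measurable_component_singleton) (use that in simp)
  hence "(\<lambda>x. \<Sum>i<n. cnj (a i) * x i) \<in> borel_measurable (coord_space n)"
    by (intro borel_measurable_sum borel_measurable_times) auto
  thus ?thesis by (rule measurable_compose) simp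
qed

text \<open>A real linear form $\mathrm{Re}\,W$ of the vector is centred normal, so that only its
variance is needed. By circular symmetry $\mathrm{Re}\,W$ and $\mathrm{Im}\,W$ have the same
second moment, and the two add up to $E|W|^2$, which the covariance matrix determines.\<close>

lemma complex_gaussian_char:
  assumes M: "prob_space M" and G: "complex_gaussian_vec M n Z" and sym: "circularly_symmetric M n Z"
    and mean: "mean_vec M n Z = 0\<^sub>v n" and cov: "covariance_mat M n Z = complex_of_real N0 \<cdot>\<^sub>m 1\<^sub>m n"
  shows "(CLINT \<omega>|M. iexp (Re (\<Sum>i<n. cnj (a i) * Z \<omega> $ i))) = complex_of_real (exp (- N0 * (\<Sum>i<n. (cmod (a i))\<^sup>2) / 4))"
proof -
  interpret M: prob_space M by fact
  have rv: "random_vec M n Z" using G by (simp add: complex_gaussian_vec_def)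
  have dim: "Z \<omega> \<in> carrier_vec n" if "\<omega> \<in> space M" for \<omega> using rv that by (auto simp: random_vec_def)
  have dimv: "dim_vec (Z \<omega>) = n" if "\<omega> \<in> space M" for \<omega> using dim[OF that] by simp
  note meas = random_vec_component[OF rv]
  define W where "W = (\<lambda>a \<omega>. \<Sum>i<n. cnj (a i) * Z \<omega> $ i)"
  have normal: "normal_rv M (\<lambda>\<omega>. Re (W a \<omega>))" for a
  proof -
    have "normal_rv M (\<lambda>\<omega>. \<Sum>i<n. Re (a i) * Re (Z \<omega> $ i) + Im (a i) * Im (Z \<omega> $ i))"
      using G unfolding complex_gaussian_vec_def by (elim conjE allE)
    thus ?thesis by (simp add: W_def)
  qed
  \<comment> \<open>The imaginary part is again a real linear form.\<close>
  have ImW: "Im (W a \<omega>) = Re (W (\<lambda>i. \<i> * a i) \<omega>)" for a \<omega>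
    by (simp add: W_def)
  have comp: "integrable M (\<lambda>\<omega>. Z \<omega> $ i)" "integrable M (\<lambda>\<omega>. (cmod (Z \<omega> $ i))\<^sup>2)" if i: "i < n" for i
  proof -
    have W1: "W (\<lambda>k. if k = i then 1 else 0) \<omega> = Z \<omega> $ i" for \<omega>
    proof -
      have "W (\<lambda>k. if k = i then 1 else 0) \<omega> = (\<Sum>k<n. if k = i then Z \<omega> $ k else 0)"
        unfolding W_def by (intro sum.cong) auto
      thus ?thesis using i by simp
    qed
    have W2: "Re (W (\<lambda>k. \<i> * (if k = i then 1 else 0)) \<omega>) = Im (Z \<omega> $ i)" for \<omega>
      using ImW[of "\<lambda>k. if k = i then 1 else 0" \<omega>] by (simp add: W1)
    have r: "normal_rv M (\<lambda>\<omega>. Re (Z \<omega> $ i))" "normal_rv M (\<lambda>\<omega>. Im (Z \<omega> $ i))"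
      using normal[of "\<lambda>k. if k = i then 1 else 0"] normal[of "\<lambda>k. \<i> * (if k = i then 1 else 0)"]
      unfolding W1 W2 by simp_all
    have "integrable M (\<lambda>\<omega>. complex_of_real (Re (Z \<omega> $ i)) + \<i> * complex_of_real (Im (Z \<omega> $ i)))"
      using normal_rv_moments(1)[OF M r(1)] normal_rv_moments(1)[OF M r(2)]
      by (intro Bochner_Integration.integrable_add integrable_mult_right integrable_of_real)
    also have "(\<lambda>\<omega>. complex_of_real (Re (Z \<omega> $ i)) + \<i> * complex_of_real (Im (Z \<omega> $ i))) = (\<lambda>\<omega>. Z \<omega> $ i)"
      by (simp add: fun_eq_iff complex_eq_iff)
    finally show "integrable M (\<lambda>\<omega>. Z \<omega> $ i)" .
    show "integrable M (\<lambda>\<omega>. (cmod (Z \<omega> $ i))\<^sup>2)"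
      unfolding cmod_power2
      using normal_rv_moments(2)[OF M r(1)] normal_rv_moments(2)[OF M r(2)] by simp
  qed
  have mean0: "(\<integral>\<omega>. Z \<omega> $ i \<partial>M) = 0" if "i < n" for i
  proof -
    have "mean_vec M n Z $ i = (\<integral>\<omega>. Z \<omega> $ i \<partial>M)" using that by (simp add: mean_vec_def)
    thus ?thesis using mean that by simp
  qed
  have prod_int: "integrable M (\<lambda>\<omega>. Z \<omega> $ i * cnj (Z \<omega> $ k))" if "i < n" "k < n" for i k
  proof (rule Bochner_Integration.integrable_bound)
    show "integrable M (\<lambda>\<omega>. (cmod (Z \<omega> $ i))\<^sup>2 + (cmod (Z \<omega> $ k))\<^sup>2)"
      by (intro Bochner_Integration.integrable_add comp that)
    have "(\<lambda>\<omega>. cnj (Z \<omega> $ k)) \<in> borel_measurable M"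
      by (rule borel_measurable_continuous_on[OF _ meas]) (auto intro!: continuous_intros that)
    thus "(\<lambda>\<omega>. Z \<omega> $ i * cnj (Z \<omega> $ k)) \<in> borel_measurable M"
      by (intro borel_measurable_times meas that)
    show "AE \<omega> in M. norm (Z \<omega> $ i * cnj (Z \<omega> $ k)) \<le> norm ((cmod (Z \<omega> $ i))\<^sup>2 + (cmod (Z \<omega> $ k))\<^sup>2)"
    proof (rule AE_I2)
      fix \<omega>
      have "x * y \<le> x\<^sup>2 + y\<^sup>2" if "x \<ge> 0" "y \<ge> 0" for x y :: real
      proof -
        have "2 * (x * y) \<le> x\<^sup>2 + y\<^sup>2" using sum_squares_bound[of x y] by (simp add: mult.assoc)
        moreover have "0 \<le> x * y" using that by simp
        ultimately show ?thesis by linarith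
      qed
      thus "norm (Z \<omega> $ i * cnj (Z \<omega> $ k)) \<le> norm ((cmod (Z \<omega> $ i))\<^sup>2 + (cmod (Z \<omega> $ k))\<^sup>2)"
        by (simp add: norm_mult)
    qed
  qed
  have cov0: "(\<integral>\<omega>. Z \<omega> $ i * cnj (Z \<omega> $ k) \<partial>M) = (if i = k then complex_of_real N0 else 0)" if "i < n" "k < n" for i k
  proof -
    have "covariance_mat M n Z $$ (i, k) = (\<integral>\<omega>. Z \<omega> $ i * cnj (Z \<omega> $ k) \<partial>M)"
      using that by (simp add: covariance_mat_def mean)
    moreover have "covariance_mat M n Z $$ (i, k) = complex_of_real N0 * (if i = k then 1 else 0)"
      unfolding cov using that by simp
    ultimately show ?thesis by (cases "i = k") simp_all
  qed
  have W2: "(\<integral>\<omega>. (Re (W a \<omega>))\<^sup>2 \<partial>M) + (\<integral>\<omega>. (Im (W a \<omega>))\<^sup>2 \<partial>M) = N0 * (\<Sum>i<n. (cmod (a i))\<^sup>2)"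
  proof -
    have "complex_of_real ((\<integral>\<omega>. (Re (W a \<omega>))\<^sup>2 \<partial>M) + (\<integral>\<omega>. (Im (W a \<omega>))\<^sup>2 \<partial>M)) =
          complex_of_real (\<integral>\<omega>. (Re (W a \<omega>))\<^sup>2 + (Im (W a \<omega>))\<^sup>2 \<partial>M)"
      unfolding ImW by (subst Bochner_Integration.integral_add) (auto intro!: normal_rv_moments(2)[OF M normal])
    also have "\<dots> = (\<integral>\<omega>. W a \<omega> * cnj (W a \<omega>) \<partial>M)"
    proof -
      have "W a \<omega> * cnj (W a \<omega>) = complex_of_real ((Re (W a \<omega>))\<^sup>2 + (Im (W a \<omega>))\<^sup>2)" for \<omega>
        by (simp only: complex_norm_square[symmetric] cmod_power2)
      thus ?thesis by (simp only: integral_complex_of_real)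
    qed
    also have "\<dots> = (\<integral>\<omega>. (\<Sum>i<n. \<Sum>k<n. cnj (a i) * a k * (Z \<omega> $ i * cnj (Z \<omega> $ k))) \<partial>M)"
    proof -
      have "W a \<omega> * cnj (W a \<omega>) = (\<Sum>i<n. \<Sum>k<n. cnj (a i) * a k * (Z \<omega> $ i * cnj (Z \<omega> $ k)))" for \<omega>
        unfolding W_def cnj_sum sum_product by (intro sum.cong refl) simp
      thus ?thesis by (simp only:)
    qed
    also have "\<dots> = (\<Sum>i<n. \<Sum>k<n. cnj (a i) * a k * (\<integral>\<omega>. Z \<omega> $ i * cnj (Z \<omega> $ k) \<partial>M))"
    proof -
      have i1: "integrable M (\<lambda>\<omega>. cnj (a i) * a k * (Z \<omega> $ i * cnj (Z \<omega> $ k)))" if "i \<in> {..<n}" "k \<in> {..<n}" for i k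
        by (intro integrable_mult_right prod_int) (use that in auto)
      have "(\<integral>\<omega>. (\<Sum>i<n. \<Sum>k<n. cnj (a i) * a k * (Z \<omega> $ i * cnj (Z \<omega> $ k))) \<partial>M) =
            (\<Sum>i<n. \<integral>\<omega>. (\<Sum>k<n. cnj (a i) * a k * (Z \<omega> $ i * cnj (Z \<omega> $ k))) \<partial>M)"
        by (rule Bochner_Integration.integral_sum) (intro Bochner_Integration.integrable_sum i1)
      also have "\<dots> = (\<Sum>i<n. \<Sum>k<n. \<integral>\<omega>. cnj (a i) * a k * (Z \<omega> $ i * cnj (Z \<omega> $ k)) \<partial>M)"
        by (intro sum.cong refl Bochner_Integration.integral_sum i1)
      finally show ?thesis by (simp only: integral_mult_right_zero)
    qed
    also have "\<dots> = (\<Sum>i<n. \<Sum>k<n. if k = i then cnj (a i) * a i * complex_of_real N0 else 0)"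
      by (intro sum.cong refl) (simp add: cov0)
    also have "\<dots> = (\<Sum>i<n. complex_of_real N0 * (a i * cnj (a i)))"
      by (intro sum.cong refl) simp
    also have "\<dots> = complex_of_real (N0 * (\<Sum>i<n. (cmod (a i))\<^sup>2))"
      by (simp only: of_real_mult of_real_sum complex_norm_square sum_distrib_left)
    finally show ?thesis by (simp only: of_real_eq_iff)
  qed
  have ReIm: "(\<integral>\<omega>. (Re (W a \<omega>))\<^sup>2 \<partial>M) = (\<integral>\<omega>. (Im (W a \<omega>))\<^sup>2 \<partial>M)"
  proof -
    define g where "g = (\<lambda>x. (Re (\<Sum>i<n. cnj (a i) * x i))\<^sup>2)"
    have g [measurable]: "g \<in> borel_measurable (coord_space n)"
      unfolding g_def by (intro borel_measurable_power measurable_coord_form)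
    have c1: "(\<lambda>\<omega>. coords n (Z \<omega>)) \<in> measurable M (coord_space n)" using rv by (simp add: random_vec_def)
    \<comment> \<open>The rotation by $\pi/2$ exchanges real and imaginary part up to a sign.\<close>
    have c2: "(\<lambda>\<omega>. coords n (cis (pi / 2) \<cdot>\<^sub>v Z \<omega>)) \<in> measurable M (coord_space n)"
    proof -
      have "(\<lambda>\<omega>. \<lambda>i\<in>{..<n}. cis (pi / 2) * Z \<omega> $ i) \<in> measurable M (coord_space n)"
        unfolding coord_space_def by (intro measurable_restrict borel_measurable_times borel_measurable_const meas) auto
      also have "?this \<longleftrightarrow> ?thesis"
        by (rule measurable_cong) (use dimv in \<open>auto simp: coords_def fun_eq_iff restrict_def\<close>)
      finally show ?thesis .
    qed
    have "(\<integral>\<omega>. (Re (W a \<omega>))\<^sup>2 \<partial>M) = (\<integral>\<omega>. g (coords n (Z \<omega>)) \<partial>M)"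
      by (simp add: g_def W_def coords_def)
    also have "\<dots> = (\<integral>x. g x \<partial>distr M (coord_space n) (\<lambda>\<omega>. coords n (Z \<omega>)))"
      by (rule integral_distr[symmetric, OF c1 g])
    also have "\<dots> = (\<integral>x. g x \<partial>distr M (coord_space n) (\<lambda>\<omega>. coords n (cis (pi / 2) \<cdot>\<^sub>v Z \<omega>)))"
      using sym by (simp only: circularly_symmetric_def)
    also have "\<dots> = (\<integral>\<omega>. g (coords n (cis (pi / 2) \<cdot>\<^sub>v Z \<omega>)) \<partial>M)" by (rule integral_distr[OF c2 g])
    also have "\<dots> = (\<integral>\<omega>. (Im (W a \<omega>))\<^sup>2 \<partial>M)"
    proof (rule Bochner_Integration.integral_cong[OF refl])
      fix \<omega> assume "\<omega> \<in> space M"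
      hence "(\<Sum>i<n. cnj (a i) * coords n (cis (pi / 2) \<cdot>\<^sub>v Z \<omega>) i) = \<i> * W a \<omega>"
        unfolding W_def sum_distrib_left using dimv by (intro sum.cong) (auto simp: coords_def mult_ac)
      hence "g (coords n (cis (pi / 2) \<cdot>\<^sub>v Z \<omega>)) = (Re (\<i> * W a \<omega>))\<^sup>2" by (simp only: g_def)
      thus "g (coords n (cis (pi / 2) \<cdot>\<^sub>v Z \<omega>)) = (Im (W a \<omega>))\<^sup>2" by simp
    qed
    finally show ?thesis .
  qed
  have "(\<integral>\<omega>. W a \<omega> \<partial>M) = 0"
    using comp mean0 by (simp add: W_def Bochner_Integration.integral_sum)
  moreover have "integrable M (W a)"
    unfolding W_def by (intro Bochner_Integration.integrable_sum integrable_mult_right comp) auto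
  ultimately have "(\<integral>\<omega>. Re (W a \<omega>) \<partial>M) = 0" by (simp add: integral_Re)
  from normal_rv_moments(3)[OF M normal this]
  have "(CLINT \<omega>|M. iexp (Re (W a \<omega>))) = complex_of_real (exp (- (\<integral>\<omega>. (Re (W a \<omega>))\<^sup>2 \<partial>M) / 2))" .
  also have "(\<integral>\<omega>. (Re (W a \<omega>))\<^sup>2 \<partial>M) = N0 * (\<Sum>i<n. (cmod (a i))\<^sup>2) / 2"
    using W2 ReIm by simp
  finally show ?thesis by (simp add: W_def)
qed

text \<open>The characteristic function of all entries is a product over the independent columns.\<close>

theorem gaussian_matrix_distr:
  assumes G: "gaussian_matrix M n m N0 X" and N0: "N0 > 0"
  shows "distr M (PiM ({..<n} \<times> {..<m}) (\<lambda>_. borel)) (\<lambda>\<omega>. \<lambda>ij\<in>{..<n} \<times> {..<m}. X \<omega> $$ ij / complex_of_real (sqrt N0)) =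
         cgaussM ({..<n} \<times> {..<m})"
proof -
  have M: "prob_space M" and dim: "\<And>\<omega>. \<omega> \<in> space M \<Longrightarrow> X \<omega> \<in> carrier_mat n m"
    and ind: "prob_space.indep_vars M (\<lambda>_. coord_space n) (\<lambda>j \<omega>. coords n (col (X \<omega>) j)) {..<m}"
    using G by (auto simp: gaussian_matrix_def)
  interpret M: prob_space M by fact
  have colX: "col (X \<omega>) j $ i = X \<omega> $$ (i, j)" if "\<omega> \<in> space M" "i < n" "j < m" for \<omega> i j
    using dim[OF that(1)] that by auto
  have cols: "complex_gaussian_vec M n (\<lambda>\<omega>. col (X \<omega>) j)" "circularly_symmetric M n (\<lambda>\<omega>. col (X \<omega>) j)"
     "mean_vec M n (\<lambda>\<omega>. col (X \<omega>) j) = 0\<^sub>v n"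
     "covariance_mat M n (\<lambda>\<omega>. col (X \<omega>) j) = complex_of_real N0 \<cdot>\<^sub>m 1\<^sub>m n" if "j < m" for j
    using G that by (auto simp: gaussian_matrix_def)
  define r where "r = complex_of_real (sqrt N0)"
  have rr: "cnj r = r" "(cmod r)\<^sup>2 = N0" using N0 by (simp_all add: r_def)
  show ?thesis unfolding r_def[symmetric]
  proof (rule distr_eq_cgaussM[OF _ M])
    fix ij assume "ij \<in> {..<n} \<times> {..<m}"
    then obtain i j where ij: "ij = (i, j)" "i < n" "j < m" by auto
    have "(\<lambda>\<omega>. col (X \<omega>) j $ i) \<in> borel_measurable M"
      by (rule random_vec_component[of M n]) (use cols(1)[OF ij(3)] ij in \<open>auto simp: complex_gaussian_vec_def\<close>)
    also have "?this \<longleftrightarrow> (\<lambda>\<omega>. X \<omega> $$ ij) \<in> borel_measurable M"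
      by (rule measurable_cong) (simp add: colX ij)
    finally show "(\<lambda>\<omega>. X \<omega> $$ ij / r) \<in> borel_measurable M" by measurable
  next
    fix a :: "nat \<times> nat \<Rightarrow> complex"
    define h where "h = (\<lambda>j x. iexp (Re (\<Sum>i<n. cnj (a (i, j) / r) * x i)))"
    have h: "h j \<in> borel_measurable (coord_space n)" for j
      unfolding h_def by (rule measurable_compose[OF measurable_coord_form]) simp
    have "M.indep_vars (\<lambda>_. borel) (\<lambda>j \<omega>. h j (coords n (col (X \<omega>) j))) {..<m}"
      by (rule M.indep_vars_compose2[OF ind]) (rule h)
    moreover have hint: "integrable M (\<lambda>\<omega>. h j (coords n (col (X \<omega>) j)))" if "j \<in> {..<m}" for j
    proof (rule M.integrable_const_bound[where B = 1])
      have "(\<lambda>\<omega>. coords n (col (X \<omega>) j)) \<in> measurable M (coord_space n)"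
        using cols(1)[of j] that by (auto simp: complex_gaussian_vec_def random_vec_def)
      from measurable_compose[OF this h] show "(\<lambda>\<omega>. h j (coords n (col (X \<omega>) j))) \<in> borel_measurable M" .
    qed (simp add: h_def)
    ultimately have "(CLINT \<omega>|M. (\<Prod>j<m. h j (coords n (col (X \<omega>) j)))) = (\<Prod>j<m. CLINT \<omega>|M. h j (coords n (col (X \<omega>) j)))"
      by (intro M.indep_vars_lebesgue_integral) auto
    also have "\<dots> = (\<Prod>j<m. complex_of_real (exp (- N0 * (\<Sum>i<n. (cmod (a (i, j) / r))\<^sup>2) / 4)))"
    proof (rule prod.cong[OF refl])
      fix j assume "j \<in> {..<m}"
      hence j: "j < m" by simp
      show "(CLINT \<omega>|M. h j (coords n (col (X \<omega>) j))) = complex_of_real (exp (- N0 * (\<Sum>i<n. (cmod (a (i, j) / r))\<^sup>2) / 4))"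
        using complex_gaussian_char[OF M cols[OF j], of "\<lambda>i. a (i, j) / r"] by (simp add: h_def coords_def)
    qed
    also have "\<dots> = complex_of_real (exp (- (\<Sum>ij\<in>{..<n} \<times> {..<m}. (cmod (a ij))\<^sup>2) / 4))"
    proof -
      have "- N0 * (\<Sum>i<n. (cmod (a (i, j) / r))\<^sup>2) / 4 = - (\<Sum>i<n. (cmod (a (i, j)))\<^sup>2) / 4" for j
      proof -
        have "(\<Sum>i<n. (cmod (a (i, j) / r))\<^sup>2) = (\<Sum>i<n. (cmod (a (i, j)))\<^sup>2) / N0"
          by (simp only: norm_divide power_divide rr sum_divide_distrib)
        thus ?thesis using N0 by simp
      qed
      hence "(\<Prod>j<m. complex_of_real (exp (- N0 * (\<Sum>i<n. (cmod (a (i, j) / r))\<^sup>2) / 4))) =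
         complex_of_real (exp (\<Sum>j<m. - (\<Sum>i<n. (cmod (a (i, j)))\<^sup>2) / 4))"
        by (simp only: of_real_prod[symmetric] exp_sum[OF finite_lessThan, symmetric])
      also have "(\<Sum>j<m. - (\<Sum>i<n. (cmod (a (i, j)))\<^sup>2) / 4) = - (\<Sum>j<m. \<Sum>i<n. (cmod (a (i, j)))\<^sup>2) / 4"
        by (simp only: sum_divide_distrib[symmetric] sum_negf)
      also have "(\<Sum>j<m. \<Sum>i<n. (cmod (a (i, j)))\<^sup>2) = (\<Sum>ij\<in>{..<n} \<times> {..<m}. (cmod (a ij))\<^sup>2)"
        by (subst sum.swap) (simp add: sum.cartesian_product case_prod_beta)
      finally show ?thesis .
    qed
    finally have main: "(CLINT \<omega>|M. (\<Prod>j<m. h j (coords n (col (X \<omega>) j)))) =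
        complex_of_real (exp (- (\<Sum>ij\<in>{..<n} \<times> {..<m}. (cmod (a ij))\<^sup>2) / 4))" .
    have "(CLINT \<omega>|M. iexp (\<Sum>ij\<in>{..<n} \<times> {..<m}. Re (cnj (a ij) * (X \<omega> $$ ij / r)))) =
          (CLINT \<omega>|M. (\<Prod>j<m. h j (coords n (col (X \<omega>) j))))"
    proof (rule Bochner_Integration.integral_cong[OF refl])
      fix \<omega> assume \<omega>: "\<omega> \<in> space M"
      have "(\<Sum>ij\<in>{..<n} \<times> {..<m}. Re (cnj (a ij) * (X \<omega> $$ ij / r))) =
            (\<Sum>i<n. \<Sum>j<m. Re (cnj (a (i, j)) * (X \<omega> $$ (i, j) / r)))"
        by (simp add: sum.cartesian_product case_prod_beta)
      also have "\<dots> = (\<Sum>j<m. \<Sum>i<n. Re (cnj (a (i, j)) * (X \<omega> $$ (i, j) / r)))" by (rule sum.swap)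
      also have "\<dots> = (\<Sum>j<m. Re (\<Sum>i<n. cnj (a (i, j) / r) * coords n (col (X \<omega>) j) i))"
        unfolding Re_sum using \<omega> by (intro sum.cong refl) (simp add: coords_def colX rr)
      finally show "iexp (\<Sum>ij\<in>{..<n} \<times> {..<m}. Re (cnj (a ij) * (X \<omega> $$ ij / r))) = (\<Prod>j<m. h j (coords n (col (X \<omega>) j)))"
        by (simp only: h_def of_real_sum sum_distrib_left exp_sum[OF finite_lessThan])
    qed
    with main show "(CLINT \<omega>|M. iexp (\<Sum>ij\<in>{..<n} \<times> {..<m}. Re (cnj (a ij) * (X \<omega> $$ ij / r)))) =
        complex_of_real (exp (- (\<Sum>ij\<in>{..<n} \<times> {..<m}. (cmod (a ij))\<^sup>2) / 4))" by simp
  qed simp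
qed

section \<open>Moments of the statistic\<close>

lemma mult_mat_adjoint_index:
  assumes A: "A \<in> carrier_mat n m" and i: "i < n" and k: "k < n"
  shows "(A * mat_adjoint A) $$ (i, k) = (\<Sum>j<m. A $$ (i, j) * cnj (A $$ (k, j)))"
proof -
  have dim: "dim_row (mat_adjoint A) = m" "dim_col (mat_adjoint A) = n"
    using A by (auto simp: mat_adjoint_def)
  have "mat_adjoint A $$ (j, k) = cnj (A $$ (k, j))" if "j < m" for j
    using A k that by (simp add: mat_adjoint_def mat_of_rows_index)
  thus ?thesis using A i k dim by (simp add: scalar_prod_def atLeast0LessThan)
qed

text \<open>The factor $N_0$ cancels between trace and determinant. On singular matrices both sides
are $0$, by the conventions for division by $0$ and for powers of $0$.\<close>

lemma W0_scaled:
  assumes A: "A \<in> carrier_mat n m" and n: "n > 0" and N0: "N0 > 0" and nm: "n \<le> m" and p: "p \<ge> 1"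
    and f: "\<And>i j. i < n \<Longrightarrow> j < m \<Longrightarrow> f (i, j) = A $$ (i, j) / complex_of_real (sqrt N0)"
  shows "W0 A ^ p = 1 / real n ^ p * (gram_det n m f powr (- (real p / real n)) * sq_norm_on ({..<n} \<times> {..<m}) f ^ p)"
proof -
  define S where "S = A * mat_adjoint A"
  have dim: "S \<in> carrier_mat n n" using A by (auto simp: S_def mat_adjoint_def)
  define D where "D = gram_det n m f"
  define T where "T = sq_norm_on ({..<n} \<times> {..<m}) f"
  have Af: "A $$ (i, j) = complex_of_real (sqrt N0) * f (i, j)" if "i < n" "j < m" for i j
    using f[OF that] N0 by simp
  have N0sq: "complex_of_real (sqrt N0) * complex_of_real (sqrt N0) = complex_of_real N0"
    using N0 by (simp flip: of_real_mult)
  have Sik: "S $$ (i, k) = complex_of_real N0 * (\<Sum>j<m. f (i, j) * cnj (f (k, j)))" if "i < n" "k < n" for i k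
  proof -
    have "S $$ (i, k) = (\<Sum>j<m. (complex_of_real (sqrt N0) * complex_of_real (sqrt N0)) * (f (i, j) * cnj (f (k, j))))"
      unfolding S_def mult_mat_adjoint_index[OF A that]
      using that by (intro sum.cong refl) (simp add: Af mult_ac)
    thus ?thesis unfolding N0sq by (simp only: sum_distrib_left)
  qed
  have S: "S = complex_of_real N0 \<cdot>\<^sub>m gram_mat n m f"
    by (rule eq_matI) (use dim Sik in \<open>auto simp: gram_mat_def\<close>)
  have det: "Re (det S) = N0 ^ n * D"
  proof -
    have "det S = complex_of_real (N0 ^ n) * det (gram_mat n m f)"
      unfolding S by (simp add: gram_mat_def)
    thus ?thesis by (simp add: D_def gram_det_def del: of_real_power)
  qed
  have tr: "Re (mat_trace S) = N0 * T"
  proof -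
    have "mat_trace S = (\<Sum>i<n. complex_of_real N0 * complex_of_real (\<Sum>j<m. (cmod (f (i, j)))\<^sup>2))"
      unfolding mat_trace_def using dim by (intro sum.cong) (auto simp: Sik complex_norm_square simp del: of_real_power)
    also have "\<dots> = complex_of_real (N0 * T)"
      by (simp only: T_def sq_norm_on_rows of_real_mult of_real_sum sum_distrib_left)
    finally show ?thesis by simp
  qed
  have "D \<ge> 0" unfolding D_def by (rule gram_det_nonneg[OF nm])
  have dA: "dim_row A = n" using A by simp
  have "W0 A = (1 / real n * (N0 * T)) / root n (N0 ^ n * D)"
    unfolding W0_def Let_def dA S_def[symmetric] det tr ..
  also have "root n (N0 ^ n * D) = N0 * root n D"
    using n N0 by (simp add: real_root_mult real_root_power_cancel)
  finally have W: "W0 A = 1 / real n * (T / root n D)" using N0 by simp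
  have "root n D powr real p = D powr (real p / real n)" if "D > 0"
    using that n by (simp add: root_powr_inverse powr_powr field_simps)
  hence "(T / root n D) ^ p = D powr (- (real p / real n)) * T ^ p"
    using \<open>D \<ge> 0\<close> p n
    by (cases "D = 0") (auto simp: power_divide powr_minus powr_realpow[symmetric] field_simps)
  thus ?thesis unfolding W power_mult_distrib D_def T_def by (simp add: power_one_over)
qed

text \<open>The condition on $p$ says that $p/n < m-n+1$, which makes the $p/n$th negative moment of the
determinant finite.\<close>

theorem moment_W0:
  assumes G: "gaussian_matrix M n m N0 X" and N0: "N0 > 0" and n: "n > 0" and nm: "n \<le> m"
    and p: "p \<ge> 1" "p < n * (m - n + 1)"
  shows "moment M (\<lambda>\<omega>. W0 (X \<omega>)) p = 1 / real n ^ p *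
     ((\<Prod>k<n. Gamma (real m - real k - real p / real n) / Gamma (real m - real k)) *
      pochhammer (real n * (real m - real p / real n)) p)"
proof -
  define s where "s = real p / real n"
  define I where "I = {..<n} \<times> {..<m}"
  define C where "C = (\<Prod>k<n. Gamma (real m - real k - s) / Gamma (real m - real k))"
  have "real p < real (n * (m - n + 1))" using p(2) by (simp only: of_nat_less_iff)
  also have "\<dots> = real n * (real m - real n + 1)" using nm by (simp only: of_nat_mult of_nat_add of_nat_diff of_nat_1)
  finally have s: "s < real m - real n + 1" using n by (simp add: s_def field_simps)
  have M: "prob_space M" and dim: "\<And>\<omega>. \<omega> \<in> space M \<Longrightarrow> X \<omega> \<in> carrier_mat n m"
    using G by (auto simp: gaussian_matrix_def)
  define f where "f = (\<lambda>\<omega>. \<lambda>ij\<in>I. X \<omega> $$ ij / complex_of_real (sqrt N0))"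
  define g where "g = (\<lambda>x. gram_det n m x powr (- s) * sq_norm_on I x ^ p)"
  have distr: "distr M (PiM I (\<lambda>_. borel)) f = cgaussM I"
    unfolding I_def f_def by (rule gaussian_matrix_distr[OF G N0])
  have fm: "f \<in> measurable M (PiM I (\<lambda>_. borel))"
    unfolding f_def
  proof (intro measurable_restrict)
    fix ij assume "ij \<in> I"
    then obtain i j where ij: "ij = (i, j)" "i < n" "j < m" by (auto simp: I_def)
    have "(\<lambda>\<omega>. col (X \<omega>) j $ i) \<in> borel_measurable M"
      by (rule random_vec_component[of M n]) (use G ij in \<open>auto simp: gaussian_matrix_def complex_gaussian_vec_def\<close>)
    also have "?this \<longleftrightarrow> (\<lambda>\<omega>. X \<omega> $$ ij) \<in> borel_measurable M"
    proof (rule measurable_cong)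
      fix \<omega> assume "\<omega> \<in> space M"
      thus "col (X \<omega>) j $ i = X \<omega> $$ ij" using dim[of \<omega>] ij by auto
    qed
    finally show "(\<lambda>\<omega>. X \<omega> $$ ij / complex_of_real (sqrt N0)) \<in> borel_measurable M" by measurable
  qed
  have gm: "g \<in> borel_measurable (cgaussM I)"
  proof -
    have [measurable]: "gram_det n m \<in> borel_measurable (cgaussM I)" "sq_norm_on I \<in> borel_measurable (cgaussM I)"
      by (auto intro!: measurable_gram_det measurable_sq_norm_on simp: I_def)
    show ?thesis unfolding g_def by measurable
  qed
  hence gm': "g \<in> borel_measurable (PiM I (\<lambda>_. borel))"
    by (simp add: measurable_cong_sets[OF sets_cgaussM refl])
  have gn: "g x \<ge> 0" for x by (simp add: g_def sq_norm_on_nonneg)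
  have pos: "C * pochhammer (real n * (real m - s)) p \<ge> 0"
  proof (intro mult_nonneg_nonneg)
    show "C \<ge> 0" unfolding C_def
      using s nm by (intro prod_nonneg divide_nonneg_nonneg) (auto intro!: Gamma_real_nonneg)
    have "real n \<ge> 1" using n by simp
    hence "real m - s > 0" using s by linarith
    thus "pochhammer (real n * (real m - s)) p \<ge> 0" using n by (intro pochhammer_nonneg) simp
  qed
  have "moment M (\<lambda>\<omega>. W0 (X \<omega>)) p = (\<integral>\<omega>. 1 / real n ^ p * g (f \<omega>) \<partial>M)"
    unfolding moment_def
  proof (rule Bochner_Integration.integral_cong[OF refl])
    fix \<omega> assume \<omega>: "\<omega> \<in> space M"
    show "W0 (X \<omega>) ^ p = 1 / real n ^ p * g (f \<omega>)"
      unfolding g_def s_def I_def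
      by (rule W0_scaled[OF dim[OF \<omega>] n N0 nm p(1)]) (auto simp: f_def I_def)
  qed
  also have "\<dots> = 1 / real n ^ p * (\<integral>\<omega>. g (f \<omega>) \<partial>M)" by simp
  also have "(\<integral>\<omega>. g (f \<omega>) \<partial>M) = (\<integral>x. g x \<partial>cgaussM I)"
    using integral_distr[OF fm gm'] by (simp add: distr)
  also have "\<dots> = enn2real (\<integral>\<^sup>+x. ennreal (g x) \<partial>cgaussM I)"
    by (rule integral_eq_nn_integral[OF gm]) (simp add: gn)
  also have "(\<integral>\<^sup>+x. ennreal (g x) \<partial>cgaussM I) = ennreal (C * pochhammer (real n * (real m - s)) p)"
    using gamma_moments_gram_det[OF nm s] unfolding gamma_moments_def g_def I_def C_def by simp
  also have "enn2real \<dots> = C * pochhammer (real n * (real m - s)) p" using pos by simp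
  finally show ?thesis by (simp only: C_def s_def)
qed

text \<open>The rising factorial $(nm-p)_p$ is the product of $nm-j$ over $1 \le j \le p$, and
$nm = n^2/c$.\<close>

lemma moment_W0_eq_exp_log_moment:
  assumes G: "gaussian_matrix M n m N0 X" and N0: "N0 > 0" and n: "n > 0" and m: "m > 0" and c: "0 < c" "c < 1"
    and nm: "real n / real m = c" and p: "p \<ge> 1" "p < n * (m - n + 1)"
  shows "moment M (\<lambda>\<omega>. W0 (X \<omega>)) p = exp (log_moment c n p)"
proof -
  define s where "s = real p / real n"
  have mc: "real n / c = real m" using nm n m c by (auto simp: field_simps)
  have "real n < real m" using nm c m by (simp add: field_simps)
  hence le: "n \<le> m" by simp
  have "real p < real (n * (m - n + 1))" using p(2) by (simp only: of_nat_less_iff)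
  also have "\<dots> = real n * (real m - real n + 1)" using le by (simp only: of_nat_mult of_nat_add of_nat_diff of_nat_1)
  finally have pn: "real p < real n * (real m - real n + 1)" .
  hence s: "s < real m - real n + 1" using n by (simp add: s_def field_simps)
  have args: "real m - real k - s > 0" "real m - real k > 0" if "k < n" for k
  proof -
    have "real k + 1 \<le> real n" using that by simp
    thus "real m - real k - s > 0" "real m - real k > 0" using s le by linarith+
  qed
  have gammas: "(\<Prod>k<n. Gamma (real m - real k - s) / Gamma (real m - real k)) =
      exp (\<Sum>k<n. ln_Gamma (real m - s - real k) - ln_Gamma (real m - real k))"
  proof -
    have "Gamma (real m - real k - s) / Gamma (real m - real k) =
       exp (ln_Gamma (real m - s - real k) - ln_Gamma (real m - real k))" if "k < n" for k
      using args[OF that] by (simp add: exp_diff Gamma_real_pos_exp algebra_simps)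
    thus ?thesis by (simp add: exp_sum)
  qed
  have small: "c * real j / (real n)\<^sup>2 < 1" if "j \<in> {1..p}" for j
  proof -
    have "real j \<le> real p" using that by simp
    also have "real p < real n * real m"
    proof -
      have "real n * (real m - real n + 1) \<le> real n * real m" using n by (intro mult_left_mono) auto
      thus ?thesis using pn by linarith
    qed
    finally have "real j < real n * real m" .
    moreover have "real m = real n / c" using mc by simp
    ultimately show ?thesis using n c by (simp add: field_simps power2_eq_square)
  qed
  have nm2: "real n * (real m - s) = real n * real m - real p" using n by (simp add: s_def algebra_simps)
  have "pochhammer (real n * real m - real p) p = (\<Prod>j=1..p. real n * real m - real j)"
    unfolding pochhammer_prod
    by (rule prod.reindex_bij_witness[of _ "\<lambda>j. p - j" "\<lambda>i. p - i"]) (auto simp: of_nat_diff)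
  also have "\<dots> = (\<Prod>j=1..p. real n * real m * (1 - c * real j / (real n)\<^sup>2))"
    using n c by (intro prod.cong refl) (simp add: mc[symmetric] field_simps power2_eq_square)
  also have "\<dots> = (real n * real m) ^ p * (\<Prod>j=1..p. 1 - c * real j / (real n)\<^sup>2)"
    by (simp add: prod.distrib)
  also have "(\<Prod>j=1..p. 1 - c * real j / (real n)\<^sup>2) = exp (\<Sum>j=1..p. ln (1 - c * real j / (real n)\<^sup>2))"
    using small by (simp add: exp_sum)
  finally have poch: "1 / real n ^ p * pochhammer (real n * (real m - s)) p =
      real m ^ p * exp (\<Sum>j=1..p. ln (1 - c * real j / (real n)\<^sup>2))"
    unfolding nm2 using n by (simp add: power_mult_distrib)
  have "real m ^ p = exp (real p * ln (real m))" using m by (simp add: exp_of_nat_mult)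
  with poch have poch': "1 / real n ^ p * pochhammer (real n * (real m - s)) p =
      exp (real p * ln (real m)) * exp (\<Sum>j=1..p. ln (1 - c * real j / (real n)\<^sup>2))" by simp
  have "moment M (\<lambda>\<omega>. W0 (X \<omega>)) p = 1 / real n ^ p *
     ((\<Prod>k<n. Gamma (real m - real k - s) / Gamma (real m - real k)) * pochhammer (real n * (real m - s)) p)"
    unfolding s_def by (rule moment_W0[OF G N0 n le p])
  also have "\<dots> = (1 / real n ^ p * pochhammer (real n * (real m - s)) p) *
      (\<Prod>k<n. Gamma (real m - real k - s) / Gamma (real m - real k))" by simp
  also have "\<dots> = exp (log_moment c n p)"
    unfolding log_moment_def mc s_def[symmetric] poch' gammas exp_add[symmetric] ..
  finally show ?thesis .
qed

section \<open>The asymptotic expansion of the cumulants\<close>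

text \<open>On the admissible \<open>n\<close> all moments up to order \<open>p\<close> are \<open>exp (log_moment c n i)\<close>, so that
the cumulant is the one whose expansion holds along all natural numbers.\<close>

theorem proposition2:
  fixes p :: nat and c :: real
    and M :: "nat \<Rightarrow> 'w measure" and X :: "nat \<Rightarrow> 'w \<Rightarrow> complex mat"
  assumes "p \<ge> 1" and "0 < c" and "c < 1"
    and "\<And>n m. n > 0 \<Longrightarrow> m > 0 \<Longrightarrow> real n / real m = c \<Longrightarrow> p < n * (m - n + 1) \<Longrightarrow>
           \<exists>N0 > 0. gaussian_matrix (M n) n m N0 (X n)"
  shows "\<forall>N. (\<lambda>n. cumulant (moment (M n) (\<lambda>\<omega>. W0 (X n \<omega>))) p
                 - (\<Sum>j = 0..N. alpha_coeff p j c / real n ^ (2 * (p - 1 + j))))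
           \<in> O[inf at_top (principal {n. n > 0 \<and> (\<exists>m > 0. real n / real m = c \<and> p < n * (m - n + 1))})](
               \<lambda>n. 1 / real n ^ (2 * (p + N)))"
proof
  fix N
  define S where "S = {n. n > 0 \<and> (\<exists>m > 0. real n / real m = c \<and> p < n * (m - n + 1))}"
  define F where "F = inf at_top (principal S)"
  define err where "err = (\<lambda>\<kappa> :: nat \<Rightarrow> real. \<lambda>n. \<kappa> n -
     (\<Sum>j = 0..N. alpha_coeff p j c / real n ^ (2 * (p - 1 + j))))"
  have "err (\<lambda>n. cumulant (\<lambda>b. exp (log_moment c n b)) p) \<in> O(\<lambda>n. 1 / real n ^ (2 * (p + N)))"
    unfolding err_def by (rule cumulant_expansion[OF assms(2,3,1)])
  hence "err (\<lambda>n. cumulant (\<lambda>b. exp (log_moment c n b)) p) \<in> O[F](\<lambda>n. 1 / real n ^ (2 * (p + N)))"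
    by (rule landau_o.big.filter_mono[rotated]) (simp add: F_def)
  moreover have "eventually (\<lambda>n. err (\<lambda>n. cumulant (\<lambda>b. exp (log_moment c n b)) p) n =
      err (\<lambda>n. cumulant (moment (M n) (\<lambda>\<omega>. W0 (X n \<omega>))) p) n) F"
    unfolding F_def eventually_inf_principal
  proof (intro always_eventually allI impI)
    fix n assume "n \<in> S"
    then obtain m where m: "n > 0" "m > 0" "real n / real m = c" "p < n * (m - n + 1)"
      by (auto simp: S_def)
    from assms(4)[OF this] obtain N0 where N0: "N0 > 0" "gaussian_matrix (M n) n m N0 (X n)"
      by blast
    have "cumulant (moment (M n) (\<lambda>\<omega>. W0 (X n \<omega>))) p = cumulant (\<lambda>b. exp (log_moment c n b)) p"
    proof (rule cumulant_cong)
      fix i assume i: "1 \<le> i" "i \<le> p"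
      hence "i < n * (m - n + 1)" using m(4) by linarith
      thus "moment (M n) (\<lambda>\<omega>. W0 (X n \<omega>)) i = exp (log_moment c n i)"
        by (intro moment_W0_eq_exp_log_moment[OF N0(2,1) m(1,2) assms(2,3) m(3) i(1)])
    qed (rule assms(1))
    thus "err (\<lambda>n. cumulant (\<lambda>b. exp (log_moment c n b)) p) n =
      err (\<lambda>n. cumulant (moment (M n) (\<lambda>\<omega>. W0 (X n \<omega>))) p) n" by (simp add: err_def)
  qed
  ultimately have "err (\<lambda>n. cumulant (moment (M n) (\<lambda>\<omega>. W0 (X n \<omega>))) p) \<in> O[F](\<lambda>n. 1 / real n ^ (2 * (p + N)))"
    using landau_o.big.in_cong by blast
  thus "(\<lambda>n. cumulant (moment (M n) (\<lambda>\<omega>. W0 (X n \<omega>))) p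
                 - (\<Sum>j = 0..N. alpha_coeff p j c / real n ^ (2 * (p - 1 + j))))
           \<in> O[inf at_top (principal {n. n > 0 \<and> (\<exists>m > 0. real n / real m = c \<and> p < n * (m - n + 1))})](
               \<lambda>n. 1 / real n ^ (2 * (p + N)))"
    unfolding err_def F_def S_def .
qed

end
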